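(* Let $n\ge 2k\ge 6$ be integers, and let $\mathcal A,\mathcal B\subset\binom{[n]}{k}$ be non-trivial cross-intersecting families with $|\mathcal A||\mathcal B|=h(n,k)^2$. Then $(\mathcal A,\mathcal B)$ is isomorphic to a pair of one of the following three types: a pair of cross-HM type (which requires $n>2k$), a pair of cross-triangle type (which requires $n>2k$ and $k=3$), or a pair of complement-dual type (which requires $n=2k$).
   Context: $[n]=\{1,\dots,n\}$; $\binom{X}{k}$ is the collection of all $k$-subsets of $X$; $h(n,k)=\binom{n-1}{k-1}-\binom{n-k-1}{k-1}+1$. A family is a star if all members contain a common element, and non-trivial otherwise. $\mathcal A,\mathcal B$ are non-trivial cross-intersecting if $A\cap B\ne\emptyset$ for all $A\in\mathcal A,B\in\mathcal B$ and neither is a star. Two pairs of families are isomorphic if one is obtained from the other by applying a single permutation of $[n]$ to both families. Cross-HM type ($n>2k\ge 6$): $(\mathcal A,\mathcal B)=(\mathcal H_x(A_0;B_0),\mathcal H_x(B_0;A_0))$ for some $x\in[n]$ and $A_0,B_0\in\binom{[n]\setminus\{x\}}{k}$ with $A_0\cap B_0\neq\emptyset$, where $\mathcal H_x(A_0;B_0)=\{A\in\binom{[n]}{k}:x\in A,\ A\cap B_0\ne\emptyset\}\cup\{A_0\}$ and $\mathcal H_x(B_0;A_0)=\{B\in\binom{[n]}{k}:x\in B,\ B\cap A_0\ne\emptyset\}\cup\{B_0\}$. Cross-triangle type ($n>2k$, $k=3$): $(\mathcal A,\mathcal B)=(\mathcal T_x(P;Q),\mathcal T_x(Q;P))$ for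 some $x\in[n]$ and $P,Q\in\binom{[n]\setminus\{x\}}{2}$ with $P\cap Q\ne\emptyset$, where $\mathcal T_x(P;Q)=\{A\in\binom{[n]}{3}:x\in A,\ A\cap Q\neq\emptyset\}\cup\{A\in\binom{[n]}{3}:x\notin A,\ P\subset A\}$. Complement-dual type ($n=2k$): $(\mathcal A,\mathcal B)=(\mathcal C,\mathcal C^{\perp})$ where $\mathcal C\subset\binom{[2k]}{k}$ is any non-trivial family with $|\mathcal C|=h(2k,k)=\frac12\binom{2k}{k}$ and $\mathcal C^{\perp}=\binom{[2k]}{k}\setminus\{[2k]\setminus C:C\in\mathcal C\}$. *)

theory Defs
  imports "HOL-Library.Ramsey" "HOL-Combinatorics.Permutations"
begin

text \<open>The ground set is \<open>{1..n}\<close>; the collection of \<open>k\<close>-subsets of \<open>X\<close> is the library's \<open>nsets X k\<close>.\<close>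

text \<open>The subtractions on \<open>nat\<close> are exact whenever \<open>n > k \<ge> 1\<close>.\<close>

definition hm_bound :: "nat \<Rightarrow> nat \<Rightarrow> nat" where
  "hm_bound n k = ((n - 1) choose (k - 1)) - ((n - k - 1) choose (k - 1)) + 1"

definition star :: "nat \<Rightarrow> nat set set \<Rightarrow> bool" where
  "star n F \<longleftrightarrow> (\<exists>x\<in>{1..n}. \<forall>A\<in>F. x \<in> A)"

definition nontrivial :: "nat \<Rightarrow> nat set set \<Rightarrow> bool" where
  "nontrivial n F \<longleftrightarrow> \<not> star n F"

definition cross_intersecting :: "nat set set \<Rightarrow> nat set set \<Rightarrow> bool" where
  "cross_intersecting \<A> \<B> \<longleftrightarrow> (\<forall>A\<in>\<A>. \<forall>B\<in>\<B>. A \<inter> B \<noteq> {})"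

definition nontrivial_cross_intersecting :: "nat \<Rightarrow> nat set set \<Rightarrow> nat set set \<Rightarrow> bool" where
  "nontrivial_cross_intersecting n \<A> \<B> \<longleftrightarrow>
     cross_intersecting \<A> \<B> \<and> nontrivial n \<A> \<and> nontrivial n \<B>"

definition isomorphic_pairs ::
  "nat \<Rightarrow> nat set set \<times> nat set set \<Rightarrow> nat set set \<times> nat set set \<Rightarrow> bool" where
  "isomorphic_pairs n p q \<longleftrightarrow>
     (\<exists>\<pi>. \<pi> permutes {1..n} \<and> fst q = (\<lambda>A. \<pi> ` A) ` fst p \<and> snd q = (\<lambda>B. \<pi> ` B) ` snd p)"

definition HM_family :: "nat \<Rightarrow> nat \<Rightarrow> nat \<Rightarrow> nat set \<Rightarrow> nat set \<Rightarrow> nat set set" where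
  "HM_family n k x A0 B0 = {A \<in> nsets {1..n} k. x \<in> A \<and> A \<inter> B0 \<noteq> {}} \<union> {A0}"

definition cross_HM_type :: "nat \<Rightarrow> nat \<Rightarrow> nat set set \<times> nat set set \<Rightarrow> bool" where
  "cross_HM_type n k p \<longleftrightarrow> n > 2 * k \<and> 2 * k \<ge> 6 \<and>
     (\<exists>x\<in>{1..n}. \<exists>A0\<in>nsets ({1..n} - {x}) k. \<exists>B0\<in>nsets ({1..n} - {x}) k.
        A0 \<inter> B0 \<noteq> {} \<and> p = (HM_family n k x A0 B0, HM_family n k x B0 A0))"

definition triangle_family :: "nat \<Rightarrow> nat \<Rightarrow> nat set \<Rightarrow> nat set \<Rightarrow> nat set set" where
  "triangle_family n x P Q =
     {A \<in> nsets {1..n} 3. x \<in> A \<and> A \<inter> Q \<noteq> {}} \<union> {A \<in> nsets {1..n} 3. x \<notin> A \<and> P \<subseteq> A}"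

definition cross_triangle_type :: "nat \<Rightarrow> nat \<Rightarrow> nat set set \<times> nat set set \<Rightarrow> bool" where
  "cross_triangle_type n k p \<longleftrightarrow> n > 2 * k \<and> k = 3 \<and>
     (\<exists>x\<in>{1..n}. \<exists>P\<in>nsets ({1..n} - {x}) 2. \<exists>Q\<in>nsets ({1..n} - {x}) 2.
        P \<inter> Q \<noteq> {} \<and> p = (triangle_family n x P Q, triangle_family n x Q P))"

definition complement_dual :: "nat \<Rightarrow> nat set set \<Rightarrow> nat set set" where
  "complement_dual k \<C> = nsets {1..2 * k} k - {{1..2 * k} - C | C. C \<in> \<C>}"

text \<open>Only \<open>\<C>\<close> itself is required to be non-trivial, not its dual.
  Note that \<open>hm_bound (2 * k) k\<close> is half of \<open>(2 * k) choose k\<close> for \<open>k \<ge> 1\<close>.\<close>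

definition complement_dual_type :: "nat \<Rightarrow> nat \<Rightarrow> nat set set \<times> nat set set \<Rightarrow> bool" where
  "complement_dual_type n k p \<longleftrightarrow> n = 2 * k \<and>
     (\<exists>\<C>. \<C> \<subseteq> nsets {1..2 * k} k \<and> nontrivial (2 * k) \<C> \<and> card \<C> = hm_bound (2 * k) k \<and>
        p = (\<C>, complement_dual k \<C>))"

end

theory Submission
  imports Defs Complex_Main
begin

text \<open>Write \<open>h = h(n, k)\<close>, \<open>N\<close> for the number of \<open>k\<close>-sets through one point and \<open>D\<close> for the number of those
  through two points. For \<open>n = 2k\<close> complementation gives \<open>|A| + |B| \<le> 2h\<close>, so both sizes are \<open>h\<close> and \<open>B\<close> is
  the dual of \<open>A\<close>. Let \<open>n > 2k\<close>.

  By Kruskal--Katona, if a vertex \<open>x\<close> has degree greater than \<open>D\<close> in \<open>A\<close>, then its degree plus the number of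
  members of \<open>B\<close> avoiding \<open>x\<close> is at most \<open>h\<close>. If both families have a vertex of degree noticeably greater
  than \<open>D\<close>, adding these bounds gives \<open>|A| + |B| \<le> 2h\<close>; so all of them are equalities, and the equality
  cases are the Hilton--Milner and the triangle configuration.

  It remains to exclude pairs in which one family, say \<open>B\<close>, has all degrees at most about \<open>D\<close>. If \<open>n\<close> is
  close to \<open>2k\<close>, then \<open>|B|\<close> is at most about \<open>nD/k\<close> by double counting, and \<open>|A| + |B| \<le> N + h\<close> makes
  the product too small. Otherwise a counterexample that is maximal with respect to the sizes and the
  degrees of \<open>1\<close> is, up to non-triviality, stable under shifts towards \<open>1\<close>. Further shifting and a ballot
  path argument show that at least half of each family contains \<open>1\<close>, and the product is too small again
  because \<open>(h + D)\<^sup>2 < 2 h\<^sup>2\<close>.\<close>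

section \<open>Shifting\<close>

text \<open>Kruskal--Katona turns the local pair at \<open>x\<close>, a link of rank
  \<open>k - 1\<close> against a rest of rank \<open>k\<close>, into two families of rank
  \<open>k - 1\<close> on \<open>n - 2\<close> points, where a Hilton--Milner bound applies. This
  requires a link of more than \<open>D\<close> sets; hence the threshold. Below it the obstacle is
  that a shift can create a star or an extremal pair. Extremal pairs have degree sums that a shift
  cannot produce from low degrees, and a shift that creates a star forces so many sets through two
  points that the product is too small. The condition \<open>(h + D)\<^sup>2 < 2 * h\<^sup>2\<close>
  comes from the last estimate: with \<open>a\<close> members of \<open>A\<close> through
  \<open>1\<close> and \<open>y\<close> members of \<open>B\<close> avoiding \<open>1\<close>, up to
  a unit \<open>|A| \<le> 2a\<close>, \<open>|B| \<le> D + y\<close> and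
  \<open>a + y \<le> h\<close>, so \<open>|A| |B| \<le> 2a(D + y) \<le> (h + D)\<^sup>2 / 2\<close>.
  It says \<open>D / h < sqrt 2 - 1\<close>, whereas \<open>D / h\<close> is close to
  \<open>1 / 2\<close> for large \<open>k\<close> and \<open>n\<close> near \<open>2k\<close>; hence
  the separate averaging argument there. Counterexamples are pairs of product at least
  \<open>h\<^sup>2\<close>, so that adding a set stays in the class.\<close>

definition shift :: "nat \<Rightarrow> nat \<Rightarrow> nat set set \<Rightarrow> nat set set" where
  "shift i j F = {V. if i \<in> V \<and> j \<notin> V then V \<in> F \<or> insert j (V - {i}) \<in> F
                     else if i \<notin> V \<and> j \<in> V then V \<in> F \<and> insert i (V - {j}) \<in> F
                     else V \<in> F}"

lemma swap_back: "j \<in> U \<Longrightarrow> i \<notin> U \<Longrightarrow> insert j (insert i (U - {j}) - {i}) = U"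
  by auto

lemma shift_nsets:
  assumes "F \<subseteq> nsets S r" "i \<in> S" "j \<in> S"
  shows "shift i j F \<subseteq> nsets S r"
proof
  fix V assume V: "V \<in> shift i j F"
  show "V \<in> nsets S r"
  proof (cases "V \<in> F")
    case True then show ?thesis using assms by auto
  next
    case False
    with V have "i \<in> V" "j \<notin> V" and W: "insert j (V - {i}) \<in> F"
      by (auto simp: shift_def split: if_splits)
    from W assms have W': "insert j (V - {i}) \<subseteq> S" "finite (insert j (V - {i}))" "card (insert j (V - {i})) = r"
      by (auto simp: nsets_def)
    then have "finite V" by (metis finite_Diff2 finite.emptyI finite_insert)
    then have "card V = r" using W'(3) \<open>i \<in> V\<close> \<open>j \<notin> V\<close>
      by (simp add: card_insert_if) (metis Suc_pred card_Diff_singleton card_gt_0_iff empty_iff)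
    with W' \<open>finite V\<close> \<open>i \<in> S\<close> show ?thesis by (auto simp: nsets_def)
  qed
qed

text \<open>The compression map itself. \<open>shift\<close> is described by membership instead, and
  \<open>bij_betw_shift_elem\<close> lets sums over the shifted family be taken over the original
  one.\<close>

definition shift_elem :: "nat \<Rightarrow> nat \<Rightarrow> nat set set \<Rightarrow> nat set \<Rightarrow> nat set" where
  "shift_elem i j F U = (if j \<in> U \<and> i \<notin> U \<and> insert i (U - {j}) \<notin> F then insert i (U - {j}) else U)"

lemma bij_betw_shift_elem: "bij_betw (shift_elem i j F) F (shift i j F)"
  unfolding bij_betw_def
proof
  show "inj_on (shift_elem i j F) F"
    by (rule inj_onI) (unfold shift_elem_def, metis swap_back)
  show "shift_elem i j F ` F = shift i j F"
  proof
    show "shift_elem i j F ` F \<subseteq> shift i j F"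
    proof (rule image_subsetI)
      fix U assume U: "U \<in> F"
      show "shift_elem i j F U \<in> shift i j F"
      proof (cases "j \<in> U \<and> i \<notin> U \<and> insert i (U - {j}) \<notin> F")
        case True
        then have "insert j (insert i (U - {j}) - {i}) = U" "i \<noteq> j" by auto
        then show ?thesis using U True by (simp add: shift_elem_def shift_def)
      next
        case False
        then show ?thesis using U by (auto simp: shift_elem_def shift_def)
      qed
    qed
    show "shift i j F \<subseteq> shift_elem i j F ` F"
    proof
      fix V assume V: "V \<in> shift i j F"
      show "V \<in> shift_elem i j F ` F"
      proof (cases "V \<in> F")
        case True
        then have "shift_elem i j F V = V" using V by (auto simp: shift_elem_def shift_def)
        with True show ?thesis by force
      next
        case False
        with V have 1: "i \<in> V" "j \<notin> V" and W: "insert j (V - {i}) \<in> F"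
          by (auto simp: shift_def split: if_splits)
        then have "insert i (insert j (V - {i}) - {j}) = V" by auto
        moreover have "i \<noteq> j" using 1 by auto
        ultimately have "shift_elem i j F (insert j (V - {i})) = V"
          using False by (simp add: shift_elem_def)
        with W show ?thesis by force
      qed
    qed
  qed
qed

lemma card_shift: "card (shift i j F) = card F"
  using bij_betw_same_card[OF bij_betw_shift_elem] by simp

lemma finite_shift: "finite F \<Longrightarrow> finite (shift i j F)"
  using bij_betw_finite[OF bij_betw_shift_elem] by simp

lemma cross_intersecting_commute: "cross_intersecting F G \<longleftrightarrow> cross_intersecting G F"
  by (auto simp: cross_intersecting_def)

lemma cross_intersectingD: "cross_intersecting F G \<Longrightarrow> U \<in> F \<Longrightarrow> V \<in> G \<Longrightarrow> U \<inter> V \<noteq> {}"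
  by (auto simp: cross_intersecting_def)

text \<open>Only a moved set against an unmoved one is in doubt. If they were disjoint, the unmoved
  set would contain \<open>j\<close> but not \<open>i\<close>, so its own swap lies in its family
  and is disjoint from the preimage of the moved set.\<close>

lemma cross_intersecting_shift:
  assumes "cross_intersecting F G" "i \<noteq> j"
  shows "cross_intersecting (shift i j F) (shift i j G)"
proof -
  have *: "U \<inter> V \<noteq> {}" if "U \<in> shift i j F" "V \<in> shift i j G" "U \<in> F" "V \<notin> G"
    and c: "cross_intersecting F G" for U V F G
  proof
    assume d: "U \<inter> V = {}"
    from that have 1: "i \<in> V" "j \<notin> V" and W: "insert j (V - {i}) \<in> G"
      by (auto simp: shift_def split: if_splits)
    with d have "i \<notin> U" by auto
    from cross_intersectingD[OF c \<open>U \<in> F\<close> W] d have "j \<in> U" by auto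
    with \<open>i \<notin> U\<close> that(1) have "insert i (U - {j}) \<in> F" by (auto simp: shift_def)
    from cross_intersectingD[OF c this W] d \<open>i \<noteq> j\<close> show False by auto
  qed
  show ?thesis unfolding cross_intersecting_def
  proof (intro ballI)
    fix U V assume UV: "U \<in> shift i j F" "V \<in> shift i j G"
    consider "U \<in> F" "V \<in> G" | "U \<in> F" "V \<notin> G" | "U \<notin> F" "V \<in> G" | "U \<notin> F" "V \<notin> G" by blast
    then show "U \<inter> V \<noteq> {}"
    proof cases
      case 1 then show ?thesis using assms by (auto simp: cross_intersecting_def)
    next
      case 2 then show ?thesis using *[OF UV _ _ assms(1)] by auto
    next
      case 3 then show ?thesis using *[OF UV(2,1)] assms(1) by (auto simp: cross_intersecting_commute)
    next
      case 4 then show ?thesis using UV by (auto simp: shift_def split: if_splits)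
    qed
  qed
qed

definition shifted_on :: "nat set \<Rightarrow> nat set set \<Rightarrow> bool" where
  "shifted_on S F \<longleftrightarrow> (\<forall>U\<in>F. \<forall>i\<in>S. \<forall>j\<in>U. i < j \<longrightarrow> i \<notin> U \<longrightarrow> insert i (U - {j}) \<in> F)"

lemma shifted_onD: "shifted_on S F \<Longrightarrow> U \<in> F \<Longrightarrow> i \<in> S \<Longrightarrow> j \<in> U \<Longrightarrow> i < j \<Longrightarrow> i \<notin> U \<Longrightarrow> insert i (U - {j}) \<in> F"
  by (auto simp: shifted_on_def)

definition weight :: "nat set set \<Rightarrow> nat" where
  "weight F = (\<Sum>U\<in>F. \<Sum>U)"

lemma sum_swap_less:
  fixes U :: "nat set"
  assumes "finite U" "i < j" "j \<in> U" "i \<notin> U"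
  shows "\<Sum>(insert i (U - {j})) < \<Sum>U"
proof -
  have "\<Sum>U = j + \<Sum>(U - {j})" using assms by (simp add: sum.remove)
  moreover have "\<Sum>(insert i (U - {j})) = i + \<Sum>(U - {j})" using assms by simp
  ultimately show ?thesis using assms by simp
qed

lemma weight_shift:
  assumes "finite F" "\<And>U. U \<in> F \<Longrightarrow> finite U" "i < j"
  shows "weight (shift i j F) \<le> weight F"
    and "U \<in> F \<Longrightarrow> j \<in> U \<Longrightarrow> i \<notin> U \<Longrightarrow> insert i (U - {j}) \<notin> F \<Longrightarrow> weight (shift i j F) < weight F"
proof -
  have eq: "weight (shift i j F) = (\<Sum>U\<in>F. \<Sum>(shift_elem i j F U))"
    unfolding weight_def using sum.reindex_bij_betw[OF bij_betw_shift_elem, of "\<lambda>U. \<Sum>U" i j F] by simp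
  have le: "\<Sum>(shift_elem i j F U) \<le> \<Sum>U" if "U \<in> F" for U
    using sum_swap_less[of U i j] assms that by (auto simp: shift_elem_def)
  show "weight (shift i j F) \<le> weight F"
    unfolding eq unfolding weight_def by (rule sum_mono) (rule le)
  show "weight (shift i j F) < weight F"
    if "U \<in> F" "j \<in> U" "i \<notin> U" "insert i (U - {j}) \<notin> F"
    unfolding eq unfolding weight_def
  proof (rule sum_strict_mono_ex1)
    show "\<exists>U\<in>F. \<Sum>(shift_elem i j F U) < \<Sum>U"
      using that sum_swap_less[of U i j] assms by (intro bexI[of _ U]) (auto simp: shift_elem_def)
  qed (use assms le in auto)
qed

text \<open>Every effective shift lowers the sum of all elements, so shifting ends. The set
  \<open>T\<close> of targets may be smaller than \<open>S\<close>, which allows shifts that leave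
  \<open>1\<close> alone; a single family is handled with an empty partner.\<close>

lemma exists_shifted_pair:
  assumes "P F G" "finite S"
    and sub: "\<And>F G. P F G \<Longrightarrow> F \<subseteq> Pow S \<and> G \<subseteq> Pow S"
    and step: "\<And>F G i j. P F G \<Longrightarrow> i \<in> T \<Longrightarrow> j \<in> S \<Longrightarrow> i < j \<Longrightarrow> P (shift i j F) (shift i j G)"
  obtains F' G' where "P F' G'" "shifted_on T F'" "shifted_on T G'"
proof -
  have "\<exists>F' G'. P F' G' \<and> shifted_on T F' \<and> shifted_on T G'"
    using assms(1)
  proof (induction "weight F + weight G" arbitrary: F G rule: less_induct)
    case less
    show ?case
    proof (cases "shifted_on T F \<and> shifted_on T G")
      case True then show ?thesis using less.prems by blast
    next
      case False
      then obtain U i j where U: "U \<in> F \<and> insert i (U - {j}) \<notin> F \<or> U \<in> G \<and> insert i (U - {j}) \<notin> G"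
         "i \<in> T" "j \<in> U" "i < j" "i \<notin> U"
        unfolding shifted_on_def by blast
      have s: "F \<subseteq> Pow S" "G \<subseteq> Pow S" using sub[OF less.prems] by auto
      then have fin: "finite F" "finite G" "\<And>U. U \<in> F \<Longrightarrow> finite U" "\<And>U. U \<in> G \<Longrightarrow> finite U"
        using \<open>finite S\<close> by (meson finite_Pow_iff finite_subset PowD subsetD)+
      have "j \<in> S" using U s by blast
      have "weight (shift i j F) + weight (shift i j G) < weight F + weight G"
        using U weight_shift[OF fin(1,3) \<open>i < j\<close>] weight_shift[OF fin(2,4) \<open>i < j\<close>]
        by (metis add_le_less_mono add_less_le_mono)
      from less.hyps[OF this step[OF less.prems \<open>i \<in> T\<close> \<open>j \<in> S\<close> \<open>i < j\<close>]] show ?thesis .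
    qed
  qed
  then show ?thesis using that by blast
qed

section \<open>Shadows under shifting\<close>

definition shadow :: "nat set set \<Rightarrow> nat set set" where
  "shadow F = {U - {z} |U z. U \<in> F \<and> z \<in> U}"

lemma shadow_iff: "V \<in> shadow F \<longleftrightarrow> (\<exists>z. z \<notin> V \<and> insert z V \<in> F)"
proof
  assume "V \<in> shadow F"
  then show "\<exists>z. z \<notin> V \<and> insert z V \<in> F" unfolding shadow_def
    by (auto simp: insert_absorb)
next
  assume "\<exists>z. z \<notin> V \<and> insert z V \<in> F"
  then show "V \<in> shadow F" unfolding shadow_def
    by clarsimp (metis Diff_insert_absorb insertI1)
qed

lemma shadow_nsets: "F \<subseteq> nsets S r \<Longrightarrow> shadow F \<subseteq> nsets S (r - 1)"
  by (auto simp: shadow_def nsets_def)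

text \<open>Together with \<open>card_shift\<close> on the right-hand side, a shift does not enlarge
  the shadow, so Kruskal--Katona may be proved for shifted families.\<close>

lemma shadow_shift_subset:
  assumes "i \<noteq> j"
  shows "shadow (shift i j F) \<subseteq> shift i j (shadow F)"
proof
  fix V assume "V \<in> shadow (shift i j F)"
  then obtain z where z: "z \<notin> V" "insert z V \<in> shift i j F" by (auto simp: shadow_iff)
  have sh: "W \<in> shadow F" if "insert y W \<in> F" "y \<notin> W" for W y using that by (auto simp: shadow_iff)
  show "V \<in> shift i j (shadow F)"
  proof (cases "z = i \<or> z = j")
    case False
    then have e: "insert j (insert z V - {i}) = insert z (insert j (V - {i}))"
         "insert i (insert z V - {j}) = insert z (insert i (V - {j}))" by auto
    show ?thesis using z(2) False z(1) unfolding shift_def mem_Collect_eq e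
      by (auto split: if_splits intro: sh)
  next
    case True
    then show ?thesis
    proof
      assume zi: "z = i"
      show ?thesis
      proof (cases "j \<in> V")
        case True
        then have "insert i V \<in> F" using z zi by (auto simp: shift_def)
        moreover have "insert j (insert i (V - {j})) = insert i V" using True by auto
        ultimately have "insert i (V - {j}) \<in> shadow F" "V \<in> shadow F"
          using sh[of j "insert i (V - {j})"] sh[of i V] z zi assms by auto
        then show ?thesis using True z zi by (auto simp: shift_def)
      next
        case False
        moreover have "insert i V - {i} = V" using z zi by auto
        ultimately have "insert i V \<in> F \<or> insert j V \<in> F" using z zi assms
          by (auto simp: shift_def split: if_splits)
        then have "V \<in> shadow F" using sh z zi False by auto
        then show ?thesis using False z zi by (auto simp: shift_def)
      qed
    next
      assume zj: "z = j"
      show ?thesis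
      proof (cases "i \<in> V")
        case True
        then have "insert j V \<in> F" using z zj by (auto simp: shift_def)
        then have "V \<in> shadow F" using sh z zj by auto
        then show ?thesis using True z zj by (auto simp: shift_def)
      next
        case False
        then have "insert j V \<in> F" using z zj assms by (auto simp: shift_def)
        then have "V \<in> shadow F" using sh z zj by auto
        then show ?thesis using False z zj by (auto simp: shift_def)
      qed
    qed
  qed
qed

section \<open>The Kruskal--Katona theorem\<close>

text \<open>\<open>kk m r t\<close> is the size of the shadow of the first \<open>t\<close> sets in the colexicographic order of the
  \<open>r\<close>-subsets of \<open>{..<m}\<close>; \<open>kk_link m r t\<close> is the degree of \<open>0\<close> in such an initial segment over
  \<open>{..<Suc m}\<close>.\<close>

fun kk :: "nat \<Rightarrow> nat \<Rightarrow> nat \<Rightarrow> nat" where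
  "kk 0 r t = 0"
| "kk (Suc m) r t = (if r = 0 then 0 else if t \<le> m choose r then kk m r t
     else (m choose (r - 1)) + kk m (r - 1) (t - (m choose r)))"

fun kk_link :: "nat \<Rightarrow> nat \<Rightarrow> nat \<Rightarrow> nat" where
  "kk_link 0 r t = (if r = 1 then t else 0)"
| "kk_link (Suc m) r t = (if r = 0 then 0 else if t \<le> Suc m choose r then kk_link m r t
     else (m choose (r - 1)) + kk_link m (r - 1) (t - (Suc m choose r)))"

lemma choose_split: "0 < r \<Longrightarrow> Suc m choose r = (m choose r) + (m choose (r - 1))"
  by (cases r) auto

lemma kk_0 [simp]: "kk m r 0 = 0"
  by (induction m) auto

lemma kk_rank_0 [simp]: "kk m 0 t = 0"
  by (cases m) auto

lemma kk_link_rank_0 [simp]: "kk_link m 0 t = 0"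
  by (cases m) auto

lemma kk_le: "t \<le> m choose r \<Longrightarrow> 0 < r \<Longrightarrow> kk m r t \<le> m choose (r - 1)"
proof (induction m arbitrary: r t)
  case (Suc m)
  show ?case
  proof (cases "t \<le> m choose r")
    case True
    then have "kk m r t \<le> m choose (r - 1)" using Suc by simp
    also have "\<dots> \<le> Suc m choose (r - 1)" by (rule binomial_right_mono) simp
    finally show ?thesis using True by simp
  next
    case False
    let ?t = "t - (m choose r)"
    have t: "?t \<le> m choose (r - 1)" using Suc.prems by (simp add: choose_split)
    show ?thesis
    proof (cases "r = 1")
      case True then show ?thesis using False by simp
    next
      case r: False
      then have "kk m (r - 1) ?t \<le> m choose (r - 1 - 1)" using Suc.IH[OF t] Suc.prems by simp
      moreover have "Suc m choose (r - 1) = (m choose (r - 1)) + (m choose (r - 1 - 1))"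
        using r Suc.prems by (intro choose_split) simp
      ultimately show ?thesis using False Suc.prems by simp
    qed
  qed
qed simp

lemma kk_mono: "s \<le> t \<Longrightarrow> t \<le> m choose r \<Longrightarrow> kk m r s \<le> kk m r t"
proof (induction m arbitrary: r s t)
  case (Suc m)
  show ?case
  proof (cases "r = 0")
    case False
    then have c: "Suc m choose r = (m choose r) + (m choose (r - 1))" by (simp add: choose_split)
    consider "t \<le> m choose r" | "s \<le> m choose r" "t > m choose r" | "s > m choose r" by linarith
    then show ?thesis
    proof cases
      case 1 then show ?thesis using Suc False by simp
    next
      case 2
      then have "kk m r s \<le> m choose (r - 1)" using kk_le False by simp
      then show ?thesis using 2 False by simp
    next
      case 3
      then show ?thesis using Suc.prems False Suc.IH[of "s - (m choose r)" "t - (m choose r)" "r - 1"] c by simp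
    qed
  qed simp
qed simp

lemma kk_pos: "0 < t \<Longrightarrow> t \<le> m choose r \<Longrightarrow> 0 < r \<Longrightarrow> 0 < kk m r t"
proof (induction m arbitrary: r t)
  case 0
  then show ?case by (cases r) auto
next
  case (Suc m)
  then have c: "Suc m choose r = (m choose r) + (m choose (r - 1))" by (simp add: choose_split)
  show ?case
  proof (cases "t \<le> m choose r")
    case True then show ?thesis using Suc by simp
  next
    case False
    then have "0 < m choose (r - 1)" using Suc.prems c by linarith
    then show ?thesis using False Suc.prems by simp
  qed
qed

lemma kk_link_pos: "0 < t \<Longrightarrow> t \<le> Suc m choose r \<Longrightarrow> 0 < r \<Longrightarrow> 0 < kk_link m r t"
proof (induction m arbitrary: r t)
  case 0
  then show ?case by (cases r; cases "r - 1") auto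
next
  case (Suc m)
  then have c: "Suc (Suc m) choose r = (Suc m choose r) + (Suc m choose (r - 1))" by (simp only: choose_split)
  show ?case
  proof (cases "t \<le> Suc m choose r")
    case True then show ?thesis using Suc by simp
  next
    case False
    let ?t = "t - (Suc m choose r)"
    have t: "0 < ?t" "?t \<le> Suc m choose (r - 1)" using False Suc.prems(2) c by linarith+
    show ?thesis
    proof (cases "r = 1")
      case True then show ?thesis using False by simp
    next
      case r: False
      then show ?thesis using Suc.IH[OF t] False Suc.prems by simp
    qed
  qed
qed

lemma kk_link_le: "t \<le> Suc m choose r \<Longrightarrow> 0 < r \<Longrightarrow> kk_link m r t \<le> m choose (r - 1)"
proof (induction m arbitrary: r t)
  case 0
  then show ?case by (cases "r = 1") auto
next
  case (Suc m)
  then have c: "Suc (Suc m) choose r = (Suc m choose r) + (Suc m choose (r - 1))" by (simp only: choose_split)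
  show ?case
  proof (cases "t \<le> Suc m choose r")
    case True
    then have "kk_link m r t \<le> m choose (r - 1)" using Suc by simp
    also have "\<dots> \<le> Suc m choose (r - 1)" by (rule binomial_right_mono) simp
    finally show ?thesis using True Suc.prems by simp
  next
    case False
    let ?t = "t - (Suc m choose r)"
    have t: "?t \<le> Suc m choose (r - 1)" using False Suc.prems(1) c by linarith
    show ?thesis
    proof (cases "r = 1")
      case True then show ?thesis using False by simp
    next
      case r: False
      then have "kk_link m (r - 1) ?t \<le> m choose (r - 1 - 1)" using Suc.IH[OF t] Suc.prems by simp
      moreover have "Suc m choose (r - 1) = (m choose (r - 1)) + (m choose (r - 1 - 1))"
        using r Suc.prems by (intro choose_split) simp
      ultimately show ?thesis using False Suc.prems by simp
    qed
  qed
qed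

text \<open>In an initial segment the shadow elements avoiding \<open>0\<close> are the members of
  the link of \<open>0\<close>, and those containing \<open>0\<close> come from the shadow of the
  link. Here this is an identity between the two recursions.\<close>

lemma kk_eq_link:
  "t \<le> Suc m choose r \<Longrightarrow> kk (Suc m) r t = kk_link m r t + kk m (r - 1) (kk_link m r t)"
proof (induction m arbitrary: r t)
  case 0
  then show ?case by (cases "r = 0"; cases "r = 1") auto
next
  case (Suc m)
  show ?case
  proof (cases "r = 0")
    case r: False
    then have c: "Suc (Suc m) choose r = (Suc m choose r) + (Suc m choose (r - 1))" by (simp only: choose_split)
    show ?thesis
    proof (cases "t \<le> Suc m choose r")
      case True
      have le: "kk_link m r t \<le> m choose (r - 1)" using kk_link_le[OF True] r by simp
      have "kk (Suc (Suc m)) r t = kk (Suc m) r t" using True r by simp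
      also have "\<dots> = kk_link m r t + kk m (r - 1) (kk_link m r t)" using Suc.IH[OF True] .
      also have "kk m (r - 1) (kk_link m r t) = kk (Suc m) (r - 1) (kk_link m r t)" using le by simp
      finally show ?thesis using True r by simp
    next
      case False
      let ?t = "t - (Suc m choose r)"
      let ?s = "kk_link m (r - 1) ?t"
      have t: "0 < ?t" "?t \<le> Suc m choose (r - 1)" using False Suc.prems(1) c by linarith+
      have lhs: "kk (Suc (Suc m)) r t = (Suc m choose (r - 1)) + kk (Suc m) (r - 1) ?t" using False r by simp
      have link: "kk_link (Suc m) r t = (m choose (r - 1)) + ?s" using False r by simp
      show ?thesis
      proof (cases "r = 1")
        case True then show ?thesis unfolding lhs link by simp
      next
        case r1: False
        then have s: "0 < ?s" using kk_link_pos[OF t] r by simp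
        have c': "Suc m choose (r - 1) = (m choose (r - 1)) + (m choose (r - 1 - 1))"
          using r r1 by (intro choose_split) simp
        have "kk (Suc m) (r - 1) ?t = ?s + kk m (r - 1 - 1) ?s" by (rule Suc.IH[OF t(2)])
        moreover have "kk (Suc m) (r - 1) (kk_link (Suc m) r t) = (m choose (r - 1 - 1)) + kk m (r - 1 - 1) ?s"
          unfolding link using s r r1 by simp
        ultimately show ?thesis unfolding lhs link c' by simp
      qed
    qed
  qed simp
qed

lemma kk_link_le_self: "t \<le> Suc m choose r \<Longrightarrow> kk_link m r t \<le> t"
proof (induction m arbitrary: r t)
  case (Suc m)
  show ?case
  proof (cases "r = 0 \<or> t \<le> Suc m choose r")
    case True then show ?thesis using Suc by auto
  next
    case False
    then have "0 < r" by simp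
    then have c: "Suc (Suc m) choose r = (Suc m choose r) + (Suc m choose (r - 1))"
      "Suc m choose r = (m choose r) + (m choose (r - 1))" by (simp_all only: choose_split)
    have "kk_link m (r - 1) (t - (Suc m choose r)) \<le> t - (Suc m choose r)"
      using Suc.IH[of "t - (Suc m choose r)" "r - 1"] Suc.prems c by simp
    moreover have "kk_link (Suc m) r t = (m choose (r - 1)) + kk_link m (r - 1) (t - (Suc m choose r))"
      using False by simp
    ultimately show ?thesis using False c(2) by linarith
  qed
qed simp

text \<open>This excludes a link that is too small: with fewer than \<open>kk_link m r t\<close>
  sets through the least point, at least \<open>t - kk_link m r t + 1\<close> sets avoid it, and
  their shadow, which in a shifted family lies inside the link, would already have
  \<open>kk_link m r t\<close> members.\<close>

lemma kk_link_residual: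
  assumes "0 < t" "t \<le> Suc m choose r" "0 < r" "t - kk_link m r t + 1 \<le> m choose r"
  shows "kk_link m r t \<le> kk m r (t - kk_link m r t + 1)"
  using assms
proof (induction m arbitrary: r t)
  case 0
  then show ?case by (cases "r = 1") auto
next
  case (Suc m)
  have c: "Suc (Suc m) choose r = (Suc m choose r) + (Suc m choose (r - 1))"
      "Suc m choose r = (m choose r) + (m choose (r - 1))" using Suc.prems by (simp_all only: choose_split)
  show ?case
  proof (cases "t \<le> Suc m choose r")
    case True
    have link: "kk_link (Suc m) r t = kk_link m r t" using True Suc.prems by simp
    show ?thesis
    proof (cases "t - kk_link m r t + 1 \<le> m choose r")
      case T: True
      then show ?thesis using Suc.IH[OF Suc.prems(1) True Suc.prems(3)] unfolding link using Suc.prems(3) by simp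
    next
      case F: False
      then have "m choose (r - 1) \<le> kk (Suc m) r (t - kk_link m r t + 1)" using Suc.prems(3) by simp
      then show ?thesis unfolding link using kk_link_le[OF True Suc.prems(3)] by linarith
    qed
  next
    case False
    let ?t = "t - (Suc m choose r)"
    let ?s = "kk_link m (r - 1) ?t"
    have t: "0 < ?t" "?t \<le> Suc m choose (r - 1)" using False Suc.prems(2) c by linarith+
    have link: "kk_link (Suc m) r t = (m choose (r - 1)) + ?s" using False Suc.prems by simp
    show ?thesis
    proof (cases "r = 1")
      case True
      then have "?s = 0" by simp
      then show ?thesis using Suc.prems t True unfolding link by simp
    next
      case r1: False
      have s_le: "?s \<le> ?t" by (rule kk_link_le_self[OF t(2)])
      have eq: "t - kk_link (Suc m) r t + 1 = (m choose r) + (?t - ?s + 1)"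
        unfolding link using s_le False c(2) by linarith
      have b: "?t - ?s + 1 \<le> m choose (r - 1)" using Suc.prems(4) unfolding eq c(2) by linarith
      have "?s \<le> kk m (r - 1) (?t - ?s + 1)" using Suc.IH[OF t] b r1 Suc.prems(3) by simp
      then have "(m choose (r - 1)) + ?s \<le> kk (Suc m) r ((m choose r) + (?t - ?s + 1))"
        using Suc.prems(3) by simp
      then show ?thesis unfolding eq unfolding link .
    qed
  qed
qed

section \<open>Links and deletions of a vertex\<close>

lemma card_partition_elem:
  assumes "finite F"
  shows "card F = card {U \<in> F. x \<in> U} + card {U \<in> F. x \<notin> U}"
proof -
  have "F = {U \<in> F. x \<in> U} \<union> {U \<in> F. x \<notin> U}" by auto
  then show ?thesis using assms card_Un_disjoint[of "{U \<in> F. x \<in> U}" "{U \<in> F. x \<notin> U}"] by auto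
qed

definition link :: "nat \<Rightarrow> nat set set \<Rightarrow> nat set set" where
  "link x F = {V. x \<notin> V \<and> insert x V \<in> F}"

definition avoid :: "nat \<Rightarrow> nat set set \<Rightarrow> nat set set" where
  "avoid x F = {U \<in> F. x \<notin> U}"

lemma bij_betw_link: "bij_betw (insert x) (link x F) {U \<in> F. x \<in> U}"
proof -
  have "U \<in> insert x ` link x F" if "U \<in> F" "x \<in> U" for U
    using that by (intro image_eqI[of _ _ "U - {x}"]) (auto simp: link_def insert_absorb)
  then show ?thesis unfolding bij_betw_def
    by (auto simp: link_def inj_on_def insert_ident)
qed

lemma card_link: "card (link x F) = card {U \<in> F. x \<in> U}"
  using bij_betw_link bij_betw_same_card by blast

lemma card_link_avoid: "finite F \<Longrightarrow> card F = card (link x F) + card (avoid x F)"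
  unfolding card_link avoid_def by (rule card_partition_elem)

lemma link_nsets: "F \<subseteq> nsets S r \<Longrightarrow> link x F \<subseteq> nsets (S - {x}) (r - 1)"
  by (auto simp: link_def nsets_def)

lemma avoid_nsets: "F \<subseteq> nsets S r \<Longrightarrow> avoid x F \<subseteq> nsets (S - {x}) r"
  by (auto simp: avoid_def nsets_def)

lemma finite_subset_nsets: "F \<subseteq> nsets S r \<Longrightarrow> finite S \<Longrightarrow> finite F"
  using finite_imp_finite_nsets finite_subset by metis

lemma card_subset_nsets_le: "F \<subseteq> nsets S r \<Longrightarrow> finite S \<Longrightarrow> card F \<le> card S choose r"
  by (metis card_mono card_nsets finite_imp_finite_nsets)

text \<open>Induction on the ground set after shifting, splitting at its least point
  \<open>x\<close>: the shadow contains the link of \<open>x\<close> and, with \<open>x\<close>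
  added, the shadow of the link.\<close>

theorem kruskal_katona:
  assumes "finite S" "F \<subseteq> nsets S r"
  shows "kk (card S) r (card F) \<le> card (shadow F)"
  using assms
proof (induction "card S" arbitrary: S F r)
  case 0 then show ?case by simp
next
  case (Suc m)
  have S: "S \<noteq> {}" "finite S" using Suc.hyps Suc.prems by auto
  show ?case
  proof (cases "F = {} \<or> r = 0")
    case True then show ?thesis by auto
  next
    case False
    define P where "P = (\<lambda>G H. G \<subseteq> nsets S r \<and> card G = card F \<and> card (shadow G) \<le> card (shadow F) \<and> H = ({} :: nat set set))"
    have P1: "P F {}" using Suc.prems by (simp add: P_def)
    have P2: "G \<subseteq> Pow S \<and> H \<subseteq> Pow S" if "P G H" for G H
      using that by (auto simp: P_def nsets_def)
    have P3: "P (shift i j G) (shift i j H)" if "P G H" "i \<in> S" "j \<in> S" "i < j" for G H i j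
    proof -
      have G: "G \<subseteq> nsets S r" using that by (simp add: P_def)
      have "finite (shift i j (shadow G))"
        using finite_shift finite_subset_nsets[OF shadow_nsets[OF G]] S by blast
      then have "card (shadow (shift i j G)) \<le> card (shadow G)"
        using card_mono[OF _ shadow_shift_subset, of i j G] that card_shift by auto
      moreover have "shift i j {} = {}" by (auto simp: shift_def)
      ultimately show ?thesis using that shift_nsets[OF G] by (auto simp: P_def card_shift)
    qed
    obtain G H where GH: "P G H" and sh: "shifted_on S G"
      using exists_shifted_pair[of P, OF P1 S(2) P2 P3] by blast
    then have G: "G \<subseteq> nsets S r" "card G = card F" "card (shadow G) \<le> card (shadow F)"
      by (simp_all add: P_def)
    define x where "x = Min S"
    have x: "x \<in> S" "\<And>y. y \<in> S \<Longrightarrow> x \<le> y" using S by (auto simp: x_def)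
    have finG: "finite G" using finite_subset_nsets[OF G(1) S(2)] .
    have cS: "card (S - {x}) = m" using Suc.hyps x S by simp
    let ?t = "card F"
    have t: "0 < ?t" "?t \<le> Suc m choose r"
      using False finite_subset_nsets[OF Suc.prems(2) S(2)] card_subset_nsets_le[OF Suc.prems(2) S(2)]
        Suc.hyps(2) by (auto simp: card_gt_0_iff)
    have r: "0 < r" using False by simp
    have sub: "shadow (avoid x G) \<subseteq> link x G"
    proof
      fix V assume "V \<in> shadow (avoid x G)"
      then obtain z where z: "z \<notin> V" "insert z V \<in> G" "x \<notin> insert z V" by (auto simp: shadow_iff avoid_def)
      then have "z \<in> S" using G by (auto simp: nsets_def)
      then have "x < z" using x(2)[of z] z by auto
      have "insert x (insert z V - {z}) \<in> G"
        by (rule shifted_onD[OF sh]) (use z x \<open>x < z\<close> in auto)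
      then show "V \<in> link x G" using z by (simp add: link_def)
    qed
    have fl: "finite (link x G)" using finite_subset_nsets[OF link_nsets[OF G(1)]] S by auto
    have split: "?t = card (link x G) + card (avoid x G)" using card_link_avoid[OF finG] G by simp
    have avoid_le: "card (avoid x G) \<le> m choose r"
      using card_subset_nsets_le[OF avoid_nsets[OF G(1), of x]] S cS by simp
    have link_ge: "kk_link m r ?t \<le> card (link x G)"
    proof (rule ccontr)
      assume "\<not> ?thesis"
      then have lt: "card (link x G) < kk_link m r ?t" by simp
      then have ge: "?t - kk_link m r ?t + 1 \<le> card (avoid x G)"
        using split kk_link_le_self[OF t(2)] by linarith
      have "kk_link m r ?t \<le> kk m r (?t - kk_link m r ?t + 1)"
        by (rule kk_link_residual[OF t r]) (use ge avoid_le in linarith)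
      also have "\<dots> \<le> kk m r (card (avoid x G))" by (rule kk_mono[OF ge avoid_le])
      also have "\<dots> \<le> card (shadow (avoid x G))"
        using Suc.hyps(1)[of "S - {x}" "avoid x G" r] cS S avoid_nsets[OF G(1)] by simp
      also have "\<dots> \<le> card (link x G)" by (rule card_mono[OF fl sub])
      finally show False using lt by simp
    qed
    have link_le: "card (link x G) \<le> m choose (r - 1)"
      using card_subset_nsets_le[OF link_nsets[OF G(1), of x]] S cS by simp
    have "kk (Suc m) r ?t = kk_link m r ?t + kk m (r - 1) (kk_link m r ?t)" by (rule kk_eq_link[OF t(2)])
    also have "\<dots> \<le> card (link x G) + kk m (r - 1) (card (link x G))"
      using link_ge kk_mono[OF link_ge link_le] by simp
    also have "\<dots> \<le> card (link x G) + card (shadow (link x G))"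
      using Suc.hyps(1)[of "S - {x}" "link x G" "r - 1"] cS S link_nsets[OF G(1)] by simp
    also have "\<dots> = card (link x G \<union> insert x ` shadow (link x G))"
    proof -
      have "card (insert x ` shadow (link x G)) = card (shadow (link x G))"
        by (rule card_image) (auto simp: inj_on_def shadow_iff link_def insert_ident)
      moreover have "finite (shadow (link x G))"
        using finite_subset_nsets[OF shadow_nsets[OF link_nsets[OF G(1)]]] S by blast
      moreover have "link x G \<inter> insert x ` shadow (link x G) = {}" by (auto simp: link_def)
      ultimately show ?thesis using fl by (simp add: card_Un_disjoint)
    qed
    also have "\<dots> \<le> card (shadow G)"
    proof (rule card_mono)
      show "finite (shadow G)" using finite_subset_nsets[OF shadow_nsets[OF G(1)]] S by blast
      show "link x G \<union> insert x ` shadow (link x G) \<subseteq> shadow G"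
        by (auto simp: link_def shadow_iff insert_commute)
    qed
    finally show ?thesis using G Suc.hyps(2) by simp
  qed
qed

section \<open>Comparison with colexicographic initial segments\<close>

text \<open>The initial segment itself and not only its size: \<open>hilton_reduction\<close> has to
  produce actual cross-intersecting families.\<close>

fun colex_family :: "nat \<Rightarrow> nat \<Rightarrow> nat \<Rightarrow> nat set set" where
  "colex_family 0 r t = (if t = 0 \<or> r \<noteq> 0 then {} else {{}})"
| "colex_family (Suc m) r t = (if r = 0 then (if t = 0 then {} else {{}})
     else if t \<le> m choose r then colex_family m r t
     else nsets {..<m} r \<union> insert m ` colex_family m (r - 1) (t - (m choose r)))"

lemma colex_family_rank_0: "colex_family m 0 t = (if t = 0 then {} else {{}})"
  by (cases m) auto

lemma colex_family_nsets: "colex_family m r t \<subseteq> nsets {..<m} r"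
proof (induction m arbitrary: r t)
  case (Suc m)
  have "insert m V \<in> nsets {..<Suc m} r" if "V \<in> colex_family m (r - 1) s" "0 < r" for V s
  proof -
    have "V \<in> nsets {..<m} (r - 1)" using that Suc.IH by blast
    then show ?thesis using that(2) by (auto simp: nsets_def card_insert_if)
  qed
  moreover have "nsets {..<m} r \<subseteq> nsets {..<Suc m} r" by (rule nsets_mono) auto
  ultimately show ?case using Suc.IH[of r t] by auto
qed auto

lemma card_colex_family: "t \<le> m choose r \<Longrightarrow> card (colex_family m r t) = t"
proof (induction m arbitrary: r t)
  case 0
  then show ?case by (cases r) auto
next
  case (Suc m)
  show ?case
  proof (cases "r = 0 \<or> t \<le> m choose r")
    case True
    then show ?thesis using Suc by auto
  next
    case False
    let ?G = "colex_family m (r - 1) (t - (m choose r))"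
    have G: "?G \<subseteq> nsets {..<m} (r - 1)" by (rule colex_family_nsets)
    have "card ?G = t - (m choose r)" using Suc False by (simp add: choose_split)
    moreover have "card (insert m ` ?G) = card ?G"
    proof (rule card_image, rule inj_onI)
      fix V W assume VW: "V \<in> ?G" "W \<in> ?G" "insert m V = insert m W"
      then have "m \<notin> V" "m \<notin> W" using G by (auto simp: nsets_def)
      then show "V = W" using VW(3) by (simp add: insert_ident)
    qed
    moreover have "nsets {..<m} r \<inter> insert m ` ?G = {}" by (auto simp: nsets_def)
    moreover have "finite ?G" using finite_subset_nsets[OF G] by simp
    moreover have "card (nsets {..<m} r) = m choose r" by (simp add: card_nsets)
    ultimately show ?thesis using False
      by (simp add: card_Un_disjoint finite_imp_finite_nsets)
  qed
qed

lemma shadow_insert_image: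
  assumes "\<And>V. V \<in> G \<Longrightarrow> m \<notin> V"
  shows "shadow (insert m ` G) = G \<union> insert m ` shadow G"
proof
  show "shadow (insert m ` G) \<subseteq> G \<union> insert m ` shadow G"
  proof
    fix W assume "W \<in> shadow (insert m ` G)"
    then obtain V z where V: "V \<in> G" "z \<in> insert m V" "W = insert m V - {z}" by (auto simp: shadow_def)
    show "W \<in> G \<union> insert m ` shadow G"
    proof (cases "z = m")
      case True then show ?thesis using V assms[OF V(1)] by simp
    next
      case False
      then have "W = insert m (V - {z})" "V - {z} \<in> shadow G" using V by (auto simp: shadow_def)
      then show ?thesis by blast
    qed
  qed
  show "G \<union> insert m ` shadow G \<subseteq> shadow (insert m ` G)"
  proof -
    have "V \<in> shadow (insert m ` G)" if "V \<in> G" for V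
      using that assms[OF that] by (auto simp: shadow_iff)
    moreover have "insert m V \<in> shadow (insert m ` G)" if V: "V \<in> shadow G" for V
    proof -
      obtain z where z: "z \<notin> V" "insert z V \<in> G" using V by (auto simp: shadow_iff)
      then have "z \<notin> insert m V" "insert z (insert m V) \<in> insert m ` G"
        using assms[OF z(2)] by (auto simp: insert_commute)
      then show ?thesis by (auto simp: shadow_iff)
    qed
    ultimately show ?thesis by blast
  qed
qed

lemma shadow_Un: "shadow (F \<union> G) = shadow F \<union> shadow G"
  by (auto simp: shadow_def)

lemma shadow_colex_family:
  "t \<le> m choose r \<Longrightarrow> 0 < r \<Longrightarrow> shadow (colex_family m r t) = colex_family m (r - 1) (kk m r t)"
proof (induction m arbitrary: r t)
  case 0
  then show ?case by (auto simp: shadow_def)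
next
  case (Suc m)
  show ?case
  proof (cases "t \<le> m choose r")
    case True
    then show ?thesis using Suc kk_le[OF True] by (auto simp: colex_family_rank_0)
  next
    case False
    let ?t = "t - (m choose r)"
    let ?G = "colex_family m (r - 1) ?t"
    have t: "0 < ?t" "?t \<le> m choose (r - 1)" using False Suc.prems by (simp_all add: choose_split)
    have G: "?G \<subseteq> nsets {..<m} (r - 1)" by (rule colex_family_nsets)
    have "?G \<noteq> {}" using card_colex_family[OF t(2)] t(1) by auto
    have "nsets {..<m} (r - 1) \<subseteq> shadow (nsets {..<m} r) \<union> ?G"
    proof
      fix V assume V: "V \<in> nsets {..<m} (r - 1)"
      show "V \<in> shadow (nsets {..<m} r) \<union> ?G"
      proof (cases "V = {..<m}")
        \<comment> \<open>Here \<open>nsets {..<m} r\<close> is empty and so is its shadow; the only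
          set of size \<open>m\<close> comes from \<open>?G\<close>.\<close>
        case True
        then have rm: "r - 1 = m" using V by (simp add: nsets_def)
        have "nsets {..<m} (r - 1) = {{..<m}}" unfolding rm by (rule nsets_self)
        then have "?G \<subseteq> {V}" using G True by simp
        then show ?thesis using \<open>?G \<noteq> {}\<close> by (metis UnI2 insertI1 subset_singletonD)
      next
        case False
        then obtain z where "z < m" "z \<notin> V" using V by (auto simp: nsets_def)
        then have "insert z V \<in> nsets {..<m} r" using V Suc.prems by (auto simp: nsets_def)
        then show ?thesis using \<open>z \<notin> V\<close> by (auto simp: shadow_iff)
      qed
    qed
    moreover have "shadow (nsets {..<m} r) \<subseteq> nsets {..<m} (r - 1)" by (rule shadow_nsets) simp
    moreover have "shadow (insert m ` ?G) = ?G \<union> insert m ` shadow ?G"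
      by (rule shadow_insert_image) (use G in \<open>auto simp: nsets_def\<close>)
    ultimately have L: "shadow (colex_family (Suc m) r t) = nsets {..<m} (r - 1) \<union> insert m ` shadow ?G"
      using False Suc.prems G by (auto simp: shadow_Un)
    show ?thesis
    proof (cases "r = 1")
      case True
      then have "shadow ?G = {}" by (auto simp: colex_family_rank_0 shadow_def)
      then show ?thesis unfolding L using True False by (simp add: colex_family_rank_0)
    next
      case r: False
      then have "0 < kk m (r - 1) ?t" using kk_pos[OF t] Suc.prems by simp
      then show ?thesis unfolding L using Suc.IH[OF t(2)] r False Suc.prems by simp
    qed
  qed
qed

section \<open>Iterated shadows and Hilton's reduction\<close>

fun kk_iter :: "nat \<Rightarrow> nat \<Rightarrow> nat \<Rightarrow> nat \<Rightarrow> nat" where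
  "kk_iter 0 m r t = t"
| "kk_iter (Suc d) m r t = kk_iter d m (r - 1) (kk m r t)"

lemma kk_iter_mono: "s \<le> t \<Longrightarrow> t \<le> m choose r \<Longrightarrow> d \<le> r \<Longrightarrow> kk_iter d m r s \<le> kk_iter d m r t"
proof (induction d arbitrary: r s t)
  case (Suc d)
  then show ?case using Suc.IH[OF kk_mono[OF Suc.prems(1,2)] kk_le[OF Suc.prems(2)]] by simp
qed simp

lemma kk_iter_le_card:
  "F \<subseteq> nsets S r \<Longrightarrow> finite S \<Longrightarrow> d \<le> r \<Longrightarrow> kk_iter d (card S) r (card F) \<le> card ((shadow ^^ d) F)"
proof (induction d arbitrary: F r)
  case (Suc d)
  have sh: "shadow F \<subseteq> nsets S (r - 1)" by (rule shadow_nsets[OF Suc.prems(1)])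
  have "kk_iter (Suc d) (card S) r (card F) \<le> kk_iter d (card S) (r - 1) (card (shadow F))"
    using kk_iter_mono[OF kruskal_katona[OF Suc.prems(2,1)] card_subset_nsets_le[OF sh Suc.prems(2)]]
      Suc.prems by simp
  also have "\<dots> \<le> card ((shadow ^^ d) (shadow F))" using Suc.IH[OF sh] Suc.prems by simp
  finally show ?case by (simp add: funpow_Suc_right del: funpow.simps)
qed simp

lemma shadow_funpow_colex_family:
  "t \<le> m choose r \<Longrightarrow> d \<le> r \<Longrightarrow>
    (shadow ^^ d) (colex_family m r t) = colex_family m (r - d) (kk_iter d m r t) \<and> kk_iter d m r t \<le> m choose (r - d)"
proof (induction d arbitrary: r t)
  case (Suc d)
  then show ?case using Suc.IH[of "kk m r t" "r - 1"] kk_le[of t m r]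
    by (simp add: funpow_Suc_right shadow_colex_family del: funpow.simps)
qed simp

text \<open>A segment longer than \<open>m choose r\<close> contains all \<open>r\<close>-subsets of
  \<open>{..<m}\<close>, whose shadows contribute the first summand; the excess evolves like a
  segment of rank \<open>r - 1\<close> on \<open>m\<close> points.\<close>

lemma kk_iter_split:
  "m choose r < t \<Longrightarrow> t \<le> Suc m choose r \<Longrightarrow> d < r \<Longrightarrow>
    kk_iter d (Suc m) r t = (m choose (r - d)) + kk_iter d m (r - 1) (t - (m choose r))"
proof (induction d arbitrary: r t)
  case (Suc d)
  let ?t = "t - (m choose r)"
  have t: "0 < ?t" "?t \<le> m choose (r - 1)" using Suc.prems by (simp_all add: choose_split)
  have pos: "0 < kk m (r - 1) ?t" using kk_pos[OF t] Suc.prems by simp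
  have eq: "kk (Suc m) r t = (m choose (r - 1)) + kk m (r - 1) ?t" using Suc.prems by simp
  have "kk_iter d (Suc m) (r - 1) (kk (Suc m) r t)
      = (m choose (r - 1 - d)) + kk_iter d m (r - 1 - 1) (kk (Suc m) r t - (m choose (r - 1)))"
    by (rule Suc.IH) (use pos eq kk_le[OF Suc.prems(2)] Suc.prems in auto)
  then show ?case unfolding eq using eq by simp
qed simp

lemma subset_imp_mem_shadow_funpow:
  "V \<subseteq> U \<Longrightarrow> U \<in> F \<Longrightarrow> finite U \<Longrightarrow> card U = card V + d \<Longrightarrow> V \<in> (shadow ^^ d) F"
proof (induction d arbitrary: U F)
  case 0
  then have "V = U" by (simp add: card_subset_eq)
  then show ?case using 0 by simp
next
  case (Suc d)
  then have "V \<noteq> U" by auto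
  then obtain z where z: "z \<in> U" "z \<notin> V" using Suc.prems by blast
  have "V \<in> (shadow ^^ d) (shadow F)"
    by (rule Suc.IH[of "U - {z}"]) (use z Suc.prems in \<open>auto simp: shadow_def\<close>)
  then show ?case by (simp add: funpow_Suc_right del: funpow.simps)
qed

lemma mem_shadow_funpow_imp_subset:
  "V \<in> (shadow ^^ d) F \<Longrightarrow> \<exists>U\<in>F. V \<subseteq> U"
proof (induction d arbitrary: F)
  case (Suc d)
  then have "V \<in> (shadow ^^ d) (shadow F)" by (simp add: funpow_Suc_right del: funpow.simps)
  from Suc.IH[OF this] show ?case by (auto simp: shadow_def)
qed auto

lemma shadow_funpow_nsets: "F \<subseteq> nsets S r \<Longrightarrow> (shadow ^^ d) F \<subseteq> nsets S (r - d)"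
proof (induction d arbitrary: F r)
  case (Suc d)
  from Suc.IH[OF shadow_nsets[OF Suc.prems]] show ?case by (simp add: funpow_Suc_right del: funpow.simps)
qed simp

lemma card_complement_image:
  assumes "finite S" "F \<subseteq> nsets S p"
  shows "card ((\<lambda>U. S - U) ` F) = card F" "(\<lambda>U. S - U) ` F \<subseteq> nsets S (card S - p)"
proof -
  have "inj_on (\<lambda>U. S - U) F" using assms(2)
    by (intro inj_on_inverseI[of _ "\<lambda>U. S - U"]) (auto simp: nsets_def)
  then show "card ((\<lambda>U. S - U) ` F) = card F" by (rule card_image)
  show "(\<lambda>U. S - U) ` F \<subseteq> nsets S (card S - p)"
    using assms by (auto simp: nsets_def card_Diff_subset)
qed

text \<open>\<open>X\<close> and \<open>Y\<close> cross-intersect iff \<open>Y\<close> misses the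
  \<open>d\<close>-fold shadow of the complements of \<open>X\<close>, so complements forming an
  initial segment leave most room for \<open>Y\<close>. In that position a large \<open>X\<close>
  contains every \<open>p\<close>-set through one fixed point and all members of \<open>Y\<close>
  contain this point; it is deleted from \<open>Y\<close>, and \<open>X\<close> keeps the members
  avoiding it.\<close>

theorem hilton_reduction:
  assumes S: "finite S" "card S = Suc m"
    and X: "X \<subseteq> nsets S p" and Y: "Y \<subseteq> nsets S q" and cr: "cross_intersecting X Y"
    and pq: "p + q \<le> Suc m" "0 < p" "0 < q" and big: "m choose (p - 1) < card X"
  obtains X' Y' where "X' \<subseteq> nsets {..<m} p" "Y' \<subseteq> nsets {..<m} (q - 1)" "cross_intersecting X' Y'"
    "card X = card X' + (m choose (p - 1))" "card Y' = card Y"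
proof -
  define r where "r = Suc m - p"
  define d where "d = r - q"
  have rd: "r - d = q" "d < r" "0 < r" "r - 1 - d = q - 1" "d \<le> r - 1" "m - (r - 1) = p"
    using pq by (auto simp: r_def d_def)
  have mr: "m choose r = m choose (p - 1)"
    using binomial_symmetric[of r m] pq unfolding r_def by (simp add: Suc_diff_le le_diff_conv)
  define F where "F = (\<lambda>U. S - U) ` X"
  have F: "card F = card X" "F \<subseteq> nsets S r"
    using card_complement_image[OF S(1) X] S(2) by (auto simp: F_def r_def)
  let ?t = "card X - (m choose r)"
  have tX: "card X \<le> Suc m choose r" using card_subset_nsets_le[OF F(2) S(1)] F S by simp
  have t: "?t \<le> m choose (r - 1)" using tX rd by (simp add: choose_split)
  let ?K = "kk_iter d m (r - 1) ?t"
  have "kk_iter d (Suc m) r (card X) = (m choose q) + ?K"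
    using kk_iter_split[of m r "card X" d] big mr tX rd by simp
  then have shF: "(m choose q) + ?K \<le> card ((shadow ^^ d) F)"
    using kk_iter_le_card[OF F(2) S(1), of d] F S rd by simp
  have shF_sub: "(shadow ^^ d) F \<subseteq> nsets S q" using shadow_funpow_nsets[OF F(2), of d] rd by simp
  have "Y \<inter> (shadow ^^ d) F = {}"
  proof -
    have False if V: "V \<in> Y" "V \<in> (shadow ^^ d) F" for V
    proof -
      obtain U where "U \<in> X" "V \<subseteq> S - U" using mem_shadow_funpow_imp_subset[OF V(2)] by (auto simp: F_def)
      then show False using cross_intersectingD[OF cr _ V(1)] by blast
    qed
    then show ?thesis by blast
  qed
  then have "card Y + card ((shadow ^^ d) F) = card (Y \<union> (shadow ^^ d) F)"
    using finite_subset_nsets[OF Y S(1)] finite_subset_nsets[OF shF_sub S(1)] by (simp add: card_Un_disjoint)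
  also have "\<dots> \<le> Suc m choose q"
    using card_subset_nsets_le[of "Y \<union> (shadow ^^ d) F" S q] Y shF_sub S by simp
  finally have cY: "card Y + ?K \<le> m choose (q - 1)" using shF pq by (simp add: choose_split)
  \<comment> \<open>The part of the segment beyond the complete \<open>r\<close>-subsets of
    \<open>{..<m}\<close>, with the point \<open>m\<close> removed.\<close>
  define G where "G = colex_family m (r - 1) ?t"
  define H where "H = (shadow ^^ d) G"
  have G: "G \<subseteq> nsets {..<m} (r - 1)" "card G = ?t"
    unfolding G_def by (rule colex_family_nsets, rule card_colex_family[OF t])
  have H: "H \<subseteq> nsets {..<m} (q - 1)" "card H = ?K"
    using shadow_funpow_colex_family[OF t rd(5)] shadow_funpow_nsets[OF G(1), of d] rd(4)
    by (auto simp: H_def G_def card_colex_family)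
  have "card (nsets {..<m} (q - 1) - H) = (m choose (q - 1)) - ?K"
    using H by (simp add: card_Diff_subset finite_subset_nsets[OF H(1)] card_nsets)
  then have "card Y \<le> card (nsets {..<m} (q - 1) - H)" using cY by linarith
  then obtain Y' where Y': "Y' \<subseteq> nsets {..<m} (q - 1) - H" "card Y' = card Y"
    using obtain_subset_with_card_n by metis
  define X' where "X' = (\<lambda>U. {..<m} - U) ` G"
  have X': "X' \<subseteq> nsets {..<m} p" "card X' = ?t"
    using card_complement_image[of "{..<m}" G "r - 1"] G rd by (auto simp: X'_def)
  have "cross_intersecting X' Y'"
    unfolding cross_intersecting_def
  proof (intro ballI)
    fix U V assume "U \<in> X'" and V: "V \<in> Y'"
    then obtain W where W: "W \<in> G" "U = {..<m} - W" by (auto simp: X'_def)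
    show "U \<inter> V \<noteq> {}"
    proof
      assume "U \<inter> V = {}"
      moreover have VV: "V \<subseteq> {..<m}" "card V = q - 1" using V Y' by (auto simp: nsets_def)
      moreover have WW: "W \<subseteq> {..<m}" "card W = r - 1" "finite W" using W G by (auto simp: nsets_def)
      ultimately have "V \<subseteq> W" using W by blast
      then have "V \<in> H" unfolding H_def
        by (rule subset_imp_mem_shadow_funpow[OF _ W(1) WW(3)]) (use VV WW rd in linarith)
      then show False using V Y' by blast
    qed
  qed
  then show ?thesis using that[of X' Y'] X' Y' big mr by auto
qed

section \<open>Cross-intersecting families of consecutive uniformities\<close>

lemma exists_shifted_cross:
  assumes X: "X \<subseteq> nsets S p" and Y: "Y \<subseteq> nsets S q" and "cross_intersecting X Y" and S: "finite S"
  obtains X' Y' where "X' \<subseteq> nsets S p" "Y' \<subseteq> nsets S q" "cross_intersecting X' Y'"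
    "card X' = card X" "card Y' = card Y" "shifted_on S X'" "shifted_on S Y'"
proof -
  define P where "P = (\<lambda>F G. F \<subseteq> nsets S p \<and> G \<subseteq> nsets S q \<and> cross_intersecting F G \<and> card F = card X \<and> card G = card Y)"
  have P1: "P X Y" using assms by (simp add: P_def)
  have P2: "F \<subseteq> Pow S \<and> G \<subseteq> Pow S" if "P F G" for F G using that by (auto simp: P_def nsets_def)
  have P3: "P (shift i j F) (shift i j G)" if "P F G" "i \<in> S" "j \<in> S" "i < j" for F G i j
    using that shift_nsets[of F S p i j] shift_nsets[of G S q i j] cross_intersecting_shift[of F G i j]
    by (simp add: P_def card_shift)
  obtain F G where "P F G" "shifted_on S F" "shifted_on S G"
    using exists_shifted_pair[of P, OF P1 S P2 P3] by blast
  then show ?thesis using that[of F G] by (simp add: P_def)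
qed

lemma shifted_on_initial:
  assumes sh: "shifted_on {..<m} Y" and Y: "Y \<subseteq> nsets {..<m} p" "Y \<noteq> {}"
  shows "{..<p} \<in> Y"
proof -
  have finU: "finite U" "card U = p" if "U \<in> Y" for U using that Y by (auto simp: nsets_def)
  obtain U where U: "U \<in> Y" and min: "\<And>V. V \<in> Y \<Longrightarrow> \<Sum>U \<le> \<Sum>V"
    using arg_min_natI[of "\<lambda>U. U \<in> Y" _ "\<lambda>U. \<Sum>U"] arg_min_nat_le[of "\<lambda>U. U \<in> Y" _ "\<lambda>U. \<Sum>U"] Y(2)
    by (metis ex_in_conv)
  have "U = {..<p}"
  proof (rule ccontr)
    assume ne: "U \<noteq> {..<p}"
    have "\<not> {..<p} \<subseteq> U" using ne finU[OF U] by (metis card_lessThan card_subset_eq)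
    then obtain i where i: "i < p" "i \<notin> U" by auto
    have "\<not> U \<subseteq> {..<p}" using ne finU[OF U] by (metis card_lessThan card_subset_eq finite_lessThan)
    then obtain j where j: "j \<in> U" "p \<le> j" by (meson lessThan_iff linorder_not_less subsetI)
    have "j < m" using j U Y by (auto simp: nsets_def)
    then have "insert i (U - {j}) \<in> Y" using shifted_onD[OF sh U _ j(1)] i j by auto
    then show False using min sum_swap_less[OF finU(1)[OF U], of i j] i j by (metis leD order_less_le_trans)
  qed
  then show ?thesis using U by simp
qed

text \<open>A member of least sum other than \<open>{..<p}\<close> can be lowered only into
  \<open>{..<p}\<close>, so it arises from it by moving the last element one step.\<close>

lemma shifted_on_second:
  assumes sh: "shifted_on {..<m} Y" and Y: "Y \<subseteq> nsets {..<m} p" "2 \<le> card Y" "0 < p"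
  shows "insert p {..<p - 1} \<in> Y"
proof -
  have finU: "finite U" "card U = p" if "U \<in> Y" for U using that Y by (auto simp: nsets_def)
  let ?Z = "Y - {{..<p}}"
  have "?Z \<noteq> {}"
  proof
    assume "?Z = {}"
    then have "card Y \<le> card {{..<p}}" by (intro card_mono) auto
    then show False using Y by simp
  qed
  then obtain U where U: "U \<in> ?Z" and min: "\<And>V. V \<in> ?Z \<Longrightarrow> \<Sum>U \<le> \<Sum>V"
    using arg_min_natI[of "\<lambda>U. U \<in> ?Z" _ "\<lambda>U. \<Sum>U"] arg_min_nat_le[of "\<lambda>U. U \<in> ?Z" _ "\<lambda>U. \<Sum>U"]
    by (metis ex_in_conv)
  have UY: "U \<in> Y" "U \<subseteq> {..<m}" using U Y by (auto simp: nsets_def)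
  have swap: "insert i (U - {j}) = {..<p}" if "i < j" "i \<notin> U" "j \<in> U" for i j
  proof (rule ccontr)
    assume ne: "insert i (U - {j}) \<noteq> {..<p}"
    have "j < m" using that UY by auto
    then have "insert i (U - {j}) \<in> ?Z" using shifted_onD[OF sh UY(1) _ that(3,1,2)] that ne by auto
    then show False using min sum_swap_less[OF finU(1)[OF UY(1)] that(1,3,2)] by (metis leD)
  qed
  have "\<not> U \<subseteq> {..<p}" using U finU[OF UY(1)] by (metis Diff_iff card_lessThan card_subset_eq finite_lessThan singletonI)
  then obtain j where j: "j \<in> U" "p \<le> j" by (meson lessThan_iff linorder_not_less subsetI)
  have "\<not> {..<p} \<subseteq> U" using U finU[OF UY(1)] by (metis Diff_iff card_lessThan card_subset_eq singletonI)
  then obtain i where i: "i < p" "i \<notin> U" by auto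
  have eq: "insert i (U - {j}) = {..<p}" by (rule swap) (use i j in auto)
  have "j = p"
  proof (rule ccontr)
    assume "j \<noteq> p"
    then have pj: "p < j" "p \<notin> U" using j eq by auto
    have "insert p (U - {j}) = {..<p}" by (rule swap) (use pj j in auto)
    then show False by auto
  qed
  have "i = p - 1"
  proof (rule ccontr)
    assume ni: "i \<noteq> p - 1"
    then have "p - 1 \<in> U - {j}" using eq i by (metis \<open>0 < p\<close> diff_less insertE lessThan_iff zero_less_one)
    then have "insert i (U - {p - 1}) = {..<p}" using swap[of i "p - 1"] i ni by auto
    then show False using j \<open>j = p\<close> by (metis \<open>p - 1 \<in> U - {j}\<close> DiffE DiffI insertI2 lessThan_iff less_irrefl singletonD)
  qed
  have "U = insert p {..<p - 1}"
  proof -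
    have "U - {p} = {..<p} - {p - 1}" using eq \<open>i = p - 1\<close> \<open>j = p\<close> i by auto
    also have "\<dots> = {..<p - 1}" by auto
    finally show ?thesis using j \<open>j = p\<close> by auto
  qed
  then show ?thesis using UY by simp
qed

lemma card_nsets_meeting:
  assumes "finite S" "T \<subseteq> S"
  shows "card {V \<in> nsets S r. V \<inter> T \<noteq> {}} + ((card S - card T) choose r) = card S choose r"
proof -
  have "{V \<in> nsets S r. V \<inter> T \<noteq> {}} = nsets S r - nsets (S - T) r" by (auto simp: nsets_def)
  moreover have "nsets (S - T) r \<subseteq> nsets S r" by (rule nsets_mono) auto
  moreover have "finite T" using assms finite_subset by blast
  ultimately have "card {V \<in> nsets S r. V \<inter> T \<noteq> {}} = card (nsets S r) - card (nsets (S - T) r)"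
    using assms by (simp add: card_Diff_subset finite_imp_finite_nsets)
  moreover have "card S - card T choose r \<le> card S choose r" by (rule binomial_right_mono) simp
  moreover have "card (nsets (S - T) r) = card S - card T choose r" "card (nsets S r) = card S choose r"
    using assms \<open>finite T\<close> by (simp_all add: card_nsets card_Diff_subset)
  ultimately show ?thesis by linarith
qed

lemma card_cross_intersecting_half:
  assumes X: "X \<subseteq> nsets S p" and Y: "Y \<subseteq> nsets S p" and "cross_intersecting X Y" and S: "finite S" "card S = 2 * p"
  shows "card X + card Y \<le> 2 * p choose p"
proof -
  define X' where "X' = (\<lambda>U. S - U) ` X"
  have X': "card X' = card X" "X' \<subseteq> nsets S p"
    using card_complement_image[OF S(1) X] S by (auto simp: X'_def)
  have "X' \<inter> Y = {}" using assms(3) by (auto simp: X'_def cross_intersecting_def)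
  then have "card X' + card Y = card (X' \<union> Y)"
    using finite_subset_nsets[OF _ S(1)] X' Y by (metis card_Un_disjoint)
  also have "\<dots> \<le> 2 * p choose p" using card_subset_nsets_le[of "X' \<union> Y" S p] X' Y S by simp
  finally show ?thesis using X' by simp
qed

text \<open>The link of the last element is empty in at least one of two shifted families, or both links
  are cross-intersecting again.\<close>

lemma cross_intersecting_link_last:
  assumes sh: "shifted_on {..<Suc m} Y" and X: "X \<subseteq> nsets {..<Suc m} p" and Y: "Y \<subseteq> nsets {..<Suc m} q"
    and cr: "cross_intersecting X Y" and pq: "p + q \<le> Suc m"
  shows "cross_intersecting (link m X) (link m Y)"
  unfolding cross_intersecting_def
proof (intro ballI notI)
  fix U V assume UV: "U \<in> link m X" "V \<in> link m Y" "U \<inter> V = {}"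
  have U: "m \<notin> U" "insert m U \<in> X" "finite U" "card U = p - 1" "U \<subseteq> {..<Suc m}" "0 < p"
    and V: "m \<notin> V" "insert m V \<in> Y" "finite V" "card V = q - 1" "0 < q"
    using UV X Y by (auto simp: link_def nsets_def subset_iff card_insert_if)
  have "card (U \<union> V) < m" using U V pq UV by (simp add: card_Un_disjoint)
  then have "\<not> {..<m} \<subseteq> U \<union> V" using U V card_mono[of "U \<union> V" "{..<m}"] by auto
  then obtain i where i: "i < m" "i \<notin> U" "i \<notin> V" by auto
  have "insert i (insert m V - {m}) \<in> Y"
    by (rule shifted_onD[OF sh V(2)]) (use i in auto)
  then have "insert i V \<in> Y" using V by simp
  from cross_intersectingD[OF cr U(2) this] show False using UV i V U by auto
qed

lemma avoid_last_nonempty: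
  assumes sh: "shifted_on {..<Suc m} Y" and Y: "Y \<subseteq> nsets {..<Suc m} q" "Y \<noteq> {}" "q \<le> m"
  shows "avoid m Y \<noteq> {}"
proof -
  have "{..<q} \<in> Y" by (rule shifted_on_initial[OF sh Y(1,2)])
  then show ?thesis using Y(3) by (auto simp: avoid_def)
qed

lemma lessThan_Suc_diff: "{..<Suc m} - {m} = {..<m}"
  by auto

text \<open>\<open>{..<p}\<close> belongs to \<open>Y\<close>, so every member of
  \<open>link m X\<close> meets it. This takes the place of the induction hypothesis when the link
  of the other family is empty.\<close>

lemma card_link_last_le:
  assumes Y: "shifted_on {..<Suc m} Y" "Y \<subseteq> nsets {..<Suc m} p" "Y \<noteq> {}" and X: "X \<subseteq> nsets {..<Suc m} p"
    and cr: "cross_intersecting X Y" and p: "0 < p" "2 * p \<le> m"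
  shows "card (link m X) + (m - p choose (p - 1)) \<le> m choose (p - 1)"
    and "2 \<le> card Y \<Longrightarrow> X \<noteq> {} \<Longrightarrow> card (link m X) + (m - p choose (p - 1)) < m choose (p - 1)"
proof -
  let ?M = "{V \<in> nsets {..<m} (p - 1). V \<inter> {..<p} \<noteq> {}}"
  have init: "{..<p} \<in> Y" by (rule shifted_on_initial[OF Y])
  have sub: "link m X \<subseteq> ?M"
  proof
    fix V assume V: "V \<in> link m X"
    then have "insert m V \<inter> {..<p} \<noteq> {}" using cross_intersectingD[OF cr _ init] by (auto simp: link_def)
    moreover have "V \<in> nsets {..<m} (p - 1)" using V link_nsets[OF X, of m] by (auto simp: lessThan_Suc_diff)
    ultimately show "V \<in> ?M" using p by auto
  qed
  have M: "card ?M + (m - p choose (p - 1)) = m choose (p - 1)"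
    using card_nsets_meeting[of "{..<m}" "{..<p}" "p - 1"] p by auto
  have finM: "finite ?M" by (simp add: finite_imp_finite_nsets)
  show "card (link m X) + (m - p choose (p - 1)) \<le> m choose (p - 1)"
    using card_mono[OF finM sub] M by simp
  assume two: "2 \<le> card Y" and "X \<noteq> {}"
  \<comment> \<open>This set meets \<open>{..<p}\<close> only in \<open>p - 1\<close> and misses the
    second smallest member \<open>insert p {..<p - 1}\<close> of \<open>Y\<close>, so it is a member
    of \<open>?M\<close> missing from the link.\<close>
  let ?R = "insert (p - 1) {p + 1..<2 * p - 1}"
  show "card (link m X) + (m - p choose (p - 1)) < m choose (p - 1)"
  proof (cases "p = 1")
    case True
    have "insert 1 {} \<in> Y" using shifted_on_second[OF Y(1,2) two p(1)] True by simp
    moreover have "{0} \<in> Y" using init True by (simp add: lessThan_Suc)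
    ultimately have "1 \<in> U \<and> 0 \<in> U" if "U \<in> X" for U
      using cross_intersectingD[OF cr that] by fastforce
    then have "{0, 1} \<subseteq> U" if "U \<in> X" for U using that by auto
    moreover have "finite U \<and> card U = 1" if "U \<in> X" for U using that X True by (auto simp: nsets_def)
    ultimately have "X = {}" using card_mono[of _ "{0, 1 :: nat}"] by fastforce
    then show ?thesis using \<open>X \<noteq> {}\<close> by simp
  next
    case False
    have R: "?R \<in> ?M" using p False by (auto simp: nsets_def)
    have "?R \<notin> link m X"
    proof
      assume "?R \<in> link m X"
      then have "insert m ?R \<in> X" by (simp add: link_def)
      from cross_intersectingD[OF cr this shifted_on_second[OF Y(1,2) two p(1)]]
      show False using p False by auto
    qed
    then have "link m X \<subset> ?M" using sub R by blast
    then have "card (link m X) < card ?M" by (rule psubset_card_mono[OF finM])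
    then show ?thesis using M by linarith
  qed
qed

text \<open>Induction through the last point after shifting: the subfamilies avoiding
  \<open>m\<close> stay non-empty, and the links form again such a pair, of rank
  \<open>p - 1\<close>, unless one of them is empty.\<close>

lemma cross_intersecting_sum_le:
  "\<lbrakk>X \<subseteq> nsets {..<m} p; Y \<subseteq> nsets {..<m} p; X \<noteq> {}; Y \<noteq> {}; cross_intersecting X Y; 0 < p; 2 * p \<le> m\<rbrakk>
    \<Longrightarrow> card X + card Y + (m - p choose p) \<le> (m choose p) + 1"
proof (induction m arbitrary: X Y p)
  case 0 then show ?case by simp
next
  case (Suc m)
  show ?case
  proof (cases "Suc m = 2 * p")
    case True
    then show ?thesis using card_cross_intersecting_half[OF Suc.prems(1,2,5)] by simp
  next
    case False
    then have pm: "2 * p \<le> m" using Suc.prems by simp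
    obtain X' Y' where XY: "X' \<subseteq> nsets {..<Suc m} p" "Y' \<subseteq> nsets {..<Suc m} p" "cross_intersecting X' Y'"
      "card X' = card X" "card Y' = card Y" and sh: "shifted_on {..<Suc m} X'" "shifted_on {..<Suc m} Y'"
      using exists_shifted_cross[OF Suc.prems(1,2,5)] by blast
    have fin: "finite X" "finite Y" "finite X'" "finite Y'"
      using finite_subset_nsets Suc.prems XY by (metis finite_lessThan)+
    then have ne: "X' \<noteq> {}" "Y' \<noteq> {}" using XY Suc.prems by (metis card_eq_0_iff)+
    have cr': "cross_intersecting Y' X'" using XY(3) by (simp add: cross_intersecting_commute)
    have av: "card (avoid m X') + card (avoid m Y') + (m - p choose p) \<le> (m choose p) + 1"
    proof (rule Suc.IH)
      show "avoid m X' \<subseteq> nsets {..<m} p" "avoid m Y' \<subseteq> nsets {..<m} p"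
        using avoid_nsets XY lessThan_Suc_diff by metis+
      show "avoid m X' \<noteq> {}" "avoid m Y' \<noteq> {}"
        using avoid_last_nonempty sh XY ne pm by (metis le_add1 mult_2 order_trans)+
      show "cross_intersecting (avoid m X') (avoid m Y')"
        using XY(3) by (auto simp: cross_intersecting_def avoid_def)
    qed (use Suc.prems pm in auto)
    have lk: "card (link m X') + card (link m Y') + (m - p choose (p - 1)) \<le> m choose (p - 1)"
    proof (cases "link m X' = {} \<or> link m Y' = {}")
      case True
      then show ?thesis
        using card_link_last_le(1)[OF sh(2) XY(2) ne(2) XY(1,3) Suc.prems(6) pm]
          card_link_last_le(1)[OF sh(1) XY(1) ne(1) XY(2) cr' Suc.prems(6) pm] by auto
    next
      case False
      have crl: "cross_intersecting (link m X') (link m Y')"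
        by (rule cross_intersecting_link_last[OF sh(2) XY(1,2,3)]) (use pm in simp)
      have ls: "link m X' \<subseteq> nsets {..<m} (p - 1)" "link m Y' \<subseteq> nsets {..<m} (p - 1)"
        using link_nsets XY lessThan_Suc_diff by metis+
      have p2: "2 \<le> p"
      proof (rule ccontr)
        assume "\<not> 2 \<le> p"
        then have "p - 1 = 0" by simp
        then show False using False ls crl by (auto simp: cross_intersecting_def)
      qed
      have "card (link m X') + card (link m Y') + (m - (p - 1) choose (p - 1)) \<le> (m choose (p - 1)) + 1"
        by (rule Suc.IH[OF ls _ _ crl]) (use False p2 pm in auto)
      moreover have e: "m - (p - 1) = Suc (m - p)" using p2 pm by simp
      have "m - (p - 1) choose (p - 1) = (m - p choose (p - 1)) + (m - p choose (p - 1 - 1))"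
        unfolding e by (rule choose_split) (use p2 in simp)
      \<comment> \<open>This term pays for the \<open>+ 1\<close> that the induction hypothesis for
        the links brings in.\<close>
      moreover have "0 < m - p choose (p - 1 - 1)" using pm by simp
      ultimately show ?thesis by linarith
    qed
    have "Suc m - p = Suc (m - p)" using pm by simp
    then have "Suc m - p choose p = (m - p choose p) + (m - p choose (p - 1))"
      using Suc.prems by (simp only: choose_split)
    moreover have "Suc m choose p = (m choose p) + (m choose (p - 1))"
      using Suc.prems by (simp only: choose_split)
    moreover have "card X = card (link m X') + card (avoid m X')" "card Y = card (link m Y') + card (avoid m Y')"
      using card_link_avoid[OF fin(3)] card_link_avoid[OF fin(4)] XY by simp_all
    ultimately show ?thesis using av lk by linarith
  qed
qed

lemma cross_intersecting_sum_less_aux: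
  assumes X: "X \<subseteq> nsets {..<Suc m} p" "shifted_on {..<Suc m} X" and Y: "Y \<subseteq> nsets {..<Suc m} p" "shifted_on {..<Suc m} Y"
    and cr: "cross_intersecting X Y" and p: "0 < p" "2 * p \<le> m" and two: "2 \<le> card X" "2 \<le> card Y"
    and lk: "card (link m X) + card (link m Y) + (m - p choose (p - 1)) < m choose (p - 1)"
  shows "card X + card Y + (Suc m - p choose p) < (Suc m choose p) + 1"
proof -
  have ne: "X \<noteq> {}" "Y \<noteq> {}" using two by auto
  have av: "card (avoid m X) + card (avoid m Y) + (m - p choose p) \<le> (m choose p) + 1"
  proof (rule cross_intersecting_sum_le)
    show "avoid m X \<subseteq> nsets {..<m} p" "avoid m Y \<subseteq> nsets {..<m} p"
      using avoid_nsets X Y lessThan_Suc_diff by metis+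
    show "avoid m X \<noteq> {}" "avoid m Y \<noteq> {}"
      using avoid_last_nonempty X Y ne p by (metis le_add1 mult_2 order_trans)+
    show "cross_intersecting (avoid m X) (avoid m Y)"
      using cr by (auto simp: cross_intersecting_def avoid_def)
  qed (use p in auto)
  have fin: "finite X" "finite Y" using finite_subset_nsets X Y by (metis finite_lessThan)+
  have "Suc m - p = Suc (m - p)" using p by simp
  then have "Suc m - p choose p = (m - p choose p) + (m - p choose (p - 1))"
    using p by (simp only: choose_split)
  moreover have "Suc m choose p = (m choose p) + (m choose (p - 1))"
    using p by (simp only: choose_split)
  moreover have "card X = card (link m X) + card (avoid m X)" "card Y = card (link m Y) + card (avoid m Y)"
    using card_link_avoid[OF fin(1)] card_link_avoid[OF fin(2)] by simp_all
  ultimately show ?thesis using av lk by linarith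
qed

text \<open>The common start of strictness for rank at least \<open>3\<close> and of the equality
  case for rank \<open>2\<close>: an empty link already loses a set, so only non-empty links
  remain.\<close>

lemma cross_intersecting_sum_cases:
  assumes X: "X \<subseteq> nsets {..<Suc m} p" and Y: "Y \<subseteq> nsets {..<Suc m} p"
    and cr: "cross_intersecting X Y" and p: "0 < p" "2 * p \<le> m" and two: "2 \<le> card X" "2 \<le> card Y"
  obtains "card X + card Y + (Suc m - p choose p) < (Suc m choose p) + 1"
  | X' Y' where "X' \<subseteq> nsets {..<Suc m} p" "Y' \<subseteq> nsets {..<Suc m} p" "cross_intersecting X' Y'"
      "card X' = card X" "card Y' = card Y" "shifted_on {..<Suc m} X'" "shifted_on {..<Suc m} Y'"
      "link m X' \<noteq> {}" "link m Y' \<noteq> {}" "cross_intersecting (link m X') (link m Y')"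
      "link m X' \<subseteq> nsets {..<m} (p - 1)" "link m Y' \<subseteq> nsets {..<m} (p - 1)"
proof -
  obtain X' Y' where XY: "X' \<subseteq> nsets {..<Suc m} p" "Y' \<subseteq> nsets {..<Suc m} p" "cross_intersecting X' Y'"
      "card X' = card X" "card Y' = card Y" and sh: "shifted_on {..<Suc m} X'" "shifted_on {..<Suc m} Y'"
    using exists_shifted_cross[OF X Y cr] by blast
  have cr': "cross_intersecting Y' X'" using XY(3) by (simp add: cross_intersecting_commute)
  have two': "2 \<le> card X'" "2 \<le> card Y'" using XY two by auto
  then have ne: "X' \<noteq> {}" "Y' \<noteq> {}" by auto
  show ?thesis
  proof (cases "link m X' = {} \<or> link m Y' = {}")
    case True
    then have "card (link m X') + card (link m Y') + (m - p choose (p - 1)) < m choose (p - 1)"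
      using card_link_last_le(2)[OF sh(2) XY(2) ne(2) XY(1,3) p two'(2) ne(1)]
        card_link_last_le(2)[OF sh(1) XY(1) ne(1) XY(2) cr' p two'(1) ne(2)] by auto
    from cross_intersecting_sum_less_aux[OF XY(1) sh(1) XY(2) sh(2) XY(3) p two' this]
    show ?thesis using that(1) XY by simp
  next
    case False
    have "cross_intersecting (link m X') (link m Y')"
      by (rule cross_intersecting_link_last[OF sh(2) XY(1,2,3)]) (use p in simp)
    moreover have "link m X' \<subseteq> nsets {..<m} (p - 1)" "link m Y' \<subseteq> nsets {..<m} (p - 1)"
      using link_nsets XY lessThan_Suc_diff by metis+
    ultimately show ?thesis using that(2)[OF XY sh] False by blast
  qed
qed

lemma cross_intersecting_sum_less:
  assumes X: "X \<subseteq> nsets {..<Suc m} p" and Y: "Y \<subseteq> nsets {..<Suc m} p"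
    and cr: "cross_intersecting X Y" and p: "3 \<le> p" "2 * p \<le> m" and two: "2 \<le> card X" "2 \<le> card Y"
  shows "card X + card Y + (Suc m - p choose p) < (Suc m choose p) + 1"
proof (cases rule: cross_intersecting_sum_cases[OF X Y cr _ p(2) two])
  case (3 X' Y')
  have "card (link m X') + card (link m Y') + (m - (p - 1) choose (p - 1)) \<le> (m choose (p - 1)) + 1"
    by (rule cross_intersecting_sum_le) (use 3 p in auto)
  moreover have e: "m - (p - 1) = Suc (m - p)" using p by simp
  have "m - (p - 1) choose (p - 1) = (m - p choose (p - 1)) + (m - p choose (p - 1 - 1))"
    unfolding e by (rule choose_split) (use p in simp)
  \<comment> \<open>Rank at least \<open>3\<close> enters here: the surplus exceeds the
    \<open>+ 1\<close>. For rank \<open>2\<close> it is exactly \<open>1\<close>, which leaves room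
    for the triangle configuration.\<close>
  moreover have "2 \<le> m - p choose (p - 1 - 1)"
  proof -
    have "p choose (p - 2) \<le> m - p choose (p - 2)" by (rule binomial_right_mono) (use p in simp)
    moreover have "p choose (p - 2) = p choose 2" using binomial_symmetric[of 2 p] p by simp
    moreover have "3 choose 2 \<le> p choose 2" by (rule binomial_right_mono) (use p in simp)
    moreover have "3 choose 2 = (3::nat)" by (simp add: numeral_eq_Suc)
    moreover have e2: "p - 1 - 1 = p - 2" by simp
    ultimately show ?thesis unfolding e2 by linarith
  qed
  ultimately have "card (link m X') + card (link m Y') + (m - p choose (p - 1)) < m choose (p - 1)"
    by linarith
  from cross_intersecting_sum_less_aux[OF 3(1,6,2,7,3) _ p(2) _ _ this]
  show ?thesis using 3 two p by simp
qed (use p in auto)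

lemma shifted_on_link_zero_star:
  assumes sh: "shifted_on {..<Suc m} X" and X: "{0, m} \<in> X" "0 < m" and z: "0 < z" "z \<le> m"
  shows "{0, z} \<in> X"
proof (cases "z = m")
  case False
  then have "insert z ({0, m} - {m}) \<in> X" by (intro shifted_onD[OF sh X(1)]) (use z in auto)
  moreover have "{0, m} - {m} = {0}" using X by auto
  ultimately show ?thesis by (simp add: insert_commute)
qed (use X in simp)

text \<open>Non-empty cross-intersecting links of rank \<open>1\<close> are one and the same
  singleton \<open>{v}\<close>, and shiftedness gives \<open>v = 0\<close>; hence both shifted
  graphs are the full star at \<open>0\<close>.\<close>

lemma cross_intersecting_sum_eq_2:
  assumes X: "X \<subseteq> nsets {..<Suc m} 2" and Y: "Y \<subseteq> nsets {..<Suc m} 2"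
    and cr: "cross_intersecting X Y" and m: "4 \<le> m" and two: "2 \<le> card X" "2 \<le> card Y"
    and eq: "card X + card Y + (Suc m - 2 choose 2) = (Suc m choose 2) + 1"
  shows "card X = m" "card Y = m"
proof -
  have "2 * 2 \<le> m" using m by simp
  from cross_intersecting_sum_cases[OF X Y cr _ this two]
  have "card X = m \<and> card Y = m"
  proof cases
    case (3 X' Y')
    have single: "\<exists>v. W = {v}" if "W \<in> link m X' \<union> link m Y'" for W
      using that 3(11,12) by (auto simp: nsets_def card_1_singleton_iff)
    obtain v where v: "{v} \<in> link m X'" using 3(8) single by (metis UnI1 ex_in_conv)
    have Yv: "W = {v}" if "W \<in> link m Y'" for W
      using single[of W] that cross_intersectingD[OF 3(10) v that] by auto
    then have vY: "{v} \<in> link m Y'" using 3(9) by (metis ex_in_conv)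
    have Xv: "W = {v}" if "W \<in> link m X'" for W
      using single[of W] that cross_intersectingD[OF 3(10) that vY] by auto
    have v0: "v = 0"
    proof (rule ccontr)
      assume "v \<noteq> 0"
      have "insert m {v} \<in> X'" "v \<noteq> m" using v by (auto simp: link_def)
      then have "insert 0 (insert m {v} - {v}) \<in> X'"
        by (intro shifted_onD[OF 3(6)]) (use \<open>v \<noteq> 0\<close> m in auto)
      moreover have "insert m {v} - {v} = {m}" using \<open>v \<noteq> m\<close> by auto
      ultimately have "insert m {0} \<in> X'" by (simp add: insert_commute)
      then have "{0} \<in> link m X'" using m by (simp add: link_def)
      then show False using Xv \<open>v \<noteq> 0\<close> by blast
    qed
    have in0: "{0, m} \<in> X'" "{0, m} \<in> Y'" using v vY v0 by (auto simp: link_def insert_commute)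
    have starX: "{0, z} \<in> X'" and starY: "{0, z} \<in> Y'" if "0 < z" "z \<le> m" for z
      using shifted_on_link_zero_star[OF 3(6) in0(1)] shifted_on_link_zero_star[OF 3(7) in0(2)] that by auto
    have only: "0 \<in> U" if "U \<in> F" "F \<subseteq> nsets {..<Suc m} 2" "\<And>z. 0 < z \<Longrightarrow> z \<le> m \<Longrightarrow> {0, z} \<in> G"
      "cross_intersecting F G" for U F G
    proof (rule ccontr)
      assume "0 \<notin> U"
      have "card U = 2" "finite U" using that by (auto simp: nsets_def)
      then have "\<not> {1..m} \<subseteq> U" using card_mono[of U "{1..m}"] m by auto
      then obtain z where "z \<in> {1..m}" "z \<notin> U" by blast
      then have "0 < z" "z \<le> m" by auto
      then show False using cross_intersectingD[OF that(4,1) that(3)] \<open>0 \<notin> U\<close> \<open>z \<notin> U\<close> by auto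
    qed
    have cardF: "card F = m" if F: "F \<subseteq> nsets {..<Suc m} 2" "\<And>U. U \<in> F \<Longrightarrow> 0 \<in> U"
       "\<And>z. 0 < z \<Longrightarrow> z \<le> m \<Longrightarrow> {0, z} \<in> F" for F
    proof -
      have "F = (\<lambda>z. {0, z}) ` {1..m}"
      proof
        show "F \<subseteq> (\<lambda>z. {0, z}) ` {1..m}"
        proof
          fix U assume U: "U \<in> F"
          then have "U \<subseteq> {..<Suc m}" "card U = 2" "0 \<in> U" using F by (auto simp: nsets_def)
          then obtain z where "U = {0, z}" "z \<noteq> 0" unfolding card_2_iff by auto
          then show "U \<in> (\<lambda>z. {0, z}) ` {1..m}" using \<open>U \<subseteq> {..<Suc m}\<close> by auto
        qed
        show "(\<lambda>z. {0, z}) ` {1..m} \<subseteq> F" using F(3) by auto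
      qed
      moreover have "inj_on (\<lambda>z. {0::nat, z}) {1..m}" by (auto simp: inj_on_def doubleton_eq_iff)
      ultimately show ?thesis by (simp add: card_image)
    qed
    have cr': "cross_intersecting Y' X'" using 3(3) by (simp add: cross_intersecting_commute)
    show ?thesis
      using cardF[OF 3(1) only[OF _ 3(1) starY 3(3)] starX] cardF[OF 3(2) only[OF _ 3(2) starX cr'] starY] 3(4,5)
      by simp
  qed (use eq in auto)
  then show "card X = m" "card Y = m" by auto
qed

section \<open>Bounds in terms of \<open>h(n, k)\<close>\<close>

lemma hm_bound_add:
  assumes "2 * k < n" "2 \<le> k"
  shows "hm_bound n k + (n - k - 1 choose (k - 1)) = (n - 1 choose (k - 1)) + 1"
proof -
  have "n - k - 1 choose (k - 1) \<le> n - 1 choose (k - 1)" by (rule binomial_right_mono) simp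
  then show ?thesis by (simp add: hm_bound_def)
qed

lemma choose_pred_split: "0 < n \<Longrightarrow> 0 < r \<Longrightarrow> n choose r = (n - 1 choose r) + (n - 1 choose (r - 1))"
  using choose_split[of r "n - 1"] by simp

locale uniform_params =
  fixes n k :: nat
  assumes nk: "2 * k < n" and k3: "3 \<le> k"
begin

abbreviation "h \<equiv> hm_bound n k"
abbreviation "D \<equiv> n - 2 choose (k - 2)"
abbreviation "N \<equiv> n - 1 choose (k - 1)"

text \<open>For ranks \<open>k - 1\<close> and \<open>k\<close> on \<open>n - 1\<close> points the
  threshold of \<open>hilton_reduction\<close> is \<open>D\<close>, and the reduced families have
  equal rank.\<close>

lemma reduce_to_balanced:
  assumes S: "finite S" "card S = n - 1" and X: "X \<subseteq> nsets S (k - 1)" and Y: "Y \<subseteq> nsets S k"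
    and cr: "cross_intersecting X Y" and big: "D < card X"
  obtains X' Y' where "X' \<subseteq> nsets {..<n - 2} (k - 1)" "Y' \<subseteq> nsets {..<n - 2} (k - 1)"
    "cross_intersecting X' Y'" "card X = card X' + D" "card Y' = card Y"
proof -
  have e: "card S = Suc (n - 2)" "k - 1 - 1 = k - 2" and pq: "k - 1 + k \<le> Suc (n - 2)" "0 < k - 1" "0 < k"
    using S nk k3 by auto
  show ?thesis
    by (rule hilton_reduction[OF S(1) e(1) X Y cr pq, unfolded e(2), OF big that])
qed

lemma hm_bound_eq: "h + (n - 2 - (k - 1) choose (k - 1)) = D + (n - 2 choose (k - 1)) + 1"
proof -
  have "n - 2 - (k - 1) = n - k - 1" "n - 1 - 1 = n - 2" "k - 1 - 1 = k - 2" using nk k3 by auto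
  then show ?thesis using hm_bound_add[of k n] choose_pred_split[of "n - 1" "k - 1"] nk k3 by simp
qed

lemma cross_sum_le:
  assumes S: "finite S" "card S = n - 1" and X: "X \<subseteq> nsets S (k - 1)" and Y: "Y \<subseteq> nsets S k"
    and cr: "cross_intersecting X Y" and big: "D < card X" and ne: "Y \<noteq> {}"
  shows "card X + card Y \<le> h"
proof -
  obtain X' Y' where XY: "X' \<subseteq> nsets {..<n - 2} (k - 1)" "Y' \<subseteq> nsets {..<n - 2} (k - 1)"
    "cross_intersecting X' Y'" "card X = card X' + D" "card Y' = card Y"
    using reduce_to_balanced[OF S X Y cr big] .
  have "finite Y" using finite_subset_nsets[OF Y S(1)] .
  then have "X' \<noteq> {}" "Y' \<noteq> {}" using XY big ne by (auto simp: card_eq_0_iff)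
  then have "card X' + card Y' + (n - 2 - (k - 1) choose (k - 1)) \<le> (n - 2 choose (k - 1)) + 1"
    by (intro cross_intersecting_sum_le XY) (use nk k3 in auto)
  then show ?thesis using hm_bound_eq XY by linarith
qed

text \<open>\<open>D + 1 < card X\<close> leaves two sets in \<open>X'\<close>, as strictness asks
  of both reduced families.\<close>

lemma cross_sum_less:
  assumes S: "finite S" "card S = n - 1" and X: "X \<subseteq> nsets S (k - 1)" and Y: "Y \<subseteq> nsets S k"
    and cr: "cross_intersecting X Y" and big: "D + 1 < card X" and two: "2 \<le> card Y" and k4: "4 \<le> k"
  shows "card X + card Y < h"
proof -
  obtain X' Y' where XY: "X' \<subseteq> nsets {..<n - 2} (k - 1)" "Y' \<subseteq> nsets {..<n - 2} (k - 1)"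
    "cross_intersecting X' Y'" "card X = card X' + D" "card Y' = card Y"
    using reduce_to_balanced[OF S X Y cr] big by auto
  have s: "Suc (n - 3) = n - 2" using nk k3 by simp
  have "card X' + card Y' + (Suc (n - 3) - (k - 1) choose (k - 1)) < (Suc (n - 3) choose (k - 1)) + 1"
    by (rule cross_intersecting_sum_less) (use XY big two k4 nk s in auto)
  then show ?thesis unfolding s using hm_bound_eq XY by linarith
qed

lemma cross_sum_eq_3:
  assumes S: "finite S" "card S = n - 1" and X: "X \<subseteq> nsets S (k - 1)" and Y: "Y \<subseteq> nsets S k"
    and cr: "cross_intersecting X Y" and big: "D + 1 < card X" and two: "2 \<le> card Y" and k: "k = 3"
    and eq: "card X + card Y = h"
  shows "card Y = n - 3"
proof -
  obtain X' Y' where XY: "X' \<subseteq> nsets {..<n - 2} (k - 1)" "Y' \<subseteq> nsets {..<n - 2} (k - 1)"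
    "cross_intersecting X' Y'" "card X = card X' + D" "card Y' = card Y"
    using reduce_to_balanced[OF S X Y cr] big by auto
  have s: "Suc (n - 3) = n - 2" "k - 1 = 2" using nk k by simp_all
  have "card X' + card Y' + (Suc (n - 3) - 2 choose 2) = (Suc (n - 3) choose 2) + 1"
    unfolding s(1) using hm_bound_eq XY eq unfolding s(2) by linarith
  then have "card Y' = n - 3"
    by (intro cross_intersecting_sum_eq_2(2)[of X' "n - 3" Y']) (use XY big two k nk s in auto)
  then show ?thesis using XY by simp
qed

text \<open>The reduction acts twice, here on \<open>n\<close> points and then inside
  \<open>cross_sum_le\<close> with the roles of the families exchanged.\<close>

lemma cross_sum_le_uniform:
  assumes S: "finite S" "card S = n" and A: "A \<subseteq> nsets S k" and B: "B \<subseteq> nsets S k"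
    and cr: "cross_intersecting A B" and bigB: "D < card B" and bigA: "N < card A"
  shows "card A + card B \<le> N + h"
proof -
  have "card S = Suc (n - 1)" using S nk by simp
  then obtain A' B' where AB: "A' \<subseteq> nsets {..<n - 1} k" "B' \<subseteq> nsets {..<n - 1} (k - 1)"
     "cross_intersecting A' B'" "card A = card A' + N" "card B' = card B"
    using hilton_reduction[OF S(1) _ A B cr _ _ _ bigA] nk k3 by auto
  have "card B' + card A' \<le> h"
    by (rule cross_sum_le[of "{..<n - 1}"])
       (use AB bigA bigB in \<open>auto simp: cross_intersecting_commute\<close>)
  then show ?thesis using AB by simp
qed

section \<open>Sizes forced by a non-trivial partner\<close>

lemma binomial_telescope:
  "l \<le> M \<Longrightarrow> 0 < r \<Longrightarrow> (\<Sum>i<l. M - 1 - i choose (r - 1)) + (M - l choose r) = M choose r"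
proof (induction l)
  case (Suc l)
  have "M - l choose r = (M - Suc l choose r) + (M - 1 - l choose (r - 1))"
    using choose_pred_split[of "M - l" r] Suc.prems by simp
  then show ?case using Suc by simp
qed simp

lemma binomial_log_concave:
  "i + l \<le> a \<Longrightarrow> (a choose r) * (a - (i + l) choose r) \<le> (a - i choose r) * (a - l choose r)"
proof (induction l)
  case (Suc l)
  let ?b = "a - l" and ?c = "a - (i + l)"
  have bc: "0 < ?b" "0 < ?c" "?c \<le> ?b" using Suc.prems by auto
  have c: "?c * (?c - 1 choose r) = (?c - r) * (?c choose r)"
    and b: "?b * (?b - 1 choose r) = (?b - r) * (?b choose r)"
    by (rule binomial_absorb_comp[symmetric])+
  have "x * (y - r) \<le> y * (x - r)" if "y \<le> x" for x y
    using that by (simp add: diff_mult_distrib2 mult.commute diff_le_mono2)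
  from this[OF bc(3)] have le: "?b * (?c - r) \<le> ?c * (?b - r)" .
  have "(?b * ?c) * ((a choose r) * (?c - 1 choose r)) = (?b * (a choose r)) * (?c * (?c - 1 choose r))"
    by (simp only: ac_simps)
  also have "\<dots> = (?b * (?c - r)) * ((a choose r) * (?c choose r))" unfolding c by (simp only: ac_simps)
  also have "\<dots> \<le> (?c * (?b - r)) * ((a - i choose r) * (?b choose r))"
    by (rule mult_le_mono[OF le]) (use Suc in simp)
  also have "\<dots> = (?c * (a - i choose r)) * (?b * (?b - 1 choose r))" unfolding b by (simp only: ac_simps)
  also have "\<dots> = (?b * ?c) * ((a - i choose r) * (?b - 1 choose r))" by (simp only: ac_simps)
  finally have "(a choose r) * (?c - 1 choose r) \<le> (a - i choose r) * (?b - 1 choose r)"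
    using bc by simp
  then show ?case by simp
qed simp

text \<open>With \<open>z\<close> removed, the members counted are \<open>(k - 1)\<close>-subsets of
  \<open>n - 1 - i\<close> points that meet \<open>V\<close>. Telescoping writes the bound as
  \<open>k\<close> summands, so that parts with different \<open>i\<close> can be compared
  termwise.\<close>

lemma card_first_hit_le:
  assumes A: "A \<subseteq> nsets S k" and S: "finite S" "card S = n"
    and V: "V \<in> nsets S k" "z \<notin> V" and hit: "\<And>U. U \<in> A \<Longrightarrow> U \<inter> V \<noteq> {}"
    and Z: "Z \<subseteq> S" "card Z = i" "i < k" "z \<in> S" "z \<notin> Z"
  shows "card {U \<in> A. z \<in> U \<and> U \<inter> Z = {}} \<le> (\<Sum>l<k. n - 2 - (i + l) choose (k - 2))"
proof -
  define M where "M = S - insert z Z"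
  have finZ: "finite Z" using Z S finite_subset by blast
  have M: "finite M" "card M = n - 1 - i"
    using S Z finZ by (auto simp: M_def card_Diff_subset)
  let ?T = "V \<inter> M"
  have T: "card ?T \<le> k" using V card_mono[of V ?T] by (auto simp: nsets_def)
  let ?F = "{U \<in> A. z \<in> U \<and> U \<inter> Z = {}}"
  let ?G = "{W \<in> nsets M (k - 1). W \<inter> ?T \<noteq> {}}"
  have "card ?F \<le> card ?G"
  proof (rule card_inj_on_le)
    show "inj_on (\<lambda>U. U - {z}) ?F" by (auto simp: inj_on_def)
    show "(\<lambda>U. U - {z}) ` ?F \<subseteq> ?G"
    proof
      fix W assume "W \<in> (\<lambda>U. U - {z}) ` ?F"
      then obtain U where U: "U \<in> A" "z \<in> U" "U \<inter> Z = {}" "W = U - {z}" by auto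
      moreover have "U \<subseteq> S" "finite U" "card U = k" using U A by (auto simp: nsets_def)
      moreover have "U \<inter> V \<noteq> {}" by (rule hit) fact
      ultimately show "W \<in> ?G" using V by (auto simp: nsets_def M_def)
    qed
    show "finite ?G" using M by (simp add: finite_imp_finite_nsets)
  qed
  also have "card ?G + (card M - card ?T choose (k - 1)) = card M choose (k - 1)"
    by (rule card_nsets_meeting) (use M in auto)
  then have "card ?G + (n - 1 - i - k choose (k - 1)) \<le> n - 1 - i choose (k - 1)"
    using binomial_right_mono[of "n - 1 - i - k" "card M - card ?T" "k - 1"] diff_le_mono2[OF T, of "card M"] M(2)
    by simp
  also have "n - 1 - i choose (k - 1) = (\<Sum>l<k. n - 1 - i - 1 - l choose (k - 1 - 1)) + (n - 1 - i - k choose (k - 1))"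
    by (rule binomial_telescope[symmetric]) (use Z nk k3 in auto)
  finally show ?thesis by (simp add: numeral_2_eq_2 add.commute)
qed

lemma hm_bound_sum: "h = (\<Sum>l<k. n - 2 - l choose (k - 2)) + 1"
proof -
  have "(\<Sum>l<k. n - 1 - 1 - l choose (k - 1 - 1)) + (n - 1 - k choose (k - 1)) = N"
    by (rule binomial_telescope) (use nk k3 in auto)
  moreover have "n - 1 - k = n - k - 1" by simp
  ultimately show ?thesis using hm_bound_add[of k n] nk k3 by (simp add: numeral_2_eq_2)
qed

text \<open>Fix \<open>V \<in> B\<close> and sort \<open>A\<close> by the first element of \<open>V\<close> that is hit; an unfixed element of \<open>V\<close> is
  avoided by some member of \<open>B\<close>, so each part is at most the corresponding part of the extremal star.\<close>

lemma nontrivial_imp_card_le: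
  assumes A: "A \<subseteq> nsets S k" and B: "B \<subseteq> nsets S k" and S: "finite S" "card S = n"
    and cr: "cross_intersecting A B" and nt: "\<And>x. x \<in> S \<Longrightarrow> \<exists>V\<in>B. x \<notin> V"
  shows "card A * D \<le> (h - 1)\<^sup>2"
proof -
  let ?f = "\<lambda>t. n - 2 - t choose (k - 2)"
  have "S \<noteq> {}" using S nk by auto
  then obtain V where V: "V \<in> B" using nt by blast
  then have "V \<subseteq> S" "finite V" "card V = k" using B by (auto simp: nsets_def)
  then obtain zs where zs: "set zs = V" "distinct zs" "length zs = k"
    using finite_distinct_list distinct_card by metis
  let ?A = "\<lambda>i. {U \<in> A. zs ! i \<in> U \<and> U \<inter> set (take i zs) = {}}"
  have finA: "finite A" using finite_subset_nsets[OF A S(1)] .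
  have cover: "A \<subseteq> (\<Union>i<k. ?A i)"
  proof
    fix U assume U: "U \<in> A"
    have "\<exists>i. i < k \<and> zs ! i \<in> U"
      using cross_intersectingD[OF cr U V] zs by (auto simp: in_set_conv_nth)
    then obtain i where i: "i < k" "zs ! i \<in> U" "\<And>l. l < i \<Longrightarrow> \<not> (l < k \<and> zs ! l \<in> U)"
      using exists_least_iff[of "\<lambda>i. i < k \<and> zs ! i \<in> U"] by blast
    then have "U \<inter> set (take i zs) = {}" using zs by (fastforce simp: in_set_conv_nth)
    then show "U \<in> (\<Union>i<k. ?A i)" using i U by blast
  qed
  have part: "card (?A i) \<le> (\<Sum>l<k. ?f (i + l))" if i: "i < k" for i
  proof -
    have zi: "zs ! i \<in> S" using i zs \<open>V \<subseteq> S\<close> nth_mem by blast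
    then obtain W where W: "W \<in> B" "zs ! i \<notin> W" using nt by blast
    have "zs ! i \<notin> set (take i zs)"
      using zs i by (auto simp: in_set_conv_nth nth_eq_iff_index_eq)
    moreover have "card (set (take i zs)) = i" using zs i distinct_card[of "take i zs"] by simp
    moreover have "set (take i zs) \<subseteq> S" using zs \<open>V \<subseteq> S\<close> set_take_subset by fastforce
    ultimately show ?thesis
      using card_first_hit_le[OF A S _ W(2) cross_intersectingD[OF cr _ W(1)]] W B i zi by blast
  qed
  have "card A \<le> card (\<Union>i<k. ?A i)" by (rule card_mono) (use cover finA in auto)
  also have "\<dots> \<le> (\<Sum>i<k. card (?A i))" by (rule card_UN_le) simp
  also have "\<dots> \<le> (\<Sum>i<k. \<Sum>l<k. ?f (i + l))" by (rule sum_mono) (use part in auto)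
  finally have "card A * D \<le> (\<Sum>i<k. \<Sum>l<k. ?f (i + l)) * D" by (rule mult_right_mono) simp
  also have "\<dots> = (\<Sum>i<k. \<Sum>l<k. D * ?f (i + l))"
    by (simp add: sum_distrib_right sum_distrib_left mult.commute)
  \<comment> \<open>\<open>D\<close> is the term of index \<open>0\<close>, so log-concavity
    distributes the index \<open>i + l\<close> over the two factors.\<close>
  also have "\<dots> \<le> (\<Sum>i<k. \<Sum>l<k. ?f i * ?f l)"
    by (intro sum_mono binomial_log_concave) (use nk in auto)
  also have "\<dots> = (h - 1)\<^sup>2" using hm_bound_sum by (simp add: sum_product power2_eq_square)
  finally show ?thesis .
qed

end

section \<open>Cross-intersecting pairs of a graph and a triple system\<close>

lemma card_cover_le:
  assumes X: "finite X" and T: "finite T" and cov: "\<And>e. e \<in> X \<Longrightarrow> e \<inter> T \<noteq> {}"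
  shows "card X \<le> (\<Sum>t\<in>T. card (link t X))"
proof -
  have "X \<subseteq> (\<Union>t\<in>T. {e \<in> X. t \<in> e})" using cov by blast
  then have "card X \<le> card (\<Union>t\<in>T. {e \<in> X. t \<in> e})" using X T by (intro card_mono) auto
  also have "\<dots> \<le> (\<Sum>t\<in>T. card {e \<in> X. t \<in> e})" by (rule card_UN_le[OF T])
  finally show ?thesis by (simp add: card_link)
qed

definition nbrs :: "nat \<Rightarrow> nat set set \<Rightarrow> nat set" where
  "nbrs v X = {w. w \<noteq> v \<and> {v, w} \<in> X}"

lemma card_nbrs:
  assumes "X \<subseteq> nsets M 2"
  shows "card (nbrs v X) = card (link v X)"
proof -
  have "link v X = (\<lambda>w. {w}) ` nbrs v X"
  proof -
    have "\<exists>w. U = {w}" if "U \<in> link v X" for U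
      using that assms link_nsets[OF assms, of v] by (auto simp: nsets_def card_1_singleton_iff)
    then show ?thesis by (fastforce simp: link_def nbrs_def)
  qed
  then show ?thesis by (simp add: card_image)
qed

lemma nbrs_subset:
  assumes "cross_intersecting X Y" "T \<in> Y" "v \<notin> T"
  shows "nbrs v X \<subseteq> T"
  using cross_intersectingD[OF assms(1) _ assms(2)] assms(3) by (fastforce simp: nbrs_def)

text \<open>A cover that avoids \<open>v\<close> must contain every neighbour of
  \<open>v\<close>.\<close>

lemma cover_avoiding_imp_degree_le:
  assumes X: "X \<subseteq> nsets M 2" and Y: "Y \<subseteq> nsets M r" and cr: "cross_intersecting X Y" and T: "T \<in> Y" "v \<notin> T"
  shows "card (link v X) \<le> r" "card (link v X) = r \<Longrightarrow> T = nbrs v X"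
proof -
  have T': "finite T" "card T = r" using T Y by (auto simp: nsets_def)
  have sub: "nbrs v X \<subseteq> T" by (rule nbrs_subset[OF cr T])
  then show "card (link v X) \<le> r" using card_mono[OF T'(1) sub] T' card_nbrs[OF X] by simp
  show "T = nbrs v X" if "card (link v X) = r"
    using card_subset_eq[OF T'(1) sub] that T' card_nbrs[OF X] by simp
qed

lemma card_avoid_le_1:
  assumes X: "X \<subseteq> nsets M 2" and Y: "Y \<subseteq> nsets M r" and cr: "cross_intersecting X Y"
    and deg: "card (link v X) = r"
  shows "card (avoid v Y) \<le> 1"
proof -
  have "avoid v Y \<subseteq> {nbrs v X}"
    using cover_avoiding_imp_degree_le(2)[OF X Y cr] deg by (auto simp: avoid_def)
  then show ?thesis using card_mono[of "{nbrs v X}" "avoid v Y"] by simp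
qed

lemma cross_link_avoid:
  "cross_intersecting X Y \<Longrightarrow> cross_intersecting (avoid v X) (link v Y)"
  "cross_intersecting X Y \<Longrightarrow> cross_intersecting (link v X) (avoid v Y)"
  by (fastforce simp: cross_intersecting_def link_def avoid_def)+

text \<open>Two disjoint edges leave at most four covers, one vertex from each edge. Otherwise two
  edges \<open>{w, p}\<close> and \<open>{w, q}\<close> leave only \<open>{p, q}\<close> and the at
  most four pairs through \<open>w\<close>. For the second claim, an edge meets at most two others,
  so a disjoint one exists.\<close>

lemma card_pair_covers_le:
  assumes X: "X \<subseteq> nsets M 2" and Y: "Y \<subseteq> nsets M 2" and cr: "cross_intersecting X Y"
    and M: "finite M" "card M \<le> 5" and c: "2 \<le> card X"
  shows "card Y \<le> 5" and "(\<And>v. card (link v X) \<le> 2) \<Longrightarrow> 4 \<le> card X \<Longrightarrow> card Y \<le> 4"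
proof -
  have finX: "finite X" using finite_subset_nsets[OF X M(1)] .
  have disj: "card Y \<le> 4" if ef: "e \<in> X" "f \<in> X" "e \<inter> f = {}" for e f
  proof -
    have e: "finite e" "card e = 2" "finite f" "card f = 2" using ef X by (auto simp: nsets_def)
    have "Y \<subseteq> (\<lambda>(p, q). {p, q}) ` (e \<times> f)"
    proof
      fix T assume T: "T \<in> Y"
      obtain p where p: "p \<in> e" "p \<in> T" using cross_intersectingD[OF cr ef(1) T] by blast
      obtain q where q: "q \<in> f" "q \<in> T" using cross_intersectingD[OF cr ef(2) T] by blast
      have "p \<noteq> q" using p q ef by auto
      moreover have "card T = 2" "finite T" using T Y by (auto simp: nsets_def)
      ultimately have "T = {p, q}" using p q card_subset_eq[of T "{p, q}"] by auto
      then show "T \<in> (\<lambda>(p, q). {p, q}) ` (e \<times> f)" using p q by auto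
    qed
    then have "card Y \<le> card (e \<times> f)" using e by (meson card_image_le card_mono finite_SigmaI finite_imageI order_trans)
    then show ?thesis using e by (simp add: card_cartesian_product)
  qed
  show "card Y \<le> 5"
  proof (cases "\<exists>e\<in>X. \<exists>f\<in>X. e \<inter> f = {}")
    case True then show ?thesis using disj by fastforce
  next
    case False
    have "X \<noteq> {}" using c by auto
    then obtain e where "e \<in> X" by blast
    moreover have "\<not> X \<subseteq> {e}" using card_mono[of "{e}" X] c by auto
    ultimately obtain f where ef: "e \<in> X" "f \<in> X" "e \<noteq> f" by blast
    then obtain w where w: "w \<in> e" "w \<in> f" using False by blast
    have e: "finite e" "card e = 2" "finite f" "card f = 2" "e \<subseteq> M" "f \<subseteq> M" using ef X by (auto simp: nsets_def)
    obtain p where p: "e = {w, p}" "p \<noteq> w" using e w by (metis card_2_iff doubleton_eq_iff insertE singletonD)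
    obtain q where q: "f = {w, q}" "q \<noteq> w" using e w by (metis card_2_iff doubleton_eq_iff insertE singletonD)
    have "Y \<subseteq> insert {p, q} ((\<lambda>z. {w, z}) ` (M - {w}))"
    proof
      fix T assume T: "T \<in> Y"
      have T': "card T = 2" "finite T" "T \<subseteq> M" using T Y by (auto simp: nsets_def)
      show "T \<in> insert {p, q} ((\<lambda>z. {w, z}) ` (M - {w}))"
      proof (cases "w \<in> T")
        case True
        then obtain z where "T = {w, z}" "z \<noteq> w" using T' by (metis card_2_iff doubleton_eq_iff insertE singletonD)
        then show ?thesis using T' by auto
      next
        case False
        have "p \<in> T" using cross_intersectingD[OF cr ef(1) T] p False by auto
        moreover have "q \<in> T" using cross_intersectingD[OF cr ef(2) T] q False by auto
        moreover have "p \<noteq> q" using ef p q by auto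
        ultimately have "T = {p, q}" using T' card_subset_eq[of T "{p, q}"] by auto
        then show ?thesis by simp
      qed
    qed
    then have "card Y \<le> card (insert {p, q} ((\<lambda>z. {w, z}) ` (M - {w})))" using M by (intro card_mono) auto
    also have "\<dots> \<le> Suc (card ((\<lambda>z. {w, z}) ` (M - {w})))" by (rule card_insert_le_m1) auto
    also have "card ((\<lambda>z. {w, z}) ` (M - {w})) \<le> card (M - {w})" by (rule card_image_le) (use M in auto)
    also have "card (M - {w}) \<le> 4" using M e w by auto
    finally show ?thesis by simp
  qed
  assume deg: "\<And>v. card (link v X) \<le> 2" and c4: "4 \<le> card X"
  obtain e where e: "e \<in> X" using c4 by fastforce
  then obtain p q where pq: "e = {p, q}" "p \<noteq> q" using X by (auto simp: nsets_def card_2_iff)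
  have "\<exists>f\<in>X. e \<inter> f = {}"
  proof (rule ccontr)
    assume "\<not> ?thesis"
    then have "X - {e} \<subseteq> ({f \<in> X. p \<in> f} - {e}) \<union> ({f \<in> X. q \<in> f} - {e})" using pq by auto
    then have "card (X - {e}) \<le> card (({f \<in> X. p \<in> f} - {e}) \<union> ({f \<in> X. q \<in> f} - {e}))"
      using finX by (intro card_mono) auto
    also have "\<dots> \<le> card ({f \<in> X. p \<in> f} - {e}) + card ({f \<in> X. q \<in> f} - {e})" by (rule card_Un_le)
    also have "\<dots> = (card (link p X) - 1) + (card (link q X) - 1)"
      using finX e pq by (simp add: card_link)
    finally show False using deg[of p] deg[of q] c4 e finX by simp
  qed
  then show "card Y \<le> 4" using disj e by blast
qed

text \<open>This serves the case \<open>card (link x A) = D + 1\<close> for \<open>k = 3\<close>,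
  where the reduced family has a single member; with \<open>m = n - 1\<close> the sizes are those
  dictated by equality in the degree bound. A vertex of degree above \<open>3\<close> in
  \<open>X\<close> would lie in all covers; lower degrees force \<open>m = 6\<close>, which is
  settled by counting.\<close>

lemma three_covers_degree:
  assumes X: "X \<subseteq> nsets M 2" and Y: "Y \<subseteq> nsets M 3" and cr: "cross_intersecting X Y"
    and M: "finite M" "card M = m" "6 \<le> m" and cX: "card X = m" and cY: "card Y = 2 * m - 5"
  shows "\<exists>z\<in>M. m < card (link z Y)"
proof (rule ccontr)
  assume "\<not> ?thesis"
  then have le: "card (link z Y) \<le> m" if "z \<in> M" for z using that by auto
  have fin: "finite X" "finite Y" using finite_subset_nsets X Y M by metis+
  have linkM: "v \<in> M" if "0 < card (link v X)" for v
  proof -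
    have "link v X \<noteq> {}" using that by auto
    then show ?thesis using X by (auto simp: link_def nsets_def)
  qed
  have split: "2 * m - 5 = card (link v Y) + card (avoid v Y)" for v
    using card_link_avoid[OF fin(2)] cY by simp
  have deg3: "card (link v X) \<le> 3" for v
  proof (rule ccontr)
    assume a: "\<not> ?thesis"
    then have "avoid v Y = {}" using cover_avoiding_imp_degree_le(1)[OF X Y cr] by (force simp: avoid_def)
    then have "card (avoid v Y) = 0" by simp
    then show False using split[of v] le[OF linkM[of v]] a M by simp
  qed
  obtain T where T: "T \<in> Y" using cY M by fastforce
  have T': "T \<subseteq> M" "finite T" "card T = 3" using T Y by (auto simp: nsets_def)
  have pairs: "link v Y \<subseteq> nsets (M - {v}) 2" "avoid v X \<subseteq> nsets (M - {v}) 2" for v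
    using link_nsets[OF Y, of v] avoid_nsets[OF X, of v] by simp_all
  have cXv: "m = card (link v X) + card (avoid v X)" for v using card_link_avoid[OF fin(1)] cX by simp
  show False
  proof (cases "\<exists>v. card (link v X) = 3")
    case True
    then obtain v where v: "card (link v X) = 3" by blast
    then have vM: "v \<in> M" using linkM[of v] by simp
    have "card (avoid v Y) \<le> 1" by (rule card_avoid_le_1[OF X Y cr v])
    then have m6: "m = 6" "6 \<le> card (link v Y)" using split[of v] le[OF vM] M by auto
    have "card (link v Y) \<le> 5"
      by (rule card_pair_covers_le(1)[OF pairs(2,1) cross_link_avoid(1)[OF cr]])
         (use M vM m6 cXv[of v] v in auto)
    then show False using m6 by simp
  next
    case False
    then have "card (link v X) \<noteq> 3" for v by blast
    then have "card (link v X) < 3" for v using deg3[of v] by (metis le_neq_implies_less)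
    then have deg2: "card (link v X) \<le> 2" for v by (simp add: less_Suc_eq_le numeral_eq_Suc)
    have sumT: "m \<le> (\<Sum>t\<in>T. card (link t X))"
      using card_cover_le[OF fin(1) T'(2)] cross_intersectingD[OF cr _ T] cX by simp
    also have "\<dots> \<le> (\<Sum>t\<in>T. 2)" by (rule sum_mono) (rule deg2)
    finally have m6: "m = 6" using T' M by simp
    obtain v where v: "v \<in> T" using T' by fastforce
    have "card (link v X) = 2"
    proof (rule ccontr)
      assume "card (link v X) \<noteq> 2"
      then have "card (link v X) \<le> 1" using deg2[of v] by simp
      have "(\<Sum>t\<in>T. card (link t X)) = card (link v X) + (\<Sum>t\<in>T - {v}. card (link t X))"
        by (rule sum.remove) (use T' v in auto)
      also have "\<dots> \<le> 1 + (\<Sum>t\<in>T - {v}. 2)" by (rule add_mono[OF \<open>card (link v X) \<le> 1\<close> sum_mono]) (rule deg2)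
      also have "\<dots> = 5" using T' v by simp
      finally show False using sumT m6 by simp
    qed
    then have cN: "card (nbrs v X) = 2" using card_nbrs[OF X] by simp
    have vM: "v \<in> M" using v T' by auto
    have "card (avoid v X) = 4" using cXv[of v] \<open>card (link v X) = 2\<close> m6 by simp
    have "card (link w (avoid v X)) \<le> 2" for w
    proof -
      have "link w (avoid v X) \<subseteq> link w X" by (auto simp: link_def avoid_def)
      moreover have "finite (link w X)" using finite_subset_nsets[OF link_nsets[OF X]] M by blast
      ultimately show ?thesis using card_mono deg2 order_trans by meson
    qed
    then have 4: "card (link v Y) \<le> 4"
      by (intro card_pair_covers_le(2)[OF pairs(2,1) cross_link_avoid(1)[OF cr]])
         (use M vM m6 \<open>card (avoid v X) = 4\<close> in auto)
    let ?N = "nbrs v X"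
    have NM: "?N \<subseteq> M - {v}" using X by (auto simp: nbrs_def nsets_def)
    have finN: "finite ?N" using NM M finite_subset by blast
    define R where "R = M - insert v ?N"
    have "v \<notin> ?N" by (simp add: nbrs_def)
    then have "card (insert v ?N) = 3" using cN finN by simp
    moreover have "insert v ?N \<subseteq> M" using NM vM by auto
    ultimately have cR: "card R = 3" using M finN m6 by (simp add: R_def card_Diff_subset)
    have sub: "avoid v Y \<subseteq> (\<lambda>r. insert r ?N) ` {r \<in> R. insert r ?N \<in> Y}"
    proof
      fix W assume W: "W \<in> avoid v Y"
      then have W': "W \<in> Y" "v \<notin> W" "finite W" "card W = 3" "W \<subseteq> M" using Y by (auto simp: avoid_def nsets_def)
      have s: "?N \<subseteq> W" by (rule nbrs_subset[OF cr W'(1,2)])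
      then have "card (W - ?N) = 1" using W' cN finN by (simp add: card_Diff_subset)
      then obtain r where "W - ?N = {r}" by (auto simp: card_1_singleton_iff)
      then have "W = insert r ?N" "r \<in> R" using s W' by (auto simp: R_def)
      then show "W \<in> (\<lambda>r. insert r ?N) ` {r \<in> R. insert r ?N \<in> Y}" using W' by blast
    qed
    have finR: "finite R" using M by (simp add: R_def)
    \<comment> \<open>If all three extensions of the neighbourhood were covers, an edge missing
      \<open>?N\<close> would contain the three points of \<open>R\<close>; so \<open>?N\<close>
      would cover \<open>X\<close>, which leaves at most four edges.\<close>
    have "{r \<in> R. insert r ?N \<in> Y} \<noteq> R"
    proof
      assume all: "{r \<in> R. insert r ?N \<in> Y} = R"
      have "e \<inter> ?N \<noteq> {}" if e: "e \<in> X" for e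
      proof
        assume d: "e \<inter> ?N = {}"
        have "R \<subseteq> e"
        proof
          fix r assume "r \<in> R"
          then have "insert r ?N \<in> Y" using all by blast
          from cross_intersectingD[OF cr e this] d show "r \<in> e" by blast
        qed
        moreover have "finite e" "card e = 2" using e X by (auto simp: nsets_def)
        ultimately show False using card_mono[of e R] cR by simp
      qed
      then have "m \<le> (\<Sum>t\<in>?N. card (link t X))" using card_cover_le[OF fin(1) finN] cX by simp
      also have "\<dots> \<le> (\<Sum>t\<in>?N. 2)" by (rule sum_mono) (rule deg2)
      finally show False using cN m6 by simp
    qed
    then have "{r \<in> R. insert r ?N \<in> Y} \<subset> R" by blast
    then have "card {r \<in> R. insert r ?N \<in> Y} < 3" using psubset_card_mono[OF finR] cR by simp
    moreover have "card (avoid v Y) \<le> card {r \<in> R. insert r ?N \<in> Y}"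
      by (rule surj_card_le[OF _ sub]) (simp add: finR)
    ultimately have "card (avoid v Y) \<le> 2" by simp
    then show False using 4 split[of v] m6 by simp
  qed
qed

text \<open>The equality case behind the triangle type. A vertex of degree at least \<open>4\<close>
  in \<open>X\<close> lies in every cover; removing it leaves a graph covered by pairs, where degree
  at least \<open>3\<close> yields the second point of \<open>P\<close> in the same way.\<close>

lemma three_covers_structure:
  assumes X: "X \<subseteq> nsets M 2" and Y: "Y \<subseteq> nsets M 3" and cr: "cross_intersecting X Y"
    and M: "finite M" "card M = m" "6 \<le> m" and cX: "card X = 2 * m - 3" and cY: "card Y = m - 2"
  obtains P where "P \<in> nsets M 2" "X = {e \<in> nsets M 2. e \<inter> P \<noteq> {}}" "Y = {T \<in> nsets M 3. P \<subseteq> T}"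
proof -
  have fin: "finite X" "finite Y" using finite_subset_nsets X Y M by metis+
  obtain T where T: "T \<in> Y" using cY M by fastforce
  have T': "T \<subseteq> M" "finite T" "card T = 3" using T Y by (auto simp: nsets_def)
  have "\<exists>v. 4 \<le> card (link v X)"
  proof (rule ccontr)
    assume "\<not> ?thesis"
    then have "card (link v X) < 4" for v by (meson not_le)
    then have deg3: "card (link v X) \<le> 3" for v by (simp add: less_Suc_eq_le numeral_eq_Suc)
    have sumT: "2 * m - 3 \<le> (\<Sum>t\<in>U. card (link t X))" if "U \<in> Y" for U
      using card_cover_le[OF fin(1), of U] cross_intersectingD[OF cr _ that] cX that Y by (auto simp: nsets_def)
    have "(\<Sum>t\<in>T. card (link t X)) \<le> (\<Sum>t\<in>T. 3)" by (rule sum_mono) (rule deg3)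
    then have m6: "m = 6" using sumT[OF T] T' M by simp
    have eq3: "card (link v X) = 3" if "v \<in> U" "U \<in> Y" for U v
    proof (rule ccontr)
      assume "card (link v X) \<noteq> 3"
      then have l: "card (link v X) \<le> 2" using deg3[of v] by simp
      have U: "finite U" "card U = 3" using that Y by (auto simp: nsets_def)
      have "(\<Sum>t\<in>U. card (link t X)) = card (link v X) + (\<Sum>t\<in>U - {v}. card (link t X))"
        by (rule sum.remove) (use U that in auto)
      also have "\<dots> \<le> 2 + (\<Sum>t\<in>U - {v}. 3)" by (rule add_mono[OF l sum_mono]) (rule deg3)
      also have "\<dots> = 8" using U that by simp
      finally show False using sumT[OF that(2)] m6 by simp
    qed
    have "\<not> Y \<subseteq> {T}" using card_mono[of "{T}" Y] cY m6 by auto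
    then obtain T2 where T2: "T2 \<in> Y" "T2 \<noteq> T" by blast
    have "\<not> Y \<subseteq> {T, T2}" using card_mono[of "{T, T2}" Y] cY m6 T2 by auto
    then obtain T3 where T3: "T3 \<in> Y" "T3 \<noteq> T" "T3 \<noteq> T2" by blast
    have T2': "finite T2" "card T2 = 3" using T2 Y by (auto simp: nsets_def)
    have T3': "finite T3" "card T3 = 3" using T3 Y by (auto simp: nsets_def)
    have "\<not> T \<subseteq> T2" using T2 T2' T' card_subset_eq by metis
    then obtain v where v: "v \<in> T" "v \<notin> T2" by blast
    have "\<not> T2 \<subseteq> T" using T2 T2' T' card_subset_eq by metis
    then obtain u where u: "u \<in> T2" "u \<notin> T" by blast
    have nv: "W = nbrs v X" if "W \<in> Y" "v \<notin> W" for W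
      using cover_avoiding_imp_degree_le(2)[OF X Y cr that] eq3[OF v(1) T] by simp
    have nu: "W = nbrs u X" if "W \<in> Y" "u \<notin> W" for W
      using cover_avoiding_imp_degree_le(2)[OF X Y cr that] eq3[OF u(1) T2(1)] by simp
    \<comment> \<open>All vertices of covers have degree \<open>3\<close>, so a cover avoiding
      \<open>v\<close> is its neighbourhood \<open>T2\<close>, and a cover avoiding \<open>u\<close>
      is \<open>T\<close>.\<close>
    have "v \<in> T3" using nv[OF T3(1)] nv[OF T2(1) v(2)] T3 by auto
    moreover have "u \<in> T3" using nu[OF T3(1)] nu[OF T u(2)] T3 by auto
    moreover have uv: "{v, u} \<in> X" "u \<noteq> v" using u nv[OF T2(1) v(2)] by (auto simp: nbrs_def)
    ultimately have "card (T3 - {u, v}) = 1" using T3' by (simp add: card_Diff_subset)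
    then obtain w where w: "T3 - {u, v} = {w}" by (auto simp: card_1_singleton_iff)
    then have T3eq: "T3 = {v, u, w}" using \<open>v \<in> T3\<close> \<open>u \<in> T3\<close> by auto
    \<comment> \<open>The edge \<open>{v, u}\<close> is counted only once, so \<open>T3\<close>
      covers at most \<open>8\<close> of the \<open>9\<close> edges.\<close>
    have "X \<subseteq> {e \<in> X. v \<in> e} \<union> ({e \<in> X. u \<in> e} - {{v, u}}) \<union> {e \<in> X. w \<in> e}"
      using cross_intersectingD[OF cr _ T3(1)] T3eq by auto
    then have "card X \<le> card ({e \<in> X. v \<in> e} \<union> ({e \<in> X. u \<in> e} - {{v, u}}) \<union> {e \<in> X. w \<in> e})"
      using fin by (intro card_mono) auto
    also have "\<dots> \<le> card {e \<in> X. v \<in> e} + card ({e \<in> X. u \<in> e} - {{v, u}}) + card {e \<in> X. w \<in> e}"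
      by (meson add_le_mono1 card_Un_le order_trans)
    also have "\<dots> = card (link v X) + (card (link u X) - 1) + card (link w X)"
      using uv fin by (simp add: card_link)
    also have "\<dots> \<le> 8" using deg3[of v] deg3[of u] deg3[of w] by linarith
    finally show False using cX m6 by simp
  qed
  then obtain v where v: "4 \<le> card (link v X)" by blast
  then have "link v X \<noteq> {}" by auto
  then have vM: "v \<in> M" using X by (auto simp: link_def nsets_def)
  have allv: "v \<in> U" if "U \<in> Y" for U
    using cover_avoiding_imp_degree_le(1)[OF X Y cr that, of v] v by force
  define E where "E = avoid v X"
  define Z where "Z = link v Y"
  have E: "E \<subseteq> nsets (M - {v}) 2" and Z: "Z \<subseteq> nsets (M - {v}) 2"
    using avoid_nsets[OF X, of v] link_nsets[OF Y, of v] by (simp_all add: E_def Z_def)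
  have crE: "cross_intersecting E Z" unfolding E_def Z_def by (rule cross_link_avoid(1)[OF cr])
  have M': "finite (M - {v})" "card (M - {v}) = m - 1" using M vM by auto
  have finE: "finite E" "finite Z" using finite_subset_nsets E Z M' by metis+
  have "avoid v Y = {}" using allv by (auto simp: avoid_def)
  then have cZ: "card Z = m - 2" using card_link_avoid[OF fin(2), of v] cY by (simp add: Z_def)
  have "card (link v X) \<le> m - 1"
    using card_subset_nsets_le[OF link_nsets[OF X, of v]] M' by simp
  then have cE: "m - 2 \<le> card E" using card_link_avoid[OF fin(1), of v] cX M by (simp add: E_def)
  have "\<exists>w. 3 \<le> card (link w E)"
  proof (rule ccontr)
    assume "\<not> ?thesis"
    then have "card (link w E) < 3" for w by (meson not_le)
    then have deg2: "card (link w E) \<le> 2" for w by (simp add: less_Suc_eq_le numeral_eq_Suc)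
    obtain U where U: "U \<in> Z" using cZ M by fastforce
    have U': "finite U" "card U = 2" using U Z by (auto simp: nsets_def)
    have "card E \<le> (\<Sum>t\<in>U. card (link t E))"
      using card_cover_le[OF finE(1) U'(1)] cross_intersectingD[OF crE _ U] by simp
    moreover have "(\<Sum>t\<in>U. card (link t E)) \<le> (\<Sum>t\<in>U. 2)" by (rule sum_mono) (rule deg2)
    ultimately have m6: "m = 6" "card E = 4" "(\<Sum>t\<in>U. card (link t E)) = 4" using U' cE M by auto
    obtain w w' where w: "U = {w, w'}" "w \<noteq> w'" using U' by (auto simp: card_2_iff)
    then have dw: "card (link w E) = 2" using m6(3) deg2[of w] deg2[of w'] by simp
    have 1: "card (avoid w Z) \<le> 1" by (rule card_avoid_le_1[OF E Z crE dw])
    have "card (avoid w E) = 2" using card_link_avoid[OF finE(1), of w] dw m6 by simp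
    then obtain e f where ef: "avoid w E = {e, f}" "e \<noteq> f" by (auto simp: card_2_iff)
    have e: "finite e" "card e = 2" "card f = 2" "finite f"
      using ef(1) E by (auto simp: avoid_def nsets_def)
    have "card (e \<inter> f) \<le> 1"
    proof (rule ccontr)
      assume "\<not> ?thesis"
      then have "card (e \<inter> f) = 2" using e card_mono[of e "e \<inter> f"] by auto
      then have "e \<inter> f = e" "e \<inter> f = f" using e card_subset_eq by (metis Int_lower1, metis Int_lower2)
      then show False using ef by simp
    qed
    \<comment> \<open>A pair of \<open>Z\<close> through \<open>w\<close> has to hit both edges
      \<open>e\<close> and \<open>f\<close>, which avoid \<open>w\<close>, with its other
      point.\<close>
    have "link w Z \<subseteq> (\<lambda>q. {q}) ` (e \<inter> f)"
    proof
      fix W assume W: "W \<in> link w Z"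
      then have "card W = 1" using link_nsets[OF Z, of w] by (auto simp: nsets_def)
      then obtain q where q: "W = {q}" by (auto simp: card_1_singleton_iff)
      have "avoid w E \<subseteq> {e. q \<in> e}"
        using cross_intersectingD[OF cross_link_avoid(1)[OF crE] _ W] q by auto
      then show "W \<in> (\<lambda>q. {q}) ` (e \<inter> f)" using ef q by auto
    qed
    then have "card (link w Z) \<le> card (e \<inter> f)" using e by (meson card_image_le card_mono finite_Int finite_imageI order_trans)
    then show False using \<open>card (e \<inter> f) \<le> 1\<close> 1 card_link_avoid[OF finE(2), of w] cZ m6 by simp
  qed
  then obtain w where w: "3 \<le> card (link w E)" by blast
  then have "link w E \<noteq> {}" by auto
  then have wM: "w \<in> M" "w \<noteq> v" using E by (auto simp: link_def nsets_def)
  have allw: "w \<in> U" if "U \<in> Y" for U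
  proof -
    have "U - {v} \<in> Z" using that allv[OF that] by (auto simp: Z_def link_def insert_absorb)
    then have "w \<in> U - {v}" using cover_avoiding_imp_degree_le(1)[OF E Z crE, of "U - {v}" w] w by force
    then show ?thesis by simp
  qed
  let ?P = "{v, w}"
  let ?Y = "{T \<in> nsets M 3. ?P \<subseteq> T}"
  let ?X = "{e \<in> nsets M 2. e \<inter> ?P \<noteq> {}}"
  have cQ: "card (M - ?P) = m - 2" using M vM wM by (simp add: card_Diff_subset)
  have "?Y = (\<lambda>q. insert q ?P) ` (M - ?P)"
  proof
    show "?Y \<subseteq> (\<lambda>q. insert q ?P) ` (M - ?P)"
    proof
      fix W assume W: "W \<in> ?Y"
      then have "card (W - ?P) = 1" using wM by (auto simp: nsets_def card_Diff_subset)
      then obtain q where "W - ?P = {q}" by (auto simp: card_1_singleton_iff)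
      then have "W = insert q ?P" "q \<in> M - ?P" using W by (auto simp: nsets_def)
      then show "W \<in> (\<lambda>q. insert q ?P) ` (M - ?P)" by blast
    qed
  qed (use vM wM in \<open>auto simp: nsets_def\<close>)
  then have "card ?Y \<le> m - 2" using cQ M by (metis card_image_le finite_Diff)
  moreover have YY: "Y \<subseteq> ?Y" using allv allw Y by auto
  moreover have finY': "finite ?Y" using M by (simp add: finite_imp_finite_nsets)
  ultimately have Yeq: "Y = ?Y" using card_seteq[OF finY' YY] cY by simp
  have "X \<subseteq> ?X"
  proof
    fix e assume e: "e \<in> X"
    then have e': "e \<in> nsets M 2" "finite e" "card e = 2" using X by (auto simp: nsets_def)
    have "\<not> M - ?P \<subseteq> e" using card_mono[OF e'(2), of "M - ?P"] cQ e' M by auto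
    then obtain q where q: "q \<in> M" "q \<noteq> v" "q \<noteq> w" "q \<notin> e" by blast
    have "insert q ?P \<in> Y" unfolding Yeq using q vM wM by (auto simp: nsets_def)
    from cross_intersectingD[OF cr e this] show "e \<in> ?X" using q e' by auto
  qed
  moreover have "card ?X + (m - 2 choose 2) = m choose 2"
    using card_nsets_meeting[of M ?P 2] M vM wM by (simp add: numeral_2_eq_2)
  then have "card ?X = 2 * m - 3"
  proof -
    have "m choose 2 = (m - 1 choose 2) + (m - 1)" using choose_pred_split[of m 2] M by simp
    moreover have "m - 1 choose 2 = (m - 2 choose 2) + (m - 2)"
      using choose_pred_split[of "m - 1" 2] M by (simp add: numeral_2_eq_2)
    ultimately show ?thesis using \<open>card ?X + (m - 2 choose 2) = m choose 2\<close> M by linarith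
  qed
  moreover have "finite ?X" using M by (simp add: finite_imp_finite_nsets)
  ultimately have "X = ?X" using card_subset_eq cX by metis
  then show ?thesis using that[of ?P] Yeq vM wM by simp
qed

section \<open>Pairs of families with large maximum degree\<close>

context uniform_params
begin

definition admissible :: "nat set set \<Rightarrow> nat set set \<Rightarrow> bool" where
  "admissible A B \<longleftrightarrow> A \<subseteq> nsets {1..n} k \<and> B \<subseteq> nsets {1..n} k \<and> nontrivial_cross_intersecting n A B"

text \<open>For \<open>k \<ge> 4\<close> the unit added to \<open>D\<close> leaves two sets in the
  reduced family, as \<open>cross_sum_less\<close> requires. For \<open>k = 3\<close> the degree
  \<open>D + 1\<close> is treated by \<open>three_covers_degree\<close>, so the threshold can stay
  at \<open>D\<close>.\<close>

definition T :: nat where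
  "T = (if k = 3 then D else D + 1)"

definition heavy :: "nat set set \<Rightarrow> bool" where
  "heavy A \<longleftrightarrow> (\<exists>x\<in>{1..n}. T < card (link x A))"

lemma admissibleD:
  assumes "admissible A B"
  shows "A \<subseteq> nsets {1..n} k" "B \<subseteq> nsets {1..n} k" "cross_intersecting A B" "finite A" "finite B"
    "\<And>x. x \<in> {1..n} \<Longrightarrow> avoid x A \<noteq> {}" "\<And>x. x \<in> {1..n} \<Longrightarrow> avoid x B \<noteq> {}"
  using assms finite_subset_nsets[of _ "{1..n}" k]
  by (auto simp: admissible_def nontrivial_cross_intersecting_def nontrivial_def star_def avoid_def)

lemma admissible_commute: "admissible A B \<longleftrightarrow> admissible B A"
  by (auto simp: admissible_def nontrivial_cross_intersecting_def cross_intersecting_commute)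

lemma admissible_local:
  assumes "admissible A B" "x \<in> {1..n}"
  shows "finite ({1..n} - {x})" "card ({1..n} - {x}) = n - 1"
    "link x A \<subseteq> nsets ({1..n} - {x}) (k - 1)" "avoid x B \<subseteq> nsets ({1..n} - {x}) k"
    "cross_intersecting (link x A) (avoid x B)" "avoid x B \<noteq> {}"
  using assms admissibleD[OF assms(1)] link_nsets avoid_nsets cross_link_avoid(2) by auto

lemma T_ge_D: "D \<le> T"
  by (simp add: T_def)

lemma degree_sum_le:
  assumes "admissible A B" "x \<in> {1..n}" "D < card (link x A)"
  shows "card (link x A) + card (avoid x B) \<le> h"
  by (rule cross_sum_le[OF admissible_local(1-5)[OF assms(1,2)] assms(3) admissible_local(6)[OF assms(1,2)]])

lemma max_degree_vertex:
  obtains x where "x \<in> {1..n}" "\<And>y. y \<in> {1..n} \<Longrightarrow> card (link y A) \<le> card (link x A)"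
proof -
  let ?M = "Max ((\<lambda>y. card (link y A)) ` {1..n})"
  have "?M \<in> (\<lambda>y. card (link y A)) ` {1..n}" by (rule Max_in) (use nk in auto)
  then obtain x where "x \<in> {1..n}" "?M = card (link x A)" by blast
  then show ?thesis using that[of x] by (metis Max_ge finite_atLeastAtMost finite_imageI imageI)
qed

text \<open>For vertices \<open>x\<close> and \<open>y\<close> of maximum degree in \<open>A\<close>
  and \<open>B\<close>, add the degree bounds at \<open>x\<close> and \<open>y\<close>; comparing
  the degrees of \<open>x\<close> and \<open>y\<close> within each family turns the sum into
  \<open>card A + card B\<close>. Equality makes \<open>x\<close> a vertex of maximum degree in
  \<open>B\<close> too, so one vertex serves both families.\<close>

lemma heavy_sum_le:
  assumes "admissible A B" "heavy A" "heavy B"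
  obtains x where "x \<in> {1..n}" "T < card (link x A)" "card (link x A) + card (avoid x B) \<le> h"
    "card A + card B \<le> 2 * h"
    "card A + card B = 2 * h \<Longrightarrow> card (link x A) + card (avoid x B) = h \<and> card (link x B) + card (avoid x A) = h
      \<and> T < card (link x B) \<and> (\<forall>y\<in>{1..n}. card (link y B) \<le> card (link x B))"
proof -
  have ba: "admissible B A" using assms(1) admissible_commute by simp
  note fin = admissibleD(4,5)[OF assms(1)]
  obtain x where x: "x \<in> {1..n}" "\<And>y. y \<in> {1..n} \<Longrightarrow> card (link y A) \<le> card (link x A)"
    by (rule max_degree_vertex[of A]) blast
  obtain y where y: "y \<in> {1..n}" "\<And>z. z \<in> {1..n} \<Longrightarrow> card (link z B) \<le> card (link y B)"
    by (rule max_degree_vertex[of B]) blast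
  have hx: "T < card (link x A)" and hy: "T < card (link y B)"
    using assms(2,3) x(2) y(2) unfolding heavy_def by (meson order_less_le_trans)+
  have 1: "card (link x A) + card (avoid x B) \<le> h"
    using degree_sum_le[OF assms(1) x(1)] hx T_ge_D by simp
  have 2: "card (link y B) + card (avoid y A) \<le> h"
    using degree_sum_le[OF ba y(1)] hy T_ge_D by simp
  note s = card_link_avoid[OF fin(2), of x] card_link_avoid[OF fin(1), of y] card_link_avoid[OF fin(1), of x]
     card_link_avoid[OF fin(2), of y] x(2)[OF y(1)] y(2)[OF x(1)]
  have 3: "card A + card B \<le> 2 * h" using 1 2 s by linarith
  show ?thesis
  proof (rule that[OF x(1) hx 1 3])
    assume eq: "card A + card B = 2 * h"
    have "card (link x B) = card (link y B)" using 1 2 s eq by linarith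
    moreover have "card (link x A) + card (avoid x B) = h" "card (link x B) + card (avoid x A) = h"
      using 1 2 s eq by linarith+
    ultimately    show "card (link x A) + card (avoid x B) = h \<and> card (link x B) + card (avoid x A) = h
        \<and> T < card (link x B) \<and> (\<forall>y\<in>{1..n}. card (link y B) \<le> card (link x B))"
      using hy y(2) by simp
  qed
qed

lemma mem_link_iff: "x \<in> U \<Longrightarrow> U \<in> A \<longleftrightarrow> U - {x} \<in> link x A"
  by (auto simp: link_def insert_absorb)

lemma link_eq_meeting:
  assumes X: "X \<subseteq> nsets S (k - 1)" and S: "finite S" "card S = n - 1" and W: "W \<in> nsets S k"
    and cr: "\<And>V. V \<in> X \<Longrightarrow> V \<inter> W \<noteq> {}" and c: "card X + 1 = h"
  shows "X = {V \<in> nsets S (k - 1). V \<inter> W \<noteq> {}}"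
proof -
  let ?G = "{V \<in> nsets S (k - 1). V \<inter> W \<noteq> {}}"
  have "card ?G + (n - 1 - k choose (k - 1)) = N"
    using card_nsets_meeting[OF S(1), of W "k - 1"] S W by (auto simp: nsets_def)
  moreover have "n - 1 - k = n - k - 1" by simp
  ultimately have "card ?G + 1 = h" using hm_bound_add[of k n] nk k3 by simp
  moreover have "X \<subseteq> ?G" using X cr by auto
  moreover have "finite ?G" using S by (simp add: finite_imp_finite_nsets)
  ultimately show ?thesis using card_subset_eq[of ?G X] c by simp
qed

lemma HM_family_eqI:
  assumes A: "A \<subseteq> nsets {1..n} k" and x: "x \<in> {1..n}" and W: "x \<notin> W"
    and l: "link x A = {V \<in> nsets ({1..n} - {x}) (k - 1). V \<inter> W \<noteq> {}}" and a: "avoid x A = {U0}"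
  shows "A = HM_family n k x U0 W"
proof -
  have "U \<in> A \<longleftrightarrow> U \<in> HM_family n k x U0 W" for U
  proof (cases "x \<in> U")
    case True
    have "x \<notin> U0" using a by (auto simp: avoid_def)
    then have "U \<noteq> U0" using True by auto
    have "U \<in> A \<longleftrightarrow> U - {x} \<in> {V \<in> nsets ({1..n} - {x}) (k - 1). V \<inter> W \<noteq> {}}"
      using mem_link_iff[OF True] l by simp
    also have "\<dots> \<longleftrightarrow> U \<in> nsets {1..n} k \<and> U \<inter> W \<noteq> {}"
      using True x W k3 by (auto simp: nsets_def)
    finally show ?thesis using True \<open>U \<noteq> U0\<close> by (auto simp: HM_family_def)
  next
    case False
    then have "U \<in> A \<longleftrightarrow> U \<in> avoid x A" by (simp add: avoid_def)
    then show ?thesis using a False by (auto simp: HM_family_def)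
  qed
  then show ?thesis by blast
qed

lemma cross_HM_typeI:
  assumes ad: "admissible A B" and x: "x \<in> {1..n}"
    and A: "card (link x A) + 1 = h" "card (avoid x A) = 1" and B: "card (link x B) + 1 = h" "card (avoid x B) = 1"
  shows "cross_HM_type n k (A, B)"
proof -
  have ba: "admissible B A" using ad admissible_commute by simp
  obtain U0 W0 where U0: "avoid x A = {U0}" and W0: "avoid x B = {W0}"
    using A B by (auto simp: card_1_singleton_iff)
  note lA = admissible_local[OF ad x] and lB = admissible_local[OF ba x]
  have "link x A = {V \<in> nsets ({1..n} - {x}) (k - 1). V \<inter> W0 \<noteq> {}}"
    by (rule link_eq_meeting[OF lA(3,1,2)]) (use lA W0 A cross_intersectingD[OF lA(5)] in auto)
  moreover have "link x B = {V \<in> nsets ({1..n} - {x}) (k - 1). V \<inter> U0 \<noteq> {}}"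
    by (rule link_eq_meeting[OF lB(3,1,2)]) (use lB U0 B cross_intersectingD[OF lB(5)] in auto)
  moreover have "x \<notin> U0" "x \<notin> W0" using U0 W0 by (auto simp: avoid_def)
  ultimately have eq: "A = HM_family n k x U0 W0" "B = HM_family n k x W0 U0"
    using HM_family_eqI[OF admissibleD(1)[OF ad] x _ _ U0] HM_family_eqI[OF admissibleD(2)[OF ad] x _ _ W0]
    by simp_all
  have mem: "U0 \<in> nsets ({1..n} - {x}) k" "W0 \<in> nsets ({1..n} - {x}) k" using lA(4) lB(4) U0 W0 by auto
  have "U0 \<in> A" "W0 \<in> B" using U0 W0 by (auto simp: avoid_def)
  then have "U0 \<inter> W0 \<noteq> {}" by (rule cross_intersectingD[OF admissibleD(3)[OF ad]])
  moreover have "6 \<le> 2 * k" using k3 by simp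
  ultimately show ?thesis using nk x mem eq unfolding cross_HM_type_def by blast
qed

lemma triangle_family_eqI:
  assumes A: "A \<subseteq> nsets {1..n} 3" and x: "x \<in> {1..n}" and Q: "x \<notin> Q"
    and l: "link x A = {V \<in> nsets ({1..n} - {x}) 2. V \<inter> Q \<noteq> {}}"
    and a: "avoid x A = {U \<in> nsets ({1..n} - {x}) 3. P \<subseteq> U}"
  shows "A = triangle_family n x P Q"
proof -
  have "U \<in> A \<longleftrightarrow> U \<in> triangle_family n x P Q" for U
  proof (cases "x \<in> U")
    case True
    have "U \<in> A \<longleftrightarrow> U - {x} \<in> {V \<in> nsets ({1..n} - {x}) 2. V \<inter> Q \<noteq> {}}"
      using mem_link_iff[OF True] l by simp
    also have "\<dots> \<longleftrightarrow> U \<in> nsets {1..n} 3 \<and> U \<inter> Q \<noteq> {}"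
      using True x Q by (auto simp: nsets_def)
    finally show ?thesis using True by (auto simp: triangle_family_def)
  next
    case False
    then have "U \<in> A \<longleftrightarrow> U \<in> avoid x A" by (simp add: avoid_def)
    then show ?thesis using a False by (auto simp: triangle_family_def nsets_def)
  qed
  then show ?thesis by blast
qed

lemma cross_triangle_typeI:
  assumes ad: "admissible A B" and x: "x \<in> {1..n}" and k: "k = 3"
    and A: "card (link x A) = 2 * n - 5" "card (avoid x A) = n - 3"
    and B: "card (link x B) = 2 * n - 5" "card (avoid x B) = n - 3"
  shows "cross_triangle_type n k (A, B)"
proof -
  have ba: "admissible B A" using ad admissible_commute by simp
  note lA = admissible_local[OF ad x] and lB = admissible_local[OF ba x]
  have k2: "k - 1 = 2" using k by simp
  have num: "6 \<le> n - 1" "card (link x A) = 2 * (n - 1) - 3" "card (link x B) = 2 * (n - 1) - 3"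
      "card (avoid x A) = n - 1 - 2" "card (avoid x B) = n - 1 - 2"
    using A B nk k by auto
  obtain Q where Q: "Q \<in> nsets ({1..n} - {x}) 2" "link x A = {e \<in> nsets ({1..n} - {x}) 2. e \<inter> Q \<noteq> {}}"
      "avoid x B = {W \<in> nsets ({1..n} - {x}) 3. Q \<subseteq> W}"
    by (rule three_covers_structure[OF lA(3)[unfolded k2] lA(4)[unfolded k] lA(5,1,2) num(1,2,5)])
  obtain P where P: "P \<in> nsets ({1..n} - {x}) 2" "link x B = {e \<in> nsets ({1..n} - {x}) 2. e \<inter> P \<noteq> {}}"
      "avoid x A = {W \<in> nsets ({1..n} - {x}) 3. P \<subseteq> W}"
    by (rule three_covers_structure[OF lB(3)[unfolded k2] lB(4)[unfolded k] lB(5,1,2) num(1,3,4)])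
  have xn: "x \<notin> P" "x \<notin> Q" using P(1) Q(1) by (auto simp: nsets_def)
  have AB: "A = triangle_family n x P Q" "B = triangle_family n x Q P"
    by (rule triangle_family_eqI[OF admissibleD(1)[OF ad, unfolded k] x xn(2) Q(2) P(3)],
        rule triangle_family_eqI[OF admissibleD(2)[OF ad, unfolded k] x xn(1) P(2) Q(3)])
  \<comment> \<open>Disjoint \<open>P\<close> and \<open>Q\<close> would extend to disjoint triples
    avoiding \<open>x\<close>; this takes two further points, available since
    \<open>n \<ge> 7\<close>.\<close>
  have "P \<inter> Q \<noteq> {}"
  proof
    assume d: "P \<inter> Q = {}"
    have fin: "finite P" "finite Q" "card P = 2" "card Q = 2" "P \<subseteq> {1..n} - {x}" "Q \<subseteq> {1..n} - {x}"
      using P(1) Q(1) by (auto simp: nsets_def)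
    have ex: "\<exists>y \<in> {1..n} - {x}. y \<notin> R" if "finite R" "card R \<le> 5" for R
    proof -
      have "\<not> {1..n} - {x} \<subseteq> R" using card_mono[OF that(1), of "{1..n} - {x}"] lA(2) that nk k by auto
      then show ?thesis by blast
    qed
    have c: "card (P \<union> Q) = 4" using fin d by (simp add: card_Un_disjoint)
    have c': "card (P \<union> Q) \<le> 5" using c by simp
    obtain y where y: "y \<in> {1..n} - {x}" "y \<notin> P \<union> Q"
      using ex[OF finite_UnI[OF fin(1,2)] c'] by blast
    have "card (insert y (P \<union> Q)) \<le> 5" "finite (insert y (P \<union> Q))" using c fin(1,2)
      by (simp_all add: card_insert_if)
    then obtain z where z: "z \<in> {1..n} - {x}" "z \<notin> insert y (P \<union> Q)"
      using ex by blast
    have "insert y P \<in> avoid x A" unfolding P(3) using y fin by (auto simp: nsets_def)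
    moreover have "insert z Q \<in> avoid x B" unfolding Q(3) using z fin by (auto simp: nsets_def)
    ultimately have "insert y P \<inter> insert z Q \<noteq> {}"
      using admissibleD(3)[OF ad] unfolding avoid_def cross_intersecting_def by blast
    then show False using d y z by auto
  qed
  then show ?thesis using AB P(1) Q(1) x nk k unfolding cross_triangle_type_def by blast
qed

lemma D_3: "k = 3 \<Longrightarrow> D = n - 2"
  by simp

lemma hm_bound_3: "k = 3 \<Longrightarrow> h + 8 = 3 * n"
proof -
  assume k: "k = 3"
  then have "h = (\<Sum>l<3. n - 2 - l) + 1" using hm_bound_sum by simp
  also have "(\<Sum>l<3. n - 2 - l) = (n - 2) + (n - 3) + (n - 4)" by (simp add: numeral_3_eq_3)
  finally show ?thesis using nk k by simp
qed

text \<open>The product is only bounded from below because this is also applied to enlarged and to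
  shifted pairs. As the sum is at most \<open>2 * h\<close>, both sizes are \<open>h\<close> and all
  degree bounds are tight.\<close>

theorem heavy_structure:
  assumes ad: "admissible A B" and hv: "heavy A" "heavy B" and prod: "h\<^sup>2 \<le> card A * card B"
  shows "card A = h \<and> card B = h \<and> (cross_HM_type n k (A, B) \<or> cross_triangle_type n k (A, B))"
proof -
  have ba: "admissible B A" using ad admissible_commute by simp
  obtain x where x: "x \<in> {1..n}" "T < card (link x A)" "card (link x A) + card (avoid x B) \<le> h"
      "card A + card B \<le> 2 * h"
    and eq: "card A + card B = 2 * h \<Longrightarrow> card (link x A) + card (avoid x B) = h \<and> card (link x B) + card (avoid x A) = h
      \<and> T < card (link x B) \<and> (\<forall>y\<in>{1..n}. card (link y B) \<le> card (link x B))"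
    using heavy_sum_le[OF ad hv] by metis
  define a where "a = int (card A)"
  define b where "b = int (card B)"
  have ab: "(int h)\<^sup>2 \<le> a * b" using prod unfolding a_def b_def by (metis of_nat_le_iff of_nat_mult of_nat_power)
  have abh: "a + b \<le> 2 * int h" "0 \<le> a + b" using x(4) unfolding a_def b_def by linarith+
  have "(a + b)\<^sup>2 \<le> (2 * int h)\<^sup>2" by (rule power_mono) (use abh in auto)
  then have "(a - b)\<^sup>2 \<le> 0" using ab by (simp add: power2_eq_square algebra_simps)
  then have "a = b" by simp
  then have "(int h)\<^sup>2 \<le> a\<^sup>2" using ab by (simp add: power2_eq_square)
  then have "int h \<le> a" using power2_le_imp_le[of "int h" a] by (simp add: a_def)
  then have AB: "card A = h" "card B = h" using abh \<open>a = b\<close> by (auto simp: a_def b_def)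
  then have e: "card (link x A) + card (avoid x B) = h" "card (link x B) + card (avoid x A) = h"
     "T < card (link x B)" "\<And>y. y \<in> {1..n} \<Longrightarrow> card (link y B) \<le> card (link x B)" using eq by auto
  note lA = admissible_local[OF ad x(1)] and lB = admissible_local[OF ba x(1)]
  have fin: "finite (avoid x A)" "finite (avoid x B)" using finite_subset_nsets lA lB by metis+
  then have ge1: "1 \<le> card (avoid x A)" "1 \<le> card (avoid x B)"
    using lA(6) lB(6) by (simp_all add: Suc_le_eq card_gt_0_iff)
  note sp = card_link_avoid[OF admissibleD(4)[OF ad], of x] card_link_avoid[OF admissibleD(5)[OF ad], of x]
  have same: "card (avoid x A) = card (avoid x B)" "card (link x A) = card (link x B)" using sp e AB by linarith+
  have "cross_HM_type n k (A, B) \<or> cross_triangle_type n k (A, B)"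
  proof (cases "card (avoid x B) = 1")
    case True
    then show ?thesis using cross_HM_typeI[OF ad x(1)] e same by simp
  next
    case False
    then have two: "2 \<le> card (avoid x B)" using ge1 by simp
    show ?thesis
    proof (cases "k = 3")
      case k: False
      then have "card (link x A) + card (avoid x B) < h"
        using cross_sum_less[OF lA(1-5) _ two] x(2) k3 by (simp add: T_def)
      then show ?thesis using e by simp
    next
      case k: True
      have k2: "k - 1 = 2" using k by simp
      \<comment> \<open>Otherwise \<open>three_covers_degree\<close> provides a vertex whose degree
        in \<open>B\<close> exceeds that of \<open>x\<close>, which is maximal.\<close>
      have "D + 1 \<noteq> card (link x A)"
      proof
        assume d: "D + 1 = card (link x A)"
        then have d': "card (link x A) = n - 1" using D_3[OF k] nk k by linarith
        have n6: "6 \<le> n - 1" using nk k by simp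
        have "card (avoid x B) = 2 * (n - 1) - 5" using e(1) d' hm_bound_3[OF k] nk k by simp
        then obtain z where z: "z \<in> {1..n} - {x}" "n - 1 < card (link z (avoid x B))"
          using three_covers_degree[OF lA(3)[unfolded k2] lA(4)[unfolded k] lA(5,1,2) n6 d'] by blast
        have "link z (avoid x B) \<subseteq> link z B" by (auto simp: link_def avoid_def)
        moreover have "finite (link z B)"
          using finite_subset_nsets[OF link_nsets[OF admissibleD(2)[OF ad]]] by blast
        ultimately have "card (link z (avoid x B)) \<le> card (link z B)" by (rule card_mono[rotated])
        then show False using z e(4)[of z] same d' by simp
      qed
      then have "D + 1 < card (link x A)" using x(2) T_ge_D by linarith
      then have "card (avoid x B) = n - 3" by (rule cross_sum_eq_3[OF lA(1-5) _ two k e(1)])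
      then show ?thesis using cross_triangle_typeI[OF ad x(1) k] same e hm_bound_3[OF k] nk k by simp
    qed
  qed
  then show ?thesis using AB by simp
qed

end

section \<open>Ballot paths of shifted families\<close>

lemma card_link_sum: "finite F \<Longrightarrow> card (link z F) = (\<Sum>U\<in>F. of_bool (z \<in> U))"
  unfolding card_link by (simp add: sum.inter_filter[symmetric] of_bool_def flip: card_eq_sum)

lemma sum_shift: "sum f (shift i j F) = (\<Sum>U\<in>F. f (shift_elem i j F U))"
  using sum.reindex_bij_betw[OF bij_betw_shift_elem, of f i j F] by simp

lemma card_link_shift:
  assumes "finite F" "i \<noteq> j"
  shows "z \<noteq> i \<Longrightarrow> z \<noteq> j \<Longrightarrow> card (link z (shift i j F)) = card (link z F)"
    and "card (link j (shift i j F)) \<le> card (link j F)"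
    and "card (link i (shift i j F)) + card (link j (shift i j F)) = card (link i F) + card (link j F)"
proof -
  have eq: "card (link y F) = (\<Sum>U\<in>F. of_bool (y \<in> U))"
    "card (link y (shift i j F)) = (\<Sum>U\<in>F. of_bool (y \<in> shift_elem i j F U))" for y
    using assms by (simp_all add: card_link_sum finite_shift sum_shift)
  show "card (link z (shift i j F)) = card (link z F)" if "z \<noteq> i" "z \<noteq> j"
    unfolding eq by (rule sum.cong[OF refl]) (use that in \<open>simp add: shift_elem_def\<close>)
  show "card (link j (shift i j F)) \<le> card (link j F)"
    unfolding eq by (rule sum_mono) (use assms in \<open>simp add: shift_elem_def\<close>)
  show "card (link i (shift i j F)) + card (link j (shift i j F)) = card (link i F) + card (link j F)"
    unfolding eq sum.distrib[symmetric]
    by (rule sum.cong[OF refl]) (use assms in \<open>auto simp: shift_elem_def\<close>)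
qed

lemma card_link_shift_ge:
  assumes "finite F" "i \<noteq> j"
  shows "card (link i F) \<le> card (link i (shift i j F))"
    and "U \<in> F \<Longrightarrow> j \<in> U \<Longrightarrow> i \<notin> U \<Longrightarrow> insert i (U - {j}) \<notin> F \<Longrightarrow> card (link i F) < card (link i (shift i j F))"
proof -
  have eq: "card (link i F) = (\<Sum>U\<in>F. of_bool (i \<in> U))"
    "card (link i (shift i j F)) = (\<Sum>U\<in>F. of_bool (i \<in> shift_elem i j F U))"
    using assms by (simp_all add: card_link_sum finite_shift sum_shift)
  show "card (link i F) \<le> card (link i (shift i j F))"
    unfolding eq by (rule sum_mono) (simp add: shift_elem_def)
  show "card (link i F) < card (link i (shift i j F))"
    if "U \<in> F" "j \<in> U" "i \<notin> U" "insert i (U - {j}) \<notin> F"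
    unfolding eq
  proof (rule sum_strict_mono_ex1[OF assms(1)])
    show "\<exists>U\<in>F. (of_bool (i \<in> U) :: nat) < of_bool (i \<in> shift_elem i j F U)"
      using that by (intro bexI[of _ U]) (auto simp: shift_elem_def)
  qed (simp add: shift_elem_def)
qed

text \<open>Stability under all shifts towards \<open>x\<close>, without any order on the other
  points, so that it survives shifts among them.\<close>

definition pulled_to :: "nat \<Rightarrow> nat set set \<Rightarrow> bool" where
  "pulled_to x F \<longleftrightarrow> (\<forall>U\<in>F. x \<notin> U \<longrightarrow> (\<forall>z\<in>U. insert x (U - {z}) \<in> F))"

lemma pulled_toD: "pulled_to x F \<Longrightarrow> U \<in> F \<Longrightarrow> x \<notin> U \<Longrightarrow> z \<in> U \<Longrightarrow> insert x (U - {z}) \<in> F"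
  by (auto simp: pulled_to_def)

lemma pulled_to_shift:
  assumes F: "pulled_to x F" and ij: "i \<noteq> x" "j \<noteq> x" "i \<noteq> j"
  shows "pulled_to x (shift i j F)"
  unfolding pulled_to_def
proof (intro ballI impI)
  fix U z assume U: "U \<in> shift i j F" "x \<notin> U" and z: "z \<in> U"
  let ?W = "insert x (U - {z})"
  have pull: "insert x (V - {y}) \<in> F" if "V \<in> F" "x \<notin> V" "y \<in> V" for V y
    using pulled_toD[OF F that] .
  consider (1) "i \<in> U" "j \<notin> U" "z = i" | (2) "i \<in> U" "j \<notin> U" "z \<noteq> i"
    | (3) "i \<notin> U" "j \<in> U" "z = j" | (4) "i \<notin> U" "j \<in> U" "z \<noteq> j"
    | (5) "i \<in> U" "j \<in> U" | (6) "i \<notin> U" "j \<notin> U" by blast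
  then show "?W \<in> shift i j F"
  proof cases
    case 1
    then have "U \<in> F \<or> insert j (U - {i}) \<in> F" using U by (auto simp: shift_def)
    then have "?W \<in> F"
    proof
      assume "insert j (U - {i}) \<in> F"
      from pull[OF this, of j] have "insert x (insert j (U - {i}) - {j}) \<in> F" using U ij by auto
      moreover have "insert j (U - {i}) - {j} = U - {i}" using 1 by auto
      ultimately show ?thesis using 1 by simp
    qed (use pull U z in auto)
    then show ?thesis using 1 ij by (auto simp: shift_def)
  next
    case 2
    then have "U \<in> F \<or> insert j (U - {i}) \<in> F" using U by (auto simp: shift_def)
    then have "?W \<in> F \<or> insert j (?W - {i}) \<in> F"
    proof
      assume "insert j (U - {i}) \<in> F"
      from pull[OF this, of z] have "insert x (insert j (U - {i}) - {z}) \<in> F" using U ij 2 z by auto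
      moreover have "insert x (insert j (U - {i}) - {z}) = insert j (?W - {i})" using 2 ij z by auto
      ultimately show ?thesis by simp
    qed (use pull U z in auto)
    then show ?thesis using 2 ij by (auto simp: shift_def)
  next
    case 3
    then have "U \<in> F" using U by (auto simp: shift_def)
    then have "?W \<in> F" using pull U z by auto
    then show ?thesis using 3 ij by (auto simp: shift_def)
  next
    case 4
    then have "U \<in> F" and V: "insert i (U - {j}) \<in> F" using U by (auto simp: shift_def)
    then have "?W \<in> F" using pull U z by auto
    moreover have "insert x (insert i (U - {j}) - {z}) \<in> F" by (rule pull[OF V]) (use U ij z 4 in auto)
    moreover have "insert x (insert i (U - {j}) - {z}) = insert i (?W - {j})" using 4 ij z by auto
    ultimately show ?thesis using 4 ij by (auto simp: shift_def)
  next
    case 5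
    then have UF: "U \<in> F" using U by (auto simp: shift_def)
    then have W: "?W \<in> F" using pull U z by auto
    have V: "insert x (U - {j}) \<in> F" using pull[OF UF] U 5 by auto
    show ?thesis
    proof (cases "z = i")
      case True
      then have "insert i (?W - {j}) = insert x (U - {j})" using 5 ij by auto
      then show ?thesis using W V True 5 ij by (auto simp: shift_def)
    next
      case False
      then show ?thesis using W 5 ij by (auto simp: shift_def)
    qed
  next
    case 6
    then have "U \<in> F" using U by (auto simp: shift_def)
    then have "?W \<in> F" using pull U z by auto
    then show ?thesis using 6 ij by (auto simp: shift_def)
  qed
qed

text \<open>Domination puts \<open>m\<close>, the least point of \<open>V - U\<close>, before
  \<open>j\<close>, the least point of \<open>U - V\<close>. Replacing \<open>j\<close> by
  \<open>m\<close> stays in \<open>F\<close>, keeps domination and brings \<open>U\<close> closer to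
  \<open>V\<close>.\<close>

lemma shifted_on_dominated:
  assumes sh: "shifted_on {1..n} F" and "U \<in> F" "F \<subseteq> nsets {1..n} k" "V \<in> nsets {1..n} k"
    and dom: "\<And>t. card (U \<inter> {1..t}) \<le> card (V \<inter> {1..t})"
  shows "V \<in> F"
  using assms(2,5)
proof (induction "card (U - V)" arbitrary: U rule: less_induct)
  case less
  have U: "U \<subseteq> {1..n}" "finite U" "card U = k" and V: "V \<subseteq> {1..n}" "finite V" "card V = k"
    using less.prems(1) assms(3,4) by (auto simp: nsets_def)
  show ?case
  proof (cases "U = V")
    case False
    have "\<not> U \<subseteq> V" "\<not> V \<subseteq> U" using False U V by (metis card_subset_eq)+
    then have ne: "U - V \<noteq> {}" "V - U \<noteq> {}" by auto
    define j where "j = Min (U - V)"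
    define m where "m = Min (V - U)"
    have j: "j \<in> U" "j \<notin> V" "\<And>y. y \<in> U - V \<Longrightarrow> j \<le> y"
      using Min_in[of "U - V"] ne U by (auto simp: j_def)
    have m: "m \<in> V" "m \<notin> U" "\<And>y. y \<in> V - U \<Longrightarrow> m \<le> y"
      using Min_in[of "V - U"] ne V by (auto simp: m_def)
    have "m < j"
    proof (rule ccontr)
      assume "\<not> m < j"
      then have "j < m" using j m by (metis linorder_neqE_nat)
      have "V \<inter> {1..j} \<subseteq> U \<inter> {1..j} - {j}"
      proof
        fix y assume y: "y \<in> V \<inter> {1..j}"
        then have "y \<in> U" using m(3)[of y] \<open>j < m\<close> by force
        then show "y \<in> U \<inter> {1..j} - {j}" using y j by auto
      qed
      then have "card (V \<inter> {1..j}) \<le> card (U \<inter> {1..j} - {j})" by (intro card_mono) auto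
      also have "\<dots> < card (U \<inter> {1..j})" by (rule card_Diff1_less) (use j U in auto)
      finally show False using less.prems(2)[of j] by simp
    qed
    define W where "W = insert m (U - {j})"
    have "W \<in> F" unfolding W_def
      by (rule shifted_onD[OF sh less.prems(1)]) (use j m \<open>m < j\<close> V in auto)
    moreover have "W - V = (U - V) - {j}" using m j by (auto simp: W_def)
    then have "card (W - V) < card (U - V)" using card_Diff1_less[of "U - V" j] j U by auto
    moreover have "card (W \<inter> {1..t}) \<le> card (V \<inter> {1..t})" for t
    proof -
      consider "t < m" | "m \<le> t" "t < j" | "j \<le> t" by linarith
      then show ?thesis
      proof cases
        case 1
        then have "W \<inter> {1..t} = U \<inter> {1..t}" using \<open>m < j\<close> by (auto simp: W_def)
        then show ?thesis using less.prems(2) by simp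
      next
        case 2
        have "W \<inter> {1..t} \<subseteq> V \<inter> {1..t}"
        proof
          fix y assume y: "y \<in> W \<inter> {1..t}"
          then have "y = m \<or> y \<in> U" by (auto simp: W_def)
          then have "y \<in> V" using m(1) j(3)[of y] y 2 by force
          then show "y \<in> V \<inter> {1..t}" using y by simp
        qed
        then show ?thesis by (intro card_mono) auto
      next
        case 3
        have "1 \<le> m" "1 \<le> j" using m V j U by auto
        then have "W \<inter> {1..t} = insert m (U \<inter> {1..t} - {j})" using 3 \<open>m < j\<close> by (auto simp: W_def)
        also have "card \<dots> = card (U \<inter> {1..t})"
        proof -
          have "j \<in> U \<inter> {1..t}" using j 3 \<open>1 \<le> j\<close> by auto
          then show ?thesis using m(2) by (simp add: card.insert_remove card_Suc_Diff1 del: card_Diff_insert)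
        qed
        finally show ?thesis using less.prems(2) by simp
      qed
    qed
    ultimately show ?thesis using less.hyps by blast
  qed (use less.prems in simp)
qed

lemma prefix_step: "card (U \<inter> {1..Suc t}) = card (U \<inter> {1..t}) + of_bool (Suc t \<in> U)"
proof -
  have "U \<inter> {1..Suc t} = (if Suc t \<in> U then insert (Suc t) (U \<inter> {1..t}) else U \<inter> {1..t})"
    by (auto simp: le_Suc_eq)
  then show ?thesis by simp
qed

text \<open>In ballot terms: a member avoiding 1 whose path stays at or below the start forces every path of
  the other family to reach height 3.\<close>

lemma high_path_of_low_path:
  assumes F: "F \<subseteq> nsets {1..n} k" "shifted_on {1..n} F" and n: "2 * k < n"
    and U: "U \<in> F" and low: "\<And>t. 1 \<le> t \<Longrightarrow> 2 * card (U \<inter> {1..t}) < t"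
    and V: "V \<in> nsets {1..n} k" and meet: "\<And>W. W \<in> F \<Longrightarrow> W \<inter> V \<noteq> {}"
  shows "\<exists>t\<le>n. t + 3 \<le> 2 * card (V \<inter> {1..t})"
proof (rule ccontr)
  assume "\<not> ?thesis"
  then have V3: "2 * card (V \<inter> {1..t}) < t + 3" if "t \<le> n" for t using that by (meson not_le)
  have V': "V \<subseteq> {1..n}" "finite V" "card V = k" using V by (auto simp: nsets_def)
  have U': "finite U" "card U = k" using U F by (auto simp: nsets_def)
  let ?C = "{1..n} - V"
  have Ct: "card (?C \<inter> {1..t}) + card (V \<inter> {1..t}) = t" if "t \<le> n" for t
  proof -
    have "?C \<inter> {1..t} = {1..t} - V \<inter> {1..t}" using that by auto
    moreover have "card (V \<inter> {1..t}) \<le> card {1..t}" by (intro card_mono) auto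
    ultimately show ?thesis by (simp add: card_Diff_subset)
  qed
  have "V \<inter> {1..n} = V" using V' by auto
  then have "k \<le> card (?C \<inter> {1..n})" using Ct[of n] V' n by simp
  then obtain t0 where t0: "k \<le> card (?C \<inter> {1..t0})" and least: "\<And>t. t < t0 \<Longrightarrow> card (?C \<inter> {1..t}) < k" and "t0 \<le> n"
    using exists_least_iff[of "\<lambda>t. k \<le> card (?C \<inter> {1..t})"] by (metis not_le)
  have eq: "card (?C \<inter> {1..t0}) = k"
  proof (cases t0)
    case (Suc t)
    then show ?thesis using t0 least[of t] prefix_step[of ?C t] by (auto simp: of_bool_def split: if_splits)
  qed (use t0 in simp)
  \<comment> \<open>The first \<open>k\<close> points outside \<open>V\<close>; membership in
    \<open>F\<close> would contradict \<open>meet\<close>.\<close>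
  define W where "W = ?C \<inter> {1..t0}"
  have "W \<in> F"
  proof (rule shifted_on_dominated[OF F(2) U F(1)])
    show "W \<in> nsets {1..n} k" using eq by (auto simp: W_def nsets_def)
    fix t
    show "card (U \<inter> {1..t}) \<le> card (W \<inter> {1..t})"
    proof (cases "t \<le> t0 \<and> 1 \<le> t")
      case True
      then have "W \<inter> {1..t} = ?C \<inter> {1..t}" by (auto simp: W_def)
      then show ?thesis using Ct[of t] V3[of t] low[of t] True \<open>t0 \<le> n\<close> by simp
    next
      case False
      show ?thesis
      proof (cases "t = 0")
        case t: False
        then have "W \<inter> {1..t} = W" using False by (auto simp: W_def)
        then have "card (W \<inter> {1..t}) = k" using eq by (simp add: W_def)
        then show ?thesis using U' card_mono[of U "U \<inter> {1..t}"] by simp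
      qed simp
    qed
  qed
  then show False using meet[of W] by (auto simp: W_def)
qed

text \<open>Reflection principle: complementing \<open>V\<close> up to the first time at which its path reaches height 3
  is injective.\<close>

lemma card_high_paths_le:
  assumes H: "H \<subseteq> nsets {1..n} k" and high: "\<And>V. V \<in> H \<Longrightarrow> \<exists>t\<le>n. t + 3 \<le> 2 * card (V \<inter> {1..t})" and k: "3 \<le> k"
  shows "card H \<le> n choose (k - 3)"
proof -
  define hit where "hit V = (LEAST t. t + 3 \<le> 2 * card (V \<inter> {1..t}))" for V :: "nat set"
  define reflect where "reflect V t = ({1..t} - V) \<union> (V - {1..t})" for V and t :: nat
  have hit: "hit V + 3 = 2 * card (V \<inter> {1..hit V})" "hit V \<le> n" if V: "V \<in> H" for V
  proof -
    obtain t where t: "t \<le> n" "t + 3 \<le> 2 * card (V \<inter> {1..t})" using high[OF V] by blast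
    have ge: "hit V + 3 \<le> 2 * card (V \<inter> {1..hit V})" unfolding hit_def by (rule LeastI) (rule t)
    show "hit V \<le> n" using Least_le[of "\<lambda>t. t + 3 \<le> 2 * card (V \<inter> {1..t})" t] t by (simp add: hit_def)
    show "hit V + 3 = 2 * card (V \<inter> {1..hit V})"
    proof (cases "hit V")
      case 0 then show ?thesis using ge by simp
    next
      case (Suc t)
      then have "\<not> t + 3 \<le> 2 * card (V \<inter> {1..t})"
        using not_less_Least[of t "\<lambda>t. t + 3 \<le> 2 * card (V \<inter> {1..t})"] by (simp add: hit_def)
      then show ?thesis using ge Suc prefix_step[of V t] by (auto simp: of_bool_def split: if_splits)
    qed
  qed
  have refl_prefix: "card (reflect V t \<inter> {1..s}) + card (V \<inter> {1..s}) = s" if "s \<le> t" for V s t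
  proof -
    have "reflect V t \<inter> {1..s} = {1..s} - V \<inter> {1..s}" using that by (auto simp: reflect_def)
    moreover have "card (V \<inter> {1..s}) \<le> card {1..s}" by (intro card_mono) auto
    ultimately show ?thesis by (simp add: card_Diff_subset)
  qed
  have invol: "reflect (reflect V t) t = V" for V t by (auto simp: reflect_def)
  \<comment> \<open>In the reflected set this is the first time at height \<open>-3\<close>, so it
    can be recovered and the reflection undone.\<close>
  have hit_reflect: "hit V = (LEAST t. 2 * card (reflect V (hit V) \<inter> {1..t}) + 3 \<le> t)" if "V \<in> H" for V
  proof (rule Least_equality[symmetric])
    show "2 * card (reflect V (hit V) \<inter> {1..hit V}) + 3 \<le> hit V"
      using hit(1)[OF that] refl_prefix[of "hit V" "hit V" V] by simp
    show "hit V \<le> s" if s: "2 * card (reflect V (hit V) \<inter> {1..s}) + 3 \<le> s" for s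
    proof (rule ccontr)
      assume "\<not> hit V \<le> s"
      then have "s < hit V" by simp
      then have "s + 3 \<le> 2 * card (V \<inter> {1..s})" using s refl_prefix[of s "hit V" V] by linarith
      then show False using not_less_Least[of s "\<lambda>t. t + 3 \<le> 2 * card (V \<inter> {1..t})"] \<open>s < hit V\<close>
        by (simp add: hit_def)
    qed
  qed
  have "card H \<le> card (nsets {1..n} (k - 3))"
  proof (rule card_inj_on_le)
    show "inj_on (\<lambda>V. reflect V (hit V)) H"
    proof (rule inj_onI)
      fix V W assume VW: "V \<in> H" "W \<in> H" "reflect V (hit V) = reflect W (hit W)"
      then have "hit V = hit W" using hit_reflect by metis
      then show "V = W" using VW(3) invol by metis
    qed
    show "(\<lambda>V. reflect V (hit V)) ` H \<subseteq> nsets {1..n} (k - 3)"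
    proof (rule image_subsetI)
      fix V assume V: "V \<in> H"
      have V': "V \<subseteq> {1..n}" "finite V" "card V = k" using V H by (auto simp: nsets_def)
      have "card (reflect V (hit V)) = card ({1..hit V} - V) + card (V - {1..hit V})"
        unfolding reflect_def by (rule card_Un_disjoint) (use V' in auto)
      moreover have "card (V - {1..hit V}) = k - card (V \<inter> {1..hit V})"
        using V' by (simp add: card_Diff_subset_Int)
      moreover have "card ({1..hit V} - V) = hit V - card (V \<inter> {1..hit V})"
        by (simp add: card_Diff_subset_Int Int_commute)
      moreover have "card (V \<inter> {1..hit V}) \<le> k" using V' card_mono[of V "V \<inter> {1..hit V}"] by simp
      moreover have "card (V \<inter> {1..hit V}) \<le> hit V" using card_mono[of "{1..hit V}" "V \<inter> {1..hit V}"] by simp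
      ultimately have "card (reflect V (hit V)) = k - 3" using hit(1)[OF V] by linarith
      moreover have "reflect V (hit V) \<subseteq> {1..n}" using V' hit(2)[OF V] by (auto simp: reflect_def)
      ultimately show "reflect V (hit V) \<in> nsets {1..n} (k - 3)" using V' by (auto simp: nsets_def reflect_def)
    qed
  qed (simp add: finite_imp_finite_nsets)
  then show ?thesis by simp
qed

text \<open>Group the sets by the last return \<open>2r\<close> of their path to height 0: each group lives on the
  middle levels \<open>r\<close> and \<open>r - 1\<close> of \<open>{2..2r}\<close>, where every shadow element has at most \<open>r\<close> preimages.\<close>

lemma card_le_shadow_of_high_paths:
  assumes F: "F \<subseteq> nsets {1..n} k" and n: "2 * k < n" and one: "\<And>U. U \<in> F \<Longrightarrow> 1 \<notin> U"
    and high: "\<And>U. U \<in> F \<Longrightarrow> \<exists>t\<ge>1. t \<le> 2 * card (U \<inter> {1..t})"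
  shows "card F \<le> card (shadow F)"
proof -
  \<comment> \<open>The offset lets the return time be read off a shadow element:
    \<open>c = 1\<close> makes up for one point deleted no later than that time.\<close>
  define last where "last U c = Max {t. t \<le> n \<and> t \<le> 2 * (card (U \<inter> {1..t}) + c)}" for U :: "nat set" and c :: nat
  have fin: "finite {t. t \<le> n \<and> P t}" for P :: "nat \<Rightarrow> bool" by (rule finite_subset[of _ "{..n}"]) auto
  have finF: "finite F" using finite_subset_nsets[OF F] by simp
  have U': "U \<subseteq> {1..n}" "finite U" "card U = k" if "U \<in> F" for U using that F by (auto simp: nsets_def)
  have last: "last U 0 = 2 * card (U \<inter> {1..last U 0})" "1 \<le> card (U \<inter> {1..last U 0})" "last U 0 < n"
    "\<And>t. last U 0 < t \<Longrightarrow> t \<le> n \<Longrightarrow> 2 * card (U \<inter> {1..t}) < t"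
    if U: "U \<in> F" for U
  proof -
    let ?S = "{t. t \<le> n \<and> t \<le> 2 * (card (U \<inter> {1..t}) + 0)}"
    obtain t where t: "1 \<le> t" "t \<le> 2 * card (U \<inter> {1..t})" using high[OF U] by blast
    have "card (U \<inter> {1..t}) \<le> k" using card_mono[of U "U \<inter> {1..t}"] U'[OF U] by simp
    then have tn: "t \<le> n" using t n by linarith
    then have tS: "t \<in> ?S" using t by simp
    have mem: "last U 0 \<in> ?S" unfolding last_def by (rule Max_in[OF fin]) (use tS in blast)
    have tle: "t \<le> last U 0" unfolding last_def by (rule Max_ge[OF fin tS])
    show mx: "2 * card (U \<inter> {1..s}) < s" if "last U 0 < s" "s \<le> n" for s
    proof (rule ccontr)
      assume "\<not> ?thesis"
      then have "s \<in> ?S" using that by simp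
      then have "s \<le> last U 0" unfolding last_def by (rule Max_ge[OF fin])
      then show False using that by simp
    qed
    show lt: "last U 0 < n"
    proof (rule ccontr)
      assume "\<not> ?thesis"
      then have "last U 0 = n" using mem by simp
      moreover have "card (U \<inter> {1..n}) = k" using U'[OF U] by (simp add: Int_absorb2)
      ultimately show False using mem n by simp
    qed
    show eq: "last U 0 = 2 * card (U \<inter> {1..last U 0})"
      using mx[of "Suc (last U 0)"] lt mem prefix_step[of U "last U 0"] by (auto simp: of_bool_def split: if_splits)
    show "1 \<le> card (U \<inter> {1..last U 0})" using eq tle t by linarith
  qed
  define E where "E = Sigma F (\<lambda>U. U \<inter> {1..last U 0})"
  have finE: "finite E" unfolding E_def using finF by auto
  have last_shadow: "last (U - {z}) 1 = last U 0" if U: "U \<in> F" and z: "z \<in> U" "z \<le> last U 0" for U z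
  proof -
    have z1: "1 \<le> z" using U'[OF U] z by auto
    have eq: "card ((U - {z}) \<inter> {1..t}) + 1 = card (U \<inter> {1..t})" if "z \<le> t" for t
    proof -
      have "(U - {z}) \<inter> {1..t} = U \<inter> {1..t} - {z}" by auto
      moreover have "z \<in> U \<inter> {1..t}" using z z1 that by auto
      ultimately show ?thesis using card_Suc_Diff1[of "U \<inter> {1..t}" z] by simp
    qed
    show ?thesis unfolding last_def[of "U - {z}"]
    proof (rule Max_eqI[OF fin])
      show "last U 0 \<in> {t. t \<le> n \<and> t \<le> 2 * (card ((U - {z}) \<inter> {1..t}) + 1)}"
        using last(1,3)[OF U] eq[OF z(2)] by auto
      fix t assume t: "t \<in> {t. t \<le> n \<and> t \<le> 2 * (card ((U - {z}) \<inter> {1..t}) + 1)}"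
      show "t \<le> last U 0"
      proof (rule ccontr)
        assume "\<not> ?thesis"
        then show False using t eq[of t] last(4)[OF U, of t] z by auto
      qed
    qed
  qed
  define g where "g = (\<lambda>(U, z). (U - {z :: nat}, z))"
  define VS where "VS = fst ` g ` E"
  have finVS: "finite VS" unfolding VS_def using finE by simp
  have VS_sub: "VS \<subseteq> shadow F" by (auto simp: VS_def g_def E_def shadow_def) blast
  \<comment> \<open>At return time \<open>2 * r\<close> the weight is \<open>1 / r\<close>: a member
    has \<open>r\<close> points to delete up to that time, so its weights sum to \<open>1\<close>,
    while a shadow element is charged at most \<open>r\<close> times.\<close>
  define w where "w t = (2 :: real) / real t" for t :: nat
  define Z where "Z V = {2..last V 1} - V" for V
  have inj: "inj_on g E"
  proof (rule inj_onI)
    fix p q assume pq: "p \<in> E" "q \<in> E" "g p = g q"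
    obtain U z U2 z2 where e: "p = (U, z)" "q = (U2, z2)" by (metis surj_pair)
    then have "z \<in> U" "z \<in> U2" "z = z2" "U - {z} = U2 - {z}" using pq by (auto simp: E_def g_def)
    then show "p = q" using e by (metis insert_Diff)
  qed
  have "real (card F) = (\<Sum>U\<in>F. 1)" by simp
  also have "\<dots> = (\<Sum>U\<in>F. \<Sum>z\<in>U \<inter> {1..last U 0}. w (last U 0))"
  proof (rule sum.cong[OF refl])
    fix U assume U: "U \<in> F"
    define c where "c = card (U \<inter> {1..last U 0})"
    have "(\<Sum>z\<in>U \<inter> {1..last U 0}. w (last U 0)) = real c * (2 / real (last U 0))" by (simp add: w_def c_def)
    moreover have "real (last U 0) = 2 * real c" "1 \<le> c" using last(1,2)[OF U] by (simp_all add: c_def)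
    ultimately show "1 = (\<Sum>z\<in>U \<inter> {1..last U 0}. w (last U 0))" by simp
  qed
  also have "\<dots> = (\<Sum>(U, z)\<in>E. w (last U 0))" unfolding E_def
    by (rule sum.Sigma) (use finF in auto)
  also have "\<dots> = (\<Sum>(U, z)\<in>E. w (last (U - {z}) 1))"
    by (rule sum.cong) (use last_shadow in \<open>auto simp: E_def\<close>)
  also have "\<dots> = (\<Sum>p\<in>E. (\<lambda>(V, z). w (last V 1)) (g p))"
    by (rule sum.cong) (auto simp: g_def)
  also have "\<dots> = (\<Sum>(V, z)\<in>g ` E. w (last V 1))"
    using sum.reindex[OF inj, of "\<lambda>(V, z). w (last V 1)"] by (simp add: comp_def)
  also have "\<dots> \<le> (\<Sum>(V, z)\<in>Sigma VS Z. w (last V 1))"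
  proof (rule sum_mono2)
    show "finite (Sigma VS Z)" using finVS by (auto simp: Z_def)
    show "g ` E \<subseteq> Sigma VS Z"
    proof (rule image_subsetI)
      fix p assume p: "p \<in> E"
      obtain U z where e: "p = (U, z)" by (metis surj_pair)
      then have U: "U \<in> F" "z \<in> U" "1 \<le> z" "z \<le> last U 0" using p by (auto simp: E_def)
      have "z \<noteq> 1" using one[OF U(1)] U by auto
      then have "z \<in> Z (U - {z})" using U last_shadow[OF U(1,2,4)] by (auto simp: Z_def)
      moreover have "U - {z} \<in> VS" unfolding VS_def using p e by (force simp: g_def)
      ultimately show "g p \<in> Sigma VS Z" by (simp add: e g_def)
    qed
  qed (auto simp: w_def)
  also have "\<dots> = (\<Sum>V\<in>VS. \<Sum>z\<in>Z V. w (last V 1))"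
    by (rule sum.Sigma[symmetric]) (use finVS in \<open>auto simp: Z_def\<close>)
  also have "\<dots> = (\<Sum>V\<in>VS. 1)"
  proof (rule sum.cong[OF refl])
    fix V assume "V \<in> VS"
    then obtain U z where U: "U \<in> F" "z \<in> U" "1 \<le> z" "z \<le> last U 0" "V = U - {z}"
      by (auto simp: VS_def g_def E_def)
    define r where "r = card (U \<inter> {1..last U 0})"
    have l: "last V 1 = 2 * r" "last U 0 = 2 * r" "1 \<le> r"
      using last_shadow[OF U(1,2,4)] last(1,2)[OF U(1)] U by (auto simp: r_def)
    \<comment> \<open>As \<open>1\<close> is avoided, only the \<open>2 * r - 1\<close> points of
      \<open>{2..2 * r}\<close> compete, and a shadow element occupies \<open>r - 1\<close> of them,
      leaving \<open>r\<close>.\<close>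
    have two: "2 \<le> y" if "y \<in> U" "1 \<le> y" for y
    proof (rule ccontr)
      assume "\<not> 2 \<le> y"
      then have "y = 1" using that(2) by simp
      then show False using one[OF U(1)] that(1) by simp
    qed
    then have "U \<inter> {2..2 * r} = U \<inter> {1..2 * r}" by auto
    moreover have "card (U \<inter> {1..last U 0}) = r" by (simp only: r_def)
    ultimately have c: "card (U \<inter> {2..2 * r}) = r" by (simp only: l(2))
    have "z \<le> 2 * r" using U(4) l(2) by linarith
    then have "z \<in> U \<inter> {2..2 * r}" using two[OF U(2,3)] U(2) by simp
    moreover have "V \<inter> {2..2 * r} = U \<inter> {2..2 * r} - {z}" unfolding U(5) by blast
    ultimately have "card (V \<inter> {2..2 * r}) = r - 1" using c by simp
    moreover have "Z V = {2..2 * r} - V \<inter> {2..2 * r}" unfolding Z_def l(1) by blast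
    ultimately have "card (Z V) = r" using l by (simp add: card_Diff_subset)
    then show "(\<Sum>z\<in>Z V. w (last V 1)) = 1" using l by (simp add: w_def)
  qed
  also have "\<dots> = real (card VS)" by simp
  also have "\<dots> \<le> real (card (shadow F))"
    using card_mono[OF _ VS_sub] finite_subset_nsets[OF shadow_nsets[OF F]] by simp
  finally show ?thesis by simp
qed

section \<open>Pairs with a family of small maximum degree\<close>

lemma four_mult_le: "4 * (x * y) \<le> (s :: nat)\<^sup>2" if "x + y \<le> s"
proof -
  have "4 * (int x * int y) \<le> (int x + int y)\<^sup>2"
    using zero_le_power2[of "int x - int y"] by (simp add: power2_eq_square algebra_simps)
  also have "\<dots> \<le> (int s)\<^sup>2" by (rule power_mono) (use that in auto)
  finally have "int (4 * (x * y)) \<le> int (s\<^sup>2)" by simp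
  then show ?thesis by (simp only: of_nat_le_iff)
qed

lemma binomial_diag_le: "m choose 2 \<le> m + i choose (2 + i)"
proof (induction i)
  case (Suc i)
  have "m + Suc i choose (2 + Suc i) = (m + i choose (2 + Suc i)) + (m + i choose (2 + i))"
    using choose_split[of "2 + Suc i" "m + i"] by simp
  then show ?case using Suc by simp
qed simp

text \<open>The regime away from \<open>n = 2 * k\<close>: \<open>gap\<close> closes the final
  product estimate, and \<open>few_high_paths\<close> makes a family whose paths all reach height
  \<open>3\<close> smaller than \<open>maximal_pair_size\<close> allows.\<close>

locale sparse_params = uniform_params +
  assumes gap: "(h + D)\<^sup>2 < 2 * h\<^sup>2" and few_high_paths: "n choose (k - 3) \<le> D"
begin

text \<open>\<open>gap\<close> means \<open>D / h < sqrt 2 - 1\<close>, and \<open>5 / 12\<close> is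
  a convergent of \<open>sqrt 2 - 1\<close> slightly above it.\<close>

lemma h_gt: "12 * D < 5 * h"
proof (rule ccontr)
  assume neg: "\<not> 12 * D < 5 * h"
  define e where "e = 12 * int D - 5 * int h"
  have e: "0 \<le> e" "e \<le> 12 * int D" using neg unfolding e_def by linarith+
  have h: "5 * int h = 12 * int D - e" by (simp add: e_def)
  have "int ((h + D)\<^sup>2) < int (2 * h\<^sup>2)" using gap by (simp only: of_nat_less_iff)
  then have "(5 * int h)\<^sup>2 > 10 * int D * (5 * int h) + 25 * (int D)\<^sup>2"
    by (simp add: power2_eq_square algebra_simps)
  then have "e * e > (int D)\<^sup>2 + 14 * (int D * e)" unfolding h by (simp add: power2_eq_square algebra_simps)
  moreover have "e * e \<le> 12 * int D * e" by (rule mult_right_mono) (use e in auto)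
  moreover have "0 \<le> int D * e" "0 \<le> (int D)\<^sup>2" using e by simp_all
  ultimately show False by (simp add: mult.assoc)
qed

text \<open>Lower bounds that absorb the additive constants in \<open>T_bounds\<close>.\<close>

lemma D_ge: "5 \<le> D" "4 \<le> k \<Longrightarrow> 21 \<le> D"
proof -
  show 4: "21 \<le> D" if "4 \<le> k"
  proof -
    have "7 choose 2 \<le> n - k + 2 choose 2" by (rule binomial_right_mono) (use nk that in simp)
    also have "\<dots> \<le> n - k + 2 + (k - 4) choose (2 + (k - 4))" by (rule binomial_diag_le)
    finally have "7 choose 2 \<le> n - k + 2 + (k - 4) choose (2 + (k - 4))" .
    moreover have "n - k + 2 + (k - 4) = n - 2" "2 + (k - 4) = k - 2" using nk that by auto
    moreover have "7 choose 2 = (21 :: nat)" by (simp add: numeral_eq_Suc)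
    ultimately show ?thesis by metis
  qed
  show "5 \<le> D"
  proof (cases "k = 3")
    case True then show ?thesis using nk by simp
  next
    case False then show ?thesis using 4 k3 by simp
  qed
qed

text \<open>The linear inequalities used by the later product estimates. In the last one,
  \<open>3 * h + D\<close> is below \<open>82 / 24\<close> times \<open>h\<close> by
  \<open>h_gt\<close>, and a further \<open>h / 24\<close> absorbs the unit in \<open>T\<close>; the
  constant matters because \<open>(83 / 24)\<^sup>2 < 12\<close>.\<close>

lemma T_bounds: "2 * T + 2 \<le> h" "4 * T \<le> h + 2 * D" "T \<le> D + 1" "24 * (3 * h + 2 * T - D) \<le> 83 * h"
proof -
  have "(T = D \<and> 5 \<le> D) \<or> (T = D + 1 \<and> 21 \<le> D)"
  proof (cases "k = 3")
    case True
    have "T = D" unfolding T_def by (rule if_P) (rule True)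
    then show ?thesis using D_ge(1) by blast
  next
    case False
    have "T = D + 1" unfolding T_def by (rule if_not_P) (rule False)
    then show ?thesis using D_ge(2) False k3 by simp
  qed
  then show "T \<le> D + 1" "2 * T + 2 \<le> h" "4 * T \<le> h + 2 * D" "24 * (3 * h + 2 * T - D) \<le> 83 * h"
    using h_gt by linarith+
qed

lemma degree_pair_of_HM:
  assumes x: "x \<in> {1..n}" and "U0 \<in> nsets ({1..n} - {x}) k" "W \<in> nsets ({1..n} - {x}) k"
  shows "2 * T < card (link x (HM_family n k x U0 W))"
proof -
  let ?S = "{1..n} - {x}"
  have S: "finite ?S" "card ?S = n - 1" using x by auto
  have "link x (HM_family n k x U0 W) = {V \<in> nsets ?S (k - 1). V \<inter> W \<noteq> {}}"
    using assms k3 by (auto simp: link_def HM_family_def nsets_def subset_Diff_insert)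
  moreover have "card {V \<in> nsets ?S (k - 1). V \<inter> W \<noteq> {}} + (n - 1 - k choose (k - 1)) = N"
    using card_nsets_meeting[OF S(1), of W "k - 1"] S assms by (auto simp: nsets_def)
  moreover have "n - 1 - k = n - k - 1" by simp
  ultimately have "card (link x (HM_family n k x U0 W)) + 1 = h" using hm_bound_add[of k n] nk k3 by simp
  then show ?thesis using T_bounds(1) by simp
qed

lemma degree_pair_of_triangle:
  assumes x: "x \<in> {1..n}" and Q: "Q \<in> nsets ({1..n} - {x}) 2" and k: "k = 3" and j: "j \<in> {1..n} - {x}"
  shows "2 * T < card (link x (triangle_family n x P Q)) + card (link j (triangle_family n x P Q))"
proof -
  let ?S = "{1..n} - {x}"
  let ?F = "triangle_family n x P Q"
  have S: "finite ?S" "card ?S = n - 1" using x by auto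
  have Q': "Q \<subseteq> ?S" "card Q = 2" "finite Q" using Q by (auto simp: nsets_def)
  have "link x ?F = {e \<in> nsets ?S 2. e \<inter> Q \<noteq> {}}"
    using x Q' by (auto simp: link_def triangle_family_def nsets_def subset_Diff_insert)
  moreover have "card {e \<in> nsets ?S 2. e \<inter> Q \<noteq> {}} + (n - 1 - 2 choose 2) = n - 1 choose 2"
    using card_nsets_meeting[OF S(1) Q'(1), of 2] S Q' by simp
  moreover have "n - 1 choose 2 = (n - 2 choose 2) + (n - 2)" "n - 2 choose 2 = (n - 3 choose 2) + (n - 3)"
    using choose_pred_split[of "n - 1" 2] choose_pred_split[of "n - 2" 2] nk k by (simp_all add: numeral_2_eq_2 numeral_3_eq_3)
  moreover have "n - 1 - 2 = n - 3" by simp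
  ultimately have "card (link x ?F) + (n - 3 choose 2) = (n - 3 choose 2) + (n - 3) + (n - 2)" by metis
  then have 1: "card (link x ?F) = 2 * n - 5" using nk k by linarith
  \<comment> \<open>The degree of \<open>x\<close> is \<open>2 * n - 5 = 2 * T - 1\<close>, so two
    more are needed; the triples \<open>{j, x, y}\<close> with \<open>y\<close> in \<open>Y\<close>
    supply them.\<close>
  define Y where "Y = (if j \<in> Q then ?S - {j} else Q)"
  have finF: "finite ?F" by (simp add: triangle_family_def finite_imp_finite_nsets)
  have "2 \<le> card Y" using Q' S j nk k by (auto simp: Y_def)
  also have "card Y = card ((\<lambda>y. {x, y}) ` Y)"
    by (rule card_image[symmetric]) (auto simp: inj_on_def doubleton_eq_iff)
  also have "\<dots> \<le> card (link j ?F)"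
  proof (rule card_mono)
    show "finite (link j ?F)"
      using bij_betw_finite[OF bij_betw_link[of j ?F]] finF by simp
    show "(\<lambda>y. {x, y}) ` Y \<subseteq> link j ?F"
    proof (rule image_subsetI)
      fix y assume y: "y \<in> Y"
      have ne: "y \<noteq> j" "y \<noteq> x" "y \<in> {1..n}" using y Q' by (auto simp: Y_def split: if_splits)
      then have "{j, x, y} \<in> nsets {1..n} 3" using x j by (auto simp: nsets_def)
      moreover have "{j, x, y} \<inter> Q \<noteq> {}" using y by (auto simp: Y_def split: if_splits)
      ultimately show "{x, y} \<in> link j ?F" using ne j by (auto simp: link_def triangle_family_def)
    qed
  qed
  finally have 2: "2 \<le> card (link j ?F)" .
  have "T = D" unfolding T_def by (rule if_P[OF k])
  then have "2 * T = 2 * (n - 2)" using D_3[OF k] by linarith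
  then show ?thesis using 1 2 nk k by linarith
qed

text \<open>The shift of \<open>j\<close> to \<open>1\<close> preserves the sum of the degrees of
  \<open>1\<close> and \<open>j\<close> but not each of them, so one large degree after the shift
  says little about the family before. Sums over two vertices do carry back, as
  \<open>heavy_of_peaked_shift\<close> shows.\<close>

definition peaked :: "nat set set \<Rightarrow> bool" where
  "peaked F \<longleftrightarrow> (\<exists>x\<in>{1..n}. \<forall>j\<in>{1..n} - {x}. 2 * T < card (link x F) + card (link j F))"

lemma peaked_of_type:
  assumes "cross_HM_type n k (A, B) \<or> cross_triangle_type n k (A, B)"
  shows "peaked A" "peaked B"
proof -
  have "peaked A \<and> peaked B" using assms
  proof
    assume "cross_HM_type n k (A, B)"
    then obtain x U0 W0 where x: "x \<in> {1..n}" "U0 \<in> nsets ({1..n} - {x}) k" "W0 \<in> nsets ({1..n} - {x}) k"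
      and AB: "A = HM_family n k x U0 W0" "B = HM_family n k x W0 U0"
      unfolding cross_HM_type_def by blast
    show ?thesis unfolding peaked_def AB
      using degree_pair_of_HM[OF x] degree_pair_of_HM[OF x(1,3,2)] x(1) by (meson trans_less_add1)
  next
    assume t: "cross_triangle_type n k (A, B)"
    then have k: "k = 3" by (simp add: cross_triangle_type_def)
    from t obtain x P Q where x: "x \<in> {1..n}" "P \<in> nsets ({1..n} - {x}) 2" "Q \<in> nsets ({1..n} - {x}) 2"
      and AB: "A = triangle_family n x P Q" "B = triangle_family n x Q P"
      unfolding cross_triangle_type_def by blast
    show ?thesis unfolding peaked_def AB
      using degree_pair_of_triangle[OF x(1,3) k] degree_pair_of_triangle[OF x(1,2) k] x(1) by blast
  qed
  then show "peaked A" "peaked B" by auto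
qed

lemma heavy_of_peaked_shift:
  assumes F: "finite F" and pk: "peaked (shift 1 j F)" and j: "j \<in> {2..n}"
  shows "heavy F"
proof (rule ccontr)
  assume "\<not> heavy F"
  then have le: "card (link z F) \<le> T" if "z \<in> {1..n}" for z using that by (auto simp: heavy_def not_less)
  let ?F = "shift 1 j F"
  obtain x where x: "x \<in> {1..n}" and big: "\<And>z. z \<in> {1..n} - {x} \<Longrightarrow> 2 * T < card (link x ?F) + card (link z ?F)"
    using pk by (auto simp: peaked_def)
  have j1: "1 \<noteq> j" "j \<in> {1..n}" "1 \<in> {1..n}" using j by auto
  have s: "card (link 1 ?F) + card (link j ?F) \<le> 2 * T"
    using card_link_shift(3)[OF F j1(1)] le[OF j1(2)] le[OF j1(3)] by simp
  consider "x = 1" | "x = j" | "x \<noteq> 1" "x \<noteq> j" by blast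
  then show False
  proof cases
    case 1 then show False using big[of j] s j1 by simp
  next
    case 2 then show False using big[of 1] s j1 by simp
  next
    case 3
    have "\<not> {1..n} \<subseteq> {1, j, x}" using card_mono[of "{1, j, x}" "{1..n}"] nk k3 by (auto simp: card_insert_if split: if_splits)
    then obtain z where z: "z \<in> {1..n}" "z \<noteq> 1" "z \<noteq> j" "z \<noteq> x" by blast
    have "card (link x ?F) \<le> T" "card (link z ?F) \<le> T"
      using card_link_shift(1)[OF F j1(1)] 3 z le x by simp_all
    then show False using big[of z] z by simp
  qed
qed

section \<open>Maximal counterexamples\<close>

definition light_pair :: "nat set set \<Rightarrow> nat set set \<Rightarrow> bool" where
  "light_pair A B \<longleftrightarrow> admissible A B \<and> h\<^sup>2 \<le> card A * card B \<and> \<not> (heavy A \<and> heavy B)"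

text \<open>The factor exceeds the degree sum, so that the order is lexicographic: sizes first, then the
  degrees of \<open>1\<close>.\<close>

definition potential :: "nat set set \<Rightarrow> nat set set \<Rightarrow> nat" where
  "potential A B = (card A + card B) * (2 * (n choose k) + 1) + (card (link 1 A) + card (link 1 B))"

definition maximal_pair :: "nat set set \<Rightarrow> nat set set \<Rightarrow> bool" where
  "maximal_pair A B \<longleftrightarrow> light_pair A B \<and> (\<forall>A' B'. light_pair A' B' \<longrightarrow> potential A' B' \<le> potential A B)"

lemma light_pair_commute: "light_pair A B \<longleftrightarrow> light_pair B A"
  by (auto simp: light_pair_def admissible_commute mult.commute)

lemma maximal_pair_commute: "maximal_pair A B \<longleftrightarrow> maximal_pair B A"
proof -
  have "potential A B = potential B A" for A B by (simp add: potential_def add.commute)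
  then show ?thesis unfolding maximal_pair_def using light_pair_commute by metis
qed

lemma card_link_le: "finite A \<Longrightarrow> card (link x A) \<le> card A"
  using card_link_avoid[of A x] by simp

lemma exists_maximal_pair:
  assumes "light_pair A B"
  obtains A' B' where "maximal_pair A' B'"
proof -
  let ?P = "\<lambda>p. light_pair (fst p) (snd p)"
  let ?f = "\<lambda>p. potential (fst p) (snd p)"
  define M where "M = (2 * (n choose k)) * (2 * (n choose k) + 1) + 2 * (n choose k) + 1"
  have bound: "?f p < M" if "?P p" for p
  proof -
    have ad: "admissible (fst p) (snd p)" using that by (simp add: light_pair_def)
    have "card (fst p) \<le> n choose k" "card (snd p) \<le> n choose k"
      using card_subset_nsets_le[OF admissibleD(1)[OF ad]] card_subset_nsets_le[OF admissibleD(2)[OF ad]] by simp_all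
    moreover have "card (link 1 (fst p)) \<le> card (fst p)" "card (link 1 (snd p)) \<le> card (snd p)"
      using card_link_le admissibleD(4,5)[OF ad] by auto
    ultimately have "card (fst p) + card (snd p) \<le> 2 * (n choose k)"
        "card (link 1 (fst p)) + card (link 1 (snd p)) \<le> 2 * (n choose k)" by linarith+
    then have "potential (fst p) (snd p) \<le> (2 * (n choose k)) * (2 * (n choose k) + 1) + 2 * (n choose k)"
      unfolding potential_def by (intro add_le_mono mult_le_mono1)
    then show ?thesis by (simp only: M_def Suc_eq_plus1[symmetric] less_Suc_eq_le)
  qed
  have "\<exists>p. ?P p \<and> (\<forall>q. ?P q \<longrightarrow> ?f q \<le> ?f p)"
    by (rule ex_has_greatest_nat[of ?P "(A, B)" ?f M]) (use assms bound in simp_all)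
  then obtain p where p: "?P p" "\<And>q. ?P q \<Longrightarrow> ?f q \<le> ?f p" by blast
  have "potential A' B' \<le> ?f p" if "light_pair A' B'" for A' B' using p(2)[of "(A', B')"] that by simp
  then show ?thesis using that[of "fst p" "snd p"] p(1) unfolding maximal_pair_def by blast
qed

text \<open>Adding a set raises the product above \<open>h\<^sup>2\<close>. If both families are
  heavy afterwards, \<open>heavy_structure\<close> makes both sizes \<open>h\<close>, a
  contradiction; otherwise the larger pair beats the maximal one.\<close>

lemma maximal_pair_saturated:
  assumes mx: "maximal_pair A B" and U: "U \<in> nsets {1..n} k" and meet: "\<And>V. V \<in> B \<Longrightarrow> U \<inter> V \<noteq> {}"
  shows "U \<in> A"
proof (rule ccontr)
  assume "U \<notin> A"
  have lp: "light_pair A B" using mx by (simp add: maximal_pair_def)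
  then have ad: "admissible A B" and prod: "h\<^sup>2 \<le> card A * card B" by (auto simp: light_pair_def)
  let ?A = "insert U A"
  have ad': "admissible ?A B"
    using ad U meet by (auto simp: admissible_def nontrivial_cross_intersecting_def cross_intersecting_def
        nontrivial_def star_def)
  have fin: "finite A" "finite B" using admissibleD[OF ad] by auto
  have cA: "card ?A = Suc (card A)" using fin \<open>U \<notin> A\<close> by simp
  have "B \<noteq> {}" using admissibleD(7)[OF ad, of 1] nk by (auto simp: avoid_def)
  then have "0 < card B" using fin by (simp add: card_gt_0_iff)
  then have more: "h\<^sup>2 < card ?A * card B" using prod cA by simp
  show False
  proof (cases "heavy ?A \<and> heavy B")
    case True
    then have "card ?A = h \<and> card B = h" using heavy_structure[OF ad'] more by simp
    then show False using more by (simp add: power2_eq_square)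
  next
    case False
    then have "light_pair ?A B" using ad' more by (simp add: light_pair_def)
    then have "potential ?A B \<le> potential A B" using mx by (simp add: maximal_pair_def)
    moreover have "card (link 1 A) \<le> card (link 1 ?A)" unfolding card_link using fin by (intro card_mono) auto
    ultimately show False using cA by (simp add: potential_def)
  qed
qed

text \<open>With at most \<open>D\<close> sets in one family, \<open>nontrivial_imp_card_le\<close>
  bounds the product by \<open>(h - 1)\<^sup>2\<close>.\<close>

lemma maximal_pair_size:
  assumes "maximal_pair A B"
  shows "D < card A"
proof (rule ccontr)
  assume small: "\<not> D < card A"
  have ad: "admissible A B" and prod: "h\<^sup>2 \<le> card A * card B"
    using assms by (auto simp: maximal_pair_def light_pair_def)
  have ba: "admissible B A" using ad admissible_commute by simp
  have "card B * D \<le> (h - 1)\<^sup>2"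
    by (rule nontrivial_imp_card_le[OF admissibleD(1,2)[OF ba] _ _ admissibleD(3)[OF ba]])
       (use admissibleD(7)[OF ba] in \<open>auto simp: avoid_def\<close>)
  moreover have "card A * card B \<le> card B * D" using small by (simp add: mult.commute)
  moreover have "(h - 1)\<^sup>2 < h\<^sup>2" using T_bounds(1) by (intro power_strict_mono) auto
  ultimately show False using prod by linarith
qed

text \<open>A shift that moves a set raises the degree of \<open>1\<close> at unchanged sizes, so by
  maximality the shifted pair is not light. It is then extremal, hence peaked, and the original
  families were heavy already.\<close>

lemma maximal_pair_shift:
  assumes mx: "maximal_pair A B" and j: "j \<in> {2..n}" and ad': "admissible (shift 1 j A) (shift 1 j B)"
    and U: "U \<in> A" "1 \<notin> U" "j \<in> U"
  shows "insert 1 (U - {j}) \<in> A"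
proof (rule ccontr)
  assume no: "insert 1 (U - {j}) \<notin> A"
  have ad: "admissible A B" and prod: "h\<^sup>2 \<le> card A * card B" and low: "\<not> (heavy A \<and> heavy B)"
    using mx by (auto simp: maximal_pair_def light_pair_def)
  have fin: "finite A" "finite B" using admissibleD[OF ad] by auto
  have prod': "h\<^sup>2 \<le> card (shift 1 j A) * card (shift 1 j B)" using prod by (simp add: card_shift)
  show False
  proof (cases "heavy (shift 1 j A) \<and> heavy (shift 1 j B)")
    case True
    then have "cross_HM_type n k (shift 1 j A, shift 1 j B) \<or> cross_triangle_type n k (shift 1 j A, shift 1 j B)"
      using heavy_structure[OF ad' _ _ prod'] by blast
    then have "heavy A" "heavy B" using heavy_of_peaked_shift[OF _ _ j] peaked_of_type fin by blast+
    then show False using low by blast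
  next
    case False
    then have "light_pair (shift 1 j A) (shift 1 j B)" using ad' prod' by (simp add: light_pair_def)
    then have "potential (shift 1 j A) (shift 1 j B) \<le> potential A B" using mx by (simp add: maximal_pair_def)
    moreover have "card (link 1 A) < card (link 1 (shift 1 j A))"
      by (rule card_link_shift_ge(2)[OF fin(1) _ U(1,3,2) no]) (use j in auto)
    moreover have "card (link 1 B) \<le> card (link 1 (shift 1 j B))"
      by (rule card_link_shift_ge(1)[OF fin(2)]) (use j in auto)
    ultimately show False by (simp add: potential_def card_shift)
  qed
qed

section \<open>Shifts that destroy non-triviality\<close>

definition collapsing :: "nat \<Rightarrow> nat set set \<Rightarrow> bool" where
  "collapsing j F \<longleftrightarrow> (\<forall>U\<in>F. 1 \<notin> U \<longrightarrow> j \<in> U \<and> insert 1 (U - {j}) \<notin> F)"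

text \<open>The centre of the new star must be \<open>1\<close>, the only point that this shift adds
  to a set; so every member avoiding \<open>1\<close> has been moved.\<close>

lemma collapsing_of_star_shift:
  assumes nt: "nontrivial n F" and st: "\<not> nontrivial n (shift 1 j F)" and j: "j \<in> {2..n}"
  shows "collapsing j F"
proof -
  let ?F = "shift 1 j F"
  obtain x where x: "x \<in> {1..n}" "\<And>U. U \<in> ?F \<Longrightarrow> x \<in> U" using st by (auto simp: nontrivial_def star_def)
  obtain W where W: "W \<in> F" "x \<notin> W" using nt x(1) unfolding nontrivial_def star_def by blast
  have "shift_elem 1 j F W \<in> ?F" using W(1) by (rule bij_betw_apply[OF bij_betw_shift_elem])
  then have "x \<in> shift_elem 1 j F W" by (rule x(2))
  then have x1: "x = 1" using W by (auto simp: shift_elem_def split: if_splits)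
  show ?thesis unfolding collapsing_def
  proof (intro ballI impI)
    fix U assume U: "U \<in> F" "1 \<notin> U"
    have "shift_elem 1 j F U \<in> ?F" using U(1) by (rule bij_betw_apply[OF bij_betw_shift_elem])
    then have "1 \<in> shift_elem 1 j F U" using x(2) x1 by blast
    then show "j \<in> U \<and> insert 1 (U - {j}) \<notin> F" using U by (auto simp: shift_elem_def split: if_splits)
  qed
qed

text \<open>After the shift \<open>F\<close> is a star at \<open>1\<close> of unchanged size, and
  the members of \<open>G\<close> avoiding both points have not moved. So the degree bound at
  \<open>1\<close> counts all of \<open>F\<close>.\<close>

lemma collapsing_sum_le:
  assumes ad: "admissible F G" and big: "D < card F" and col: "collapsing j F" and j: "j \<in> {2..n}"
    and ne: "{U \<in> G. 1 \<notin> U \<and> j \<notin> U} \<noteq> {}"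
  shows "card F + card {U \<in> G. 1 \<notin> U \<and> j \<notin> U} \<le> h"
proof -
  let ?F = "shift 1 j F" and ?G = "{U \<in> G. 1 \<notin> U \<and> j \<notin> U}"
  have j1: "1 \<noteq> j" "1 \<in> {1..n}" "j \<in> {1..n}" using j by auto
  have F: "?F \<subseteq> nsets {1..n} k" by (rule shift_nsets[OF admissibleD(1)[OF ad] j1(2,3)])
  have finF: "finite F" using admissibleD[OF ad] by simp
  have "avoid 1 ?F = {}" using col by (auto simp: avoid_def shift_def collapsing_def split: if_splits)
  then have cF: "card (link 1 ?F) = card F"
    using card_link_avoid[OF finite_shift[OF finF, of 1 j], of 1] by (simp add: card_shift)
  have cr: "cross_intersecting ?F (shift 1 j G)"
    by (rule cross_intersecting_shift[OF admissibleD(3)[OF ad] j1(1)])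
  have "cross_intersecting (link 1 ?F) (avoid 1 (shift 1 j G))" by (rule cross_link_avoid(2)[OF cr])
  moreover have "?G \<subseteq> avoid 1 (shift 1 j G)" by (auto simp: avoid_def shift_def)
  ultimately have "cross_intersecting (link 1 ?F) ?G" unfolding cross_intersecting_def by blast
  then have "card (link 1 ?F) + card ?G \<le> h"
    using link_nsets[OF F, of 1] admissibleD(2)[OF ad] ne big cF j1
    by (intro cross_sum_le[of "{1..n} - {1}"]) (auto simp: nsets_def)
  then show ?thesis using cF by simp
qed

lemma cells:
  assumes "finite F" "x \<noteq> y"
  shows "card F = card {U \<in> F. x \<in> U \<and> y \<in> U} + card {U \<in> F. x \<in> U \<and> y \<notin> U}
      + card {U \<in> F. x \<notin> U \<and> y \<in> U} + card {U \<in> F. x \<notin> U \<and> y \<notin> U}"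
    "card (link x F) = card {U \<in> F. x \<in> U \<and> y \<in> U} + card {U \<in> F. x \<in> U \<and> y \<notin> U}"
    "card (link y F) = card {U \<in> F. x \<in> U \<and> y \<in> U} + card {U \<in> F. x \<notin> U \<and> y \<in> U}"
    "card (avoid x F) = card {U \<in> F. x \<notin> U \<and> y \<in> U} + card {U \<in> F. x \<notin> U \<and> y \<notin> U}"
    "card (avoid y F) = card {U \<in> F. x \<in> U \<and> y \<notin> U} + card {U \<in> F. x \<notin> U \<and> y \<notin> U}"
proof -
  have *: "card {U \<in> G. y \<in> U} + card {U \<in> G. y \<notin> U} = card G" if "finite G" for G :: "nat set set" and y
    using card_partition_elem[OF that, of y] by simp
  show x: "card (link x F) = card {U \<in> F. x \<in> U \<and> y \<in> U} + card {U \<in> F. x \<in> U \<and> y \<notin> U}"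
    using *[of "{U \<in> F. x \<in> U}" y] assms by (simp add: card_link conj_assoc)
  show "card (link y F) = card {U \<in> F. x \<in> U \<and> y \<in> U} + card {U \<in> F. x \<notin> U \<and> y \<in> U}"
    using *[of "{U \<in> F. y \<in> U}" x] assms by (simp add: card_link conj_ac)
  show ax: "card (avoid x F) = card {U \<in> F. x \<notin> U \<and> y \<in> U} + card {U \<in> F. x \<notin> U \<and> y \<notin> U}"
    using *[of "{U \<in> F. x \<notin> U}" y] assms by (simp add: avoid_def conj_assoc)
  show "card (avoid y F) = card {U \<in> F. x \<in> U \<and> y \<notin> U} + card {U \<in> F. x \<notin> U \<and> y \<notin> U}"
    using *[of "{U \<in> F. y \<notin> U}" x] assms by (simp add: avoid_def conj_ac)
  show "card F = card {U \<in> F. x \<in> U \<and> y \<in> U} + card {U \<in> F. x \<in> U \<and> y \<notin> U}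
      + card {U \<in> F. x \<notin> U \<and> y \<in> U} + card {U \<in> F. x \<notin> U \<and> y \<notin> U}"
    using card_link_avoid[OF assms(1), of x] x ax by simp
qed

lemma card_nsets_containing_pair:
  assumes "x \<in> {1..n}" "y \<in> {1..n}" "x \<noteq> y"
  shows "card {U \<in> nsets {1..n} k. x \<in> U \<and> y \<in> U} = D"
proof -
  have "bij_betw (\<lambda>V. insert x (insert y V)) (nsets ({1..n} - {x, y}) (k - 2)) {U \<in> nsets {1..n} k. x \<in> U \<and> y \<in> U}"
  proof (rule bij_betwI[of _ _ _ "\<lambda>U. U - {x, y}"])
    show "(\<lambda>V. insert x (insert y V)) \<in> nsets ({1..n} - {x, y}) (k - 2) \<rightarrow> {U \<in> nsets {1..n} k. x \<in> U \<and> y \<in> U}"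
    proof
      fix V assume "V \<in> nsets ({1..n} - {x, y}) (k - 2)"
      then have V: "V \<subseteq> {1..n}" "x \<notin> V" "y \<notin> V" "finite V" "card V = k - 2" by (auto simp: nsets_def)
      then show "insert x (insert y V) \<in> {U \<in> nsets {1..n} k. x \<in> U \<and> y \<in> U}"
        using assms k3 by (auto simp: nsets_def)
    qed
    show "(\<lambda>U. U - {x, y}) \<in> {U \<in> nsets {1..n} k. x \<in> U \<and> y \<in> U} \<rightarrow> nsets ({1..n} - {x, y}) (k - 2)"
      using assms by (auto simp: nsets_def card_Diff_subset)
    show "insert x (insert y V) - {x, y} = V" if "V \<in> nsets ({1..n} - {x, y}) (k - 2)" for V
      using that by (auto simp: nsets_def)
    show "insert x (insert y (U - {x, y})) = U" if "U \<in> {U \<in> nsets {1..n} k. x \<in> U \<and> y \<in> U}" for U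
      using that by auto
  qed
  moreover have "card ({1..n} - {x, y}) = n - 2" using assms by (simp add: card_Diff_subset)
  ultimately show ?thesis using bij_betw_same_card by fastforce
qed

lemma pair_cell_eq:
  assumes mx: "maximal_pair A B" and j: "j \<in> {2..n}" and cov: "\<And>V. V \<in> B \<Longrightarrow> 1 \<in> V \<or> j \<in> V"
  shows "card {U \<in> A. 1 \<in> U \<and> j \<in> U} = D"
proof -
  have "A \<subseteq> nsets {1..n} k" using mx admissibleD by (auto simp: maximal_pair_def light_pair_def)
  moreover have "U \<in> A" if U: "U \<in> nsets {1..n} k" "1 \<in> U" "j \<in> U" for U
  proof (rule maximal_pair_saturated[OF mx U(1)])
    fix V assume "V \<in> B"
    then show "U \<inter> V \<noteq> {}" using cov[of V] U(2,3) by auto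
  qed
  ultimately have "{U \<in> A. 1 \<in> U \<and> j \<in> U} = {U \<in> nsets {1..n} k. 1 \<in> U \<and> j \<in> U}" by blast
  moreover have "1 \<in> {1..n}" "j \<in> {1..n}" "1 \<noteq> j" using j by auto
  ultimately show ?thesis using card_nsets_containing_pair by simp
qed

lemma light_degree: "\<not> heavy B \<Longrightarrow> x \<in> {1..n} \<Longrightarrow> card (link x B) \<le> T"
  by (auto simp: heavy_def not_less)

lemma degree_sum_le_h:
  assumes ad: "admissible A B" and x: "x \<in> {1..n}" and y: "card (avoid x B) \<le> T"
  shows "card (link x A) + card (avoid x B) \<le> h"
proof (cases "D < card (link x A)")
  case True then show ?thesis by (rule degree_sum_le[OF ad x])
next
  case False then show ?thesis using y T_bounds(1) T_ge_D by linarith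
qed

text \<open>Since \<open>{1, j}\<close> meets every member of \<open>A\<close>, maximality puts all \<open>D\<close> sets through \<open>1\<close> and \<open>j\<close>
  into \<open>B\<close>; they count twice in the degrees of \<open>1\<close> and \<open>j\<close>, which are at most \<open>T\<close>.\<close>

lemma no_collapse_of_partner:
  assumes mx: "maximal_pair A B" and lB: "\<not> heavy B" and j: "j \<in> {2..n}" and col: "collapsing j A"
  shows False
proof -
  have ad: "admissible A B" and prod: "h\<^sup>2 \<le> card A * card B"
    using mx by (auto simp: maximal_pair_def light_pair_def)
  have xm: "maximal_pair B A" using mx maximal_pair_commute by simp
  have j1: "1 \<noteq> j" "1 \<in> {1..n}" "j \<in> {1..n}" using j by auto
  have fin: "finite A" "finite B" using admissibleD[OF ad] by auto
  have cov: "1 \<in> U \<or> j \<in> U" if "U \<in> A" for U using col that by (auto simp: collapsing_def)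
  let ?b = "card {U \<in> B. 1 \<notin> U \<and> j \<notin> U}"
  note cB = cells[OF fin(2) j1(1)] and cA = cells[OF fin(1) j1(1)]
  have "card {U \<in> B. 1 \<in> U \<and> j \<in> U} = D" by (rule pair_cell_eq[OF xm j cov])
  then have b: "card B + D \<le> 2 * T + ?b"
    using cB(1,2,3) light_degree[OF lB j1(2)] light_degree[OF lB j1(3)] by linarith
  show False
  proof (cases "?b = 0")
    case False
    then have "{U \<in> B. 1 \<notin> U \<and> j \<notin> U} \<noteq> {}" by (metis card.empty)
    from collapsing_sum_le[OF ad maximal_pair_size[OF mx] col j this] have a: "card A + ?b \<le> h" .
    have "card A + card B \<le> h + 2 * T - D" using a b T_ge_D by linarith
    then have "4 * (card A * card B) \<le> (h + 2 * T - D)\<^sup>2" by (rule four_mult_le)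
    also have "\<dots> < (2 * h)\<^sup>2" by (rule power_strict_mono) (use T_bounds(1) D_ge in linarith)+
    finally show False using prod by simp
  next
    \<comment> \<open>Now \<open>B\<close> has at most \<open>2 * T - D\<close> members, which is at
      most \<open>h / 2\<close>, while the degrees of \<open>1\<close> and \<open>j\<close>, which
      cover \<open>A\<close>, sum to less than \<open>2 * h\<close>.\<close>
    case True
    have "{U \<in> A. 1 \<notin> U \<and> j \<notin> U} = {}" using cov by blast
    then have "card {U \<in> A. 1 \<notin> U \<and> j \<notin> U} = 0" by (metis card.empty)
    then have "card A \<le> card (link 1 A) + card (link j A)" using cA(1,2,3) by linarith
    moreover have "card (link x A) \<le> h" if "x \<in> {1..n}" for x
    proof (cases "D < card (link x A)")
      case True then show ?thesis using degree_sum_le[OF ad that] by simp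
    next
      case False then show ?thesis using T_bounds(1) T_ge_D by linarith
    qed
    moreover have "card (link 1 A) < h"
    proof (cases "D < card (link 1 A)")
      case True
      moreover have "0 < card (avoid 1 B)" using admissibleD(7)[OF ad j1(2)] finite_subset_nsets[OF avoid_nsets[OF admissibleD(2)[OF ad]]]
        by (simp add: card_gt_0_iff)
      ultimately show ?thesis using degree_sum_le[OF ad j1(2)] by simp
    next
      case False then show ?thesis using T_bounds(1) T_ge_D by linarith
    qed
    ultimately have a: "card A < 2 * h" using j1(3) by fastforce
    have "2 * card B \<le> h" using b True T_bounds(2) by linarith
    moreover have "0 < card B" using maximal_pair_size[OF xm] by simp
    ultimately have "2 * (card A * card B) < 2 * h\<^sup>2"
    proof -
      have "card A * card B < 2 * h * card B" using a \<open>0 < card B\<close> by simp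
      also have "\<dots> \<le> h * h" using \<open>2 * card B \<le> h\<close> by simp
      finally show ?thesis by (simp add: power2_eq_square)
    qed
    then show False using prod by simp
  qed
qed

text \<open>Here \<open>{1, j}\<close> meets all of \<open>B\<close>, so \<open>A\<close> contains
  all \<open>D\<close> sets through both points. The degree bounds at \<open>1\<close> and
  \<open>j\<close> and \<open>collapsing_sum_le\<close> each trade a part of \<open>A\<close>
  against \<open>card B\<close>, in the first two cases up to \<open>T\<close>; hence the weight
  \<open>3\<close> on \<open>card B\<close>.\<close>

lemma no_collapse_of_light:
  assumes mx: "maximal_pair A B" and lB: "\<not> heavy B" and j: "j \<in> {2..n}" and col: "collapsing j B"
  shows False
proof -
  have ad: "admissible A B" and prod: "h\<^sup>2 \<le> card A * card B"
    using mx by (auto simp: maximal_pair_def light_pair_def)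
  have xm: "maximal_pair B A" and ba: "admissible B A" using mx maximal_pair_commute ad admissible_commute by auto
  have j1: "1 \<noteq> j" "1 \<in> {1..n}" "j \<in> {1..n}" using j by auto
  have fin: "finite A" "finite B" using admissibleD[OF ad] by auto
  have cov: "1 \<in> U \<or> j \<in> U" if "U \<in> B" for U using col that by (auto simp: collapsing_def)
  let ?a = "card {U \<in> A. 1 \<notin> U \<and> j \<notin> U}"
  note cB = cells[OF fin(2) j1(1)] and cA = cells[OF fin(1) j1(1)]
  have a11: "card {U \<in> A. 1 \<in> U \<and> j \<in> U} = D" by (rule pair_cell_eq[OF mx j cov])
  have b00: "card {U \<in> B. 1 \<notin> U \<and> j \<notin> U} = 0" using cov by (metis (no_types, lifting) card.empty empty_Collect_eq)
  have dB: "card (link 1 B) \<le> T" "card (link j B) \<le> T" using light_degree[OF lB] j1 by auto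
  have 1: "card (link 1 A) + card (avoid 1 B) \<le> h"
    by (rule degree_sum_le_h[OF ad j1(2)]) (use cB(3,4) b00 dB in linarith)
  have 2: "card (link j A) + card (avoid j B) \<le> h"
    by (rule degree_sum_le_h[OF ad j1(3)]) (use cB(2,5) b00 dB in linarith)
  have b: "card B \<le> 2 * T" using cB(1,2,3) b00 dB by linarith
  have a00: "?a + card B \<le> h"
  proof (cases "?a = 0")
    case True then show ?thesis using b T_bounds(1) by simp
  next
    case False
    then have "{U \<in> A. 1 \<notin> U \<and> j \<notin> U} \<noteq> {}" by (metis card.empty)
    from collapsing_sum_le[OF ba maximal_pair_size[OF xm] col j this] show ?thesis by simp
  qed
  \<comment> \<open>Sum of the three bounds: each contributes one \<open>h\<close>, the two small
    degrees in \<open>B\<close> give back \<open>2 * T\<close>, and the sets of \<open>A\<close>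
    counted twice are subtracted.\<close>
  let ?M = "3 * h + 2 * T - D"
  have "card A + 3 * card B \<le> ?M"
    using cA(1,2,3) a11 1 2 cB(1,2,3,4,5) b00 dB a00 T_ge_D by linarith
  then have "4 * (card A * (3 * card B)) \<le> ?M\<^sup>2" by (rule four_mult_le)
  moreover have "(24 * ?M)\<^sup>2 \<le> (83 * h)\<^sup>2" by (rule power_mono[OF T_bounds(4)]) simp
  moreover have "0 < h\<^sup>2" using T_bounds(1) by simp
  ultimately show False using prod by (simp add: power_mult_distrib)
qed

text \<open>If the path of some member avoiding \<open>1\<close> stays below its start, all paths of
  \<open>G\<close> reach height \<open>3\<close> and \<open>G\<close> is too small. Otherwise all
  such paths return, so these members are at most as many as their shadow, which shiftedness places
  in the link of \<open>1\<close>.\<close>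

lemma pulled_avoid_le:
  assumes F: "F \<subseteq> nsets {1..n} k" and G: "G \<subseteq> nsets {1..n} k" and cr: "cross_intersecting F G"
    and sh: "shifted_on {1..n} F" and big: "D < card G"
  shows "card (avoid 1 F) \<le> card (link 1 F)"
proof (cases "\<exists>U\<in>avoid 1 F. \<forall>t\<ge>1. 2 * card (U \<inter> {1..t}) < t")
  case True
  then obtain U where U: "U \<in> F" "\<And>t. 1 \<le> t \<Longrightarrow> 2 * card (U \<inter> {1..t}) < t" by (auto simp: avoid_def)
  have "card G \<le> n choose (k - 3)"
    by (rule card_high_paths_le[OF G _ k3])
       (rule high_path_of_low_path[OF F sh nk U], use G cr in \<open>auto dest: cross_intersectingD\<close>)
  then show ?thesis using few_high_paths big by linarith
next
  case False
  then have high: "\<exists>t\<ge>1. t \<le> 2 * card (U \<inter> {1..t})" if "U \<in> avoid 1 F" for U using that by (meson not_le)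
  have sub: "avoid 1 F \<subseteq> nsets {1..n} k" using F by (auto simp: avoid_def)
  have "card (avoid 1 F) \<le> card (shadow (avoid 1 F))"
    by (rule card_le_shadow_of_high_paths[OF sub nk _ high]) (auto simp: avoid_def)
  also have "\<dots> \<le> card (link 1 F)"
  proof (rule card_mono)
    show "finite (link 1 F)" using finite_subset_nsets[OF link_nsets[OF F]] by blast
    show "shadow (avoid 1 F) \<subseteq> link 1 F"
    proof
      fix V assume "V \<in> shadow (avoid 1 F)"
      then obtain z where z: "z \<notin> V" "insert z V \<in> F" "1 \<notin> insert z V" by (auto simp: shadow_iff avoid_def)
      then have "insert z V \<subseteq> {1..n}" using F z(2) by (auto simp: nsets_def)
      then have "1 \<le> z" "z \<noteq> 1" using z(3) by auto
      then have "1 < z" by simp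
      have "insert 1 (insert z V - {z}) \<in> F"
        by (rule shifted_onD[OF sh z(2)]) (use z nk \<open>1 < z\<close> in auto)
      then show "V \<in> link 1 F" using z by (simp add: link_def)
    qed
  qed
  finally show ?thesis .
qed

text \<open>Shifts among the points other than \<open>1\<close> keep the sizes, the degrees of
  \<open>1\<close> and the stability towards \<open>1\<close>; with the latter, the outcome is
  shifted on all of \<open>{1..n}\<close>. So the bound for shifted families carries back.\<close>

lemma pulled_pair_avoid_le:
  assumes ad: "admissible A B" and pA: "pulled_to 1 A" and pB: "pulled_to 1 B" and big: "D < card A" "D < card B"
  shows "card (avoid 1 A) \<le> card (link 1 A)" "card (avoid 1 B) \<le> card (link 1 B)"
proof -
  define P where "P = (\<lambda>F G. F \<subseteq> nsets {1..n} k \<and> G \<subseteq> nsets {1..n} k \<and> cross_intersecting F G \<and>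
    card F = card A \<and> card G = card B \<and> card (link 1 F) = card (link 1 A) \<and> card (link 1 G) = card (link 1 B) \<and>
    pulled_to 1 F \<and> pulled_to 1 G)"
  have P1: "P A B" using ad pA pB admissibleD[OF ad] by (simp add: P_def)
  have P2: "F \<subseteq> Pow {1..n} \<and> G \<subseteq> Pow {1..n}" if "P F G" for F G using that by (auto simp: P_def nsets_def)
  have P3: "P (shift i j F) (shift i j G)" if PFG: "P F G" and ij: "i \<in> {2..n}" "j \<in> {1..n}" "i < j" for F G i j
  proof -
    have fin: "finite F" "finite G" using PFG finite_subset_nsets[of _ "{1..n}" k] by (auto simp: P_def)
    have i1: "i \<in> {1..n}" "i \<noteq> j" "1 \<noteq> i" "1 \<noteq> j" using ij by auto
    show ?thesis using PFG shift_nsets[OF _ i1(1) ij(2)] cross_intersecting_shift[OF _ i1(2)] i1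
        card_link_shift(1)[OF fin(1) i1(2-4)] card_link_shift(1)[OF fin(2) i1(2-4)]
        pulled_to_shift[of 1 F i j] pulled_to_shift[of 1 G i j]
      by (simp add: P_def card_shift)
  qed
  obtain F G where PFG: "P F G" and sh: "shifted_on {2..n} F" "shifted_on {2..n} G"
    using exists_shifted_pair[of P, OF P1 finite_atLeastAtMost P2 P3] by blast
  have FG: "F \<subseteq> nsets {1..n} k" "G \<subseteq> nsets {1..n} k" "cross_intersecting F G" "cross_intersecting G F"
    and pl: "pulled_to 1 F" "pulled_to 1 G" and c: "card F = card A" "card G = card B"
      "card (link 1 F) = card (link 1 A)" "card (link 1 G) = card (link 1 B)"
    using PFG by (auto simp: P_def cross_intersecting_commute)
  have full: "shifted_on {1..n} H" if "shifted_on {2..n} H" "pulled_to 1 H" for H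
    unfolding shifted_on_def
  proof (intro ballI impI)
    fix U i j assume u: "U \<in> H" "i \<in> {1..n}" "j \<in> U" "i < j" "i \<notin> U"
    show "insert i (U - {j}) \<in> H"
    proof (cases "i = 1")
      case True then show ?thesis using pulled_toD[OF that(2) u(1) _ u(3)] u by simp
    next
      case False then show ?thesis using shifted_onD[OF that(1) u(1) _ u(3-5)] u by simp
    qed
  qed
  have fin: "finite F" "finite G" "finite A" "finite B"
    using FG finite_subset_nsets[of _ "{1..n}" k] admissibleD[OF ad] by auto
  have "card (avoid 1 F) \<le> card (link 1 F)" "card (avoid 1 G) \<le> card (link 1 G)"
    using pulled_avoid_le[OF FG(1,2,3) full[OF sh(1) pl(1)]] pulled_avoid_le[OF FG(2,1,4) full[OF sh(2) pl(2)]] big c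
    by simp_all
  moreover have "card (avoid 1 F) = card (avoid 1 A)" "card (avoid 1 G) = card (avoid 1 B)"
    using card_link_avoid[OF fin(1), of 1] card_link_avoid[OF fin(2), of 1] card_link_avoid[OF fin(3), of 1]
      card_link_avoid[OF fin(4), of 1] c by linarith+
  ultimately show "card (avoid 1 A) \<le> card (link 1 A)" "card (avoid 1 B) \<le> card (link 1 B)" using c by simp_all
qed

lemma no_light_pair: "\<not> light_pair A B"
proof
  assume "light_pair A B"
  then obtain A1 B1 where m1: "maximal_pair A1 B1" by (rule exists_maximal_pair)
  then have "\<not> heavy A1 \<or> \<not> heavy B1" by (auto simp: maximal_pair_def light_pair_def)
  then obtain A B where mx: "maximal_pair A B" and lB: "\<not> heavy B" using m1 maximal_pair_commute by blast
  have xm: "maximal_pair B A" using mx maximal_pair_commute by simp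
  have ad: "admissible A B" and prod: "h\<^sup>2 \<le> card A * card B"
    using mx by (auto simp: maximal_pair_def light_pair_def)
  have nt: "nontrivial n A" "nontrivial n B" using ad by (auto simp: admissible_def nontrivial_cross_intersecting_def)
  have adj: "admissible (shift 1 j A) (shift 1 j B)" if j: "j \<in> {2..n}" for j
  proof -
    have "nontrivial n (shift 1 j A)" "nontrivial n (shift 1 j B)"
      using collapsing_of_star_shift[OF nt(1) _ j] collapsing_of_star_shift[OF nt(2) _ j]
        no_collapse_of_partner[OF mx lB j] no_collapse_of_light[OF mx lB j] by blast+
    then show ?thesis using shift_nsets[OF admissibleD(1)[OF ad], of 1 j] shift_nsets[OF admissibleD(2)[OF ad], of 1 j]
        cross_intersecting_shift[OF admissibleD(3)[OF ad], of 1 j] j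
      by (auto simp: admissible_def nontrivial_cross_intersecting_def)
  qed
  have pull: "pulled_to 1 F" if m: "maximal_pair F G" and a: "\<And>j. j \<in> {2..n} \<Longrightarrow> admissible (shift 1 j F) (shift 1 j G)" for F G
    unfolding pulled_to_def
  proof (intro ballI impI)
    fix U z assume U: "U \<in> F" "1 \<notin> U" "z \<in> U"
    have "F \<subseteq> nsets {1..n} k" using m admissibleD(1) by (auto simp: maximal_pair_def light_pair_def)
    then have "U \<subseteq> {1..n}" using U(1) by (auto simp: nsets_def)
    then have "z \<in> {1..n}" using U(3) by (rule subsetD)
    moreover have "z \<noteq> 1" using U by metis
    ultimately have "z \<in> {2..n}" by simp
    then show "insert 1 (U - {z}) \<in> F" using maximal_pair_shift[OF m _ a U(1,2,3)] by blast
  qed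
  have pA: "pulled_to 1 A" by (rule pull[OF mx adj])
  have pB: "pulled_to 1 B" by (rule pull[OF xm]) (use adj admissible_commute in blast)
  have one: "1 \<in> {1..n}" using nk by simp
  note av = pulled_pair_avoid_le[OF ad pA pB maximal_pair_size[OF mx] maximal_pair_size[OF xm]]
  let ?a = "card (link 1 A)" and ?y = "card (avoid 1 B)"
  have fin: "finite A" "finite B" using admissibleD[OF ad] by auto
  have b1: "card (link 1 B) \<le> T" by (rule light_degree[OF lB one])
  have y1: "1 \<le> ?y" using admissibleD(7)[OF ad one] finite_subset_nsets[OF avoid_nsets[OF admissibleD(2)[OF ad]]]
    by (simp add: Suc_le_eq card_gt_0_iff)
  have yT: "?y \<le> T" using av(2) b1 by simp
  have cA: "card A \<le> 2 * ?a" using card_link_avoid[OF fin(1), of 1] av(1) by simp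
  have cB: "card B \<le> T + ?y" using card_link_avoid[OF fin(2), of 1] b1 by simp
  have "card A * card B \<le> 2 * ?a * (T + ?y)" by (rule mult_le_mono[OF cA cB])
  then have *: "h\<^sup>2 \<le> 2 * (?a * (T + ?y))" using prod by (simp only: mult.assoc)
  have ah: "?a + ?y \<le> h" by (rule degree_sum_le_h[OF ad one yT])
  show False
  proof (cases "T < ?a")
    case False
    then have "?a * (T + ?y) \<le> T * (2 * T)" using yT by (intro mult_le_mono) auto
    moreover have "(2 * T)\<^sup>2 < h\<^sup>2" by (rule power_strict_mono) (use T_bounds(1) in auto)
    ultimately show False using * by (simp add: power2_eq_square)
  next
    case True
    \<comment> \<open>For \<open>T = D + 1\<close> the extra unit is regained from the strict bound
      \<open>cross_sum_less\<close>, which requires two members of \<open>B\<close> avoiding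
      \<open>1\<close>; a single one remains as a separate case.\<close>
    have mid: "?a + (T + ?y) \<le> h + D \<or> (?y = 1 \<and> T = D + 1)"
    proof (cases "k = 3")
      case True
      have "T = D" unfolding T_def by (rule if_P) (rule True)
      then show ?thesis using ah by linarith
    next
      case False
      then have T1: "T = D + 1" and k4: "4 \<le> k" using k3 unfolding T_def by (simp_all only: if_False)
      show ?thesis
      proof (cases "2 \<le> ?y")
        case True
        have "?a + ?y < h"
          by (rule cross_sum_less[OF admissible_local(1-5)[OF ad one] _ True k4]) (use \<open>T < ?a\<close> T1 in linarith)
        then show ?thesis using T1 by linarith
      next
        case False then show ?thesis using y1 T1 by linarith
      qed
    qed
    then show False
    proof
      assume "?a + (T + ?y) \<le> h + D"
      then have "4 * (?a * (T + ?y)) \<le> (h + D)\<^sup>2" by (rule four_mult_le)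
      then show False using * gap by linarith
    next
      assume y: "?y = 1 \<and> T = D + 1"
      have y1: "?y = 1" by (rule conjunct1[OF y])
      then have "2 * (T + ?y) = 2 * T + 2" by (simp only: add_mult_distrib2 mult_1_right)
      also have "\<dots> \<le> h" by (rule T_bounds(1))
      finally have "2 * (T + ?y) \<le> h" .
      then have "2 * (?a * (T + ?y)) \<le> ?a * h" by (simp add: mult.left_commute)
      also have "\<dots> < h * h" by (rule mult_strict_right_mono) (use ah y1 T_bounds(1) in linarith)+
      finally show False using * by (simp add: power2_eq_square)
    qed
  qed
qed

end

section \<open>Estimates of binomial coefficients\<close>

text \<open>The integer falling factorial, which evaluates by multiplication alone.\<close>

primrec falling :: "nat \<Rightarrow> int \<Rightarrow> int" where
  "falling 0 a = 1"
| "falling (Suc m) a = a * falling m (a - 1)"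

lemma falling_eq: "falling m (int a) = fact m * int (a choose m)"
proof (induction m arbitrary: a)
  case (Suc m)
  show ?case
  proof (cases a)
    case (Suc b)
    have "int (Suc b) - 1 = int b" by simp
    then have "falling (Suc m) (int a) = int (Suc b) * (fact m * int (b choose m))"
      using Suc.IH[of b] Suc by simp
    also have "\<dots> = fact m * int (Suc b * (b choose m))" by (simp add: algebra_simps)
    also have "\<dots> = fact m * int (Suc m * (Suc b choose Suc m))" by (simp only: Suc_times_binomial)
    finally show ?thesis using Suc by (simp add: algebra_simps)
  qed simp
qed simp

lemma binomial_ratio_power_le:
  fixes c :: real
  assumes "0 \<le> c" "c \<le> 1" "real a \<le> c * real b"
  shows "real (a choose m) \<le> c ^ m * real (b choose m)"
proof (induction m)
  case (Suc m)
  have step: "real (Suc m) * real (x choose Suc m) = real (x - m) * real (x choose m)" for x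
    using binomial_absorb_comp[of x m] binomial_absorption[of m x] by (metis of_nat_mult)
  have "real (a - m) \<le> c * real (b - m)"
  proof (cases "m \<le> a")
    case True
    have "c * real b \<le> 1 * real b" by (rule mult_right_mono) (use assms in auto)
    then have "m \<le> b" using True assms(3) by linarith
    moreover have "c * real m \<le> 1 * real m" by (rule mult_right_mono) (use assms in auto)
    ultimately show ?thesis using True assms(3) by (simp add: of_nat_diff algebra_simps)
  next
    case False then show ?thesis using assms(1) by simp
  qed
  then have "real (a - m) * real (a choose m) \<le> (c * real (b - m)) * (c ^ m * real (b choose m))"
    by (intro mult_mono Suc.IH) (use assms(1) in auto)
  then have "real (Suc m) * real (a choose Suc m) \<le> c ^ Suc m * (real (b - m) * real (b choose m))"
    unfolding step by (simp add: mult_ac)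
  then have "real (Suc m) * real (a choose Suc m) \<le> real (Suc m) * (c ^ Suc m * real (b choose Suc m))"
    unfolding step[symmetric] by (simp add: mult_ac)
  then show ?case by (rule mult_left_le_imp_le) simp
qed simp

text \<open>Raising both upper arguments by one multiplies the coefficient with the smaller one by
  the larger factor. This moves the worst case of a ratio of binomial coefficients to the largest
  \<open>n\<close>.\<close>

lemma binomial_ratio_mono:
  assumes "a \<le> b" "m \<le> a"
  shows "(a choose m) * (b + i choose m) \<le> (a + i choose m) * (b choose m)"
proof (induction i)
  case (Suc i)
  let ?a = "a + i" and ?b = "b + i"
  have step: "(Suc x - m) * (Suc x choose m) = Suc x * (x choose m)" for x
    using binomial_absorb_comp[of "Suc x" m] by simp
  have "Suc ?b * (Suc ?a - m) \<le> Suc ?a * (Suc ?b - m)"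
  proof -
    have "int (Suc ?a) * int m \<le> int (Suc ?b) * int m" by (rule mult_right_mono) (use assms in auto)
    then have "int (Suc ?b) * (int (Suc ?a) - int m) \<le> int (Suc ?a) * (int (Suc ?b) - int m)" by (simp add: algebra_simps)
    then have "int (Suc ?b * (Suc ?a - m)) \<le> int (Suc ?a * (Suc ?b - m))"
      using assms by (simp only: of_nat_mult of_nat_diff)
    then show ?thesis by (simp only: of_nat_le_iff)
  qed
  then have "(a choose m) * (?b choose m) * (Suc ?b * (Suc ?a - m)) \<le> (?a choose m) * (b choose m) * (Suc ?a * (Suc ?b - m))"
    by (rule mult_le_mono[OF Suc.IH])
  then have "(a choose m) * (Suc ?a - m) * (Suc ?b * (?b choose m)) \<le> (b choose m) * (Suc ?b - m) * (Suc ?a * (?a choose m))"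
    by (simp only: mult_ac)
  then have "(Suc ?a - m) * (Suc ?b - m) * ((a choose m) * (Suc ?b choose m))
      \<le> (Suc ?a - m) * (Suc ?b - m) * ((Suc ?a choose m) * (b choose m))"
    unfolding step[symmetric] by (simp only: mult_ac)
  moreover have "0 < (Suc ?a - m) * (Suc ?b - m)" using assms by simp
  ultimately show ?case by simp
qed simp

text \<open>\<open>12 / 29\<close> is the convergent of \<open>sqrt 2 - 1\<close> following
  \<open>5 / 12\<close>, slightly below the limit. The cofactor \<open>12 * H + 5 * d\<close> makes
  the product agree with \<open>144\<close> times \<open>H\<^sup>2 - 2 * H * d - d\<^sup>2\<close>
  except for one further \<open>- d\<^sup>2\<close>.\<close>

lemma gapI: "29 * d \<le> 12 * (H :: nat) \<Longrightarrow> 0 < d \<Longrightarrow> (H + d)\<^sup>2 < 2 * H\<^sup>2"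
proof -
  assume d: "29 * d \<le> 12 * H" "0 < d"
  have "0 \<le> int (12 * H - 29 * d) * int (12 * H + 5 * d)" by simp
  then have "0 \<le> (12 * int H - 29 * int d) * (12 * int H + 5 * int d)" using d by (simp add: of_nat_diff)
  moreover have "0 < int d * int d" using d by simp
  ultimately have "(int H + int d)\<^sup>2 < 2 * (int H)\<^sup>2" by (simp add: power2_eq_square algebra_simps)
  then have "int ((H + d)\<^sup>2) < int (2 * H\<^sup>2)" by simp
  then show ?thesis by (simp only: of_nat_less_iff)
qed

lemma binomial_pred_ratio:
  assumes "m \<le> x" "p * x \<le> q * (x - m)" "0 < x"
  shows "p * (x choose m) \<le> q * (x - 1 choose m)"
proof -
  have "x * (p * (x choose m)) \<le> q * (x - m) * (x choose m)"
    using assms(2) by (metis mult.assoc mult.commute mult_le_mono1)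
  also have "\<dots> = x * (q * (x - 1 choose m))" using binomial_absorb_comp[of x m] by (metis mult.assoc mult.left_commute)
  finally show ?thesis using assms(3) by simp
qed

text \<open>The quotient of the two sides is
  \<open>n (n - 1) (k - 2) / ((u + 1) (u + 2) (u + 3))\<close> with \<open>u = n - k\<close>. At
  \<open>n = 3 * k\<close> it tends to \<open>9 / 8\<close>, so lower-order terms must help: the
  estimate reduces to \<open>9 * (k - 2) \<le> 4 * (u + 6)\<close>, which
  \<open>u \<ge> 2 * k\<close> yields up to \<open>k = 42\<close>. From
  \<open>n = 16 * k / 5\<close> on, the leading part is at most \<open>1280 / 1331\<close>.\<close>

lemma binomial_minus3_le:
  assumes n: "3 * k \<le> n" and k: "4 \<le> k" and or: "k \<le> 42 \<or> 16 * k \<le> 5 * n"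
  shows "n choose (k - 3) \<le> n - 2 choose (k - 2)"
proof -
  define u where "u = n - k"
  define j where "j = k - 3"
  have j: "k = j + 3" using k by (simp add: j_def)
  have n': "n = u + j + 3" using n j by (simp add: u_def)
  have u: "2 * k \<le> u" using n by (simp add: u_def)
  let ?M = "n - 2 choose (k - 2)"
  have 1: "(u + 3) * (n choose j) = n * (n - 1 choose j)"
    using binomial_absorb_comp[of n j] by (simp add: n')
  have 2: "(u + 2) * (n - 1 choose j) = (n - 1) * (n - 2 choose j)"
    using binomial_absorb_comp[of "n - 1" j] by (simp add: n' numeral_2_eq_2)
  have 3: "(u + 1) * (n - 2 choose j) = (k - 2) * (n - 2 choose (k - 2))"
    using binomial_absorption[of j "n - 2"] binomial_absorb_comp[of "n - 2" j] by (simp add: n' j)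
  have "(u + 1) * (u + 2) * (u + 3) * (n choose j) = n * (n - 1) * (k - 2) * ?M"
  proof -
    have "(u + 1) * (u + 2) * (u + 3) * (n choose j) = (u + 1) * (u + 2) * (n * (n - 1 choose j))"
      by (simp only: 1[symmetric] mult_ac)
    also have "\<dots> = (u + 1) * n * ((n - 1) * (n - 2 choose j))" by (simp only: 2[symmetric] mult_ac)
    also have "\<dots> = n * (n - 1) * ((k - 2) * ?M)" by (simp only: 3[symmetric] mult_ac)
    finally show ?thesis by (simp only: mult_ac)
  qed
  also have "n * (n - 1) * (k - 2) \<le> (u + 1) * (u + 2) * (u + 3)"
    using or
  proof
    assume "k \<le> 42"
    have "2 * n \<le> 3 * u" using n by (simp add: u_def)
    then have "(2 * n) * (2 * n) * (k - 2) \<le> (3 * u) * (3 * u) * (k - 2)"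
      by (intro mult_le_mono[OF mult_le_mono le_refl])
    also have "\<dots> = u * u * (9 * (k - 2))" by simp
    also have "\<dots> \<le> u * u * (4 * (u + 6))"
      by (rule mult_le_mono[OF le_refl]) (use u k \<open>k \<le> 42\<close> in arith)
    finally have "4 * (n * n * (k - 2)) \<le> 4 * (u * u * (u + 6))" by (simp add: algebra_simps)
    then have "n * n * (k - 2) \<le> u * u * (u + 6)" by (rule mult_left_le_imp_le) simp
    moreover have "n * (n - 1) * (k - 2) \<le> n * n * (k - 2)" by (intro mult_le_mono) auto
    moreover have "u * u * (u + 6) \<le> (u + 1) * (u + 2) * (u + 3)" by (simp add: algebra_simps)
    ultimately show ?thesis by linarith
  next
    assume a: "16 * k \<le> 5 * n"
    have e: "11 * n \<le> 16 * u" "11 * (k - 2) \<le> 5 * u" using a by (simp_all add: u_def)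
    have "(11 * n) * (11 * (n - 1)) * (11 * (k - 2)) \<le> (16 * u) * (16 * u) * (5 * u)"
      by (rule mult_le_mono[OF mult_le_mono]) (use e in linarith)+
    then have "1331 * (n * (n - 1) * (k - 2)) \<le> 1280 * (u * u * u)" by (simp add: mult_ac)
    also have "\<dots> \<le> 1331 * ((u + 1) * (u + 2) * (u + 3))" by (simp add: algebra_simps)
    finally show ?thesis by simp
  qed
  finally have "(u + 1) * (u + 2) * (u + 3) * (n choose j) \<le> (u + 1) * (u + 2) * (u + 3) * ?M" by simp
  then show ?thesis using j by simp
qed

section \<open>The two regimes of \<open>n\<close>\<close>

context uniform_params begin

lemma hm_bound_terms:
  assumes "4 \<le> k"
  shows "1 + (\<Sum>l<4. n - 2 - l choose (k - 2)) \<le> h" "5 \<le> k \<Longrightarrow> 1 + (\<Sum>l<5. n - 2 - l choose (k - 2)) \<le> h"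
  proof -
  have "(\<Sum>l<m. n - 2 - l choose (k - 2)) \<le> (\<Sum>l<k. n - 2 - l choose (k - 2))" if "m \<le> k" for m
    by (rule sum_mono2) (use that in auto)
  then show "1 + (\<Sum>l<4. n - 2 - l choose (k - 2)) \<le> h" "5 \<le> k \<Longrightarrow> 1 + (\<Sum>l<5. n - 2 - l choose (k - 2)) \<le> h"
    unfolding hm_bound_sum using assms by simp_all
qed

text \<open>For \<open>n \<ge> 3 * k\<close> each of the first terms of the sum for \<open>h\<close>
  is at least \<open>2 / 3\<close> of the preceding one, so five terms give \<open>211 / 81\<close>
  times \<open>D\<close>, more than \<open>29 / 12\<close>. Four terms at this rate give
  \<open>65 / 27\<close>, just too little, so \<open>k = 4\<close> uses the better first ratio
  \<open>3 / 4\<close>.\<close>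

lemma gap_of_3_le:
  assumes n: "3 * k \<le> n" and k: "4 \<le> k"
  shows "(h + D)\<^sup>2 < 2 * h\<^sup>2"
proof (rule gapI)
  define t where "t l = (n - 2 - l choose (k - 2))" for l
  have r: "p * t l \<le> q * t (Suc l)" if "p * (n - 2 - l) \<le> q * (n - k - l)" "l < 4" for p q l
  proof -
    have "n - 2 - l - (k - 2) = n - k - l" "n - 2 - l - 1 = n - 2 - Suc l" using n k by auto
    then show ?thesis
      using binomial_pred_ratio[of "k - 2" "n - 2 - l" p q] that n k by (simp add: t_def)
  qed
  have r0: "2 * t l \<le> 3 * t (Suc l)" if "l < 4" for l by (rule r) (use n k that in auto)
  have t0: "t 0 = D" by (simp add: t_def)
  show "29 * D \<le> 12 * h"
  proof (cases "k = 4")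
    case True
    have "3 * t 0 \<le> 4 * t (Suc 0)" by (rule r) (use n True in auto)
    moreover have "1 + (t 0 + t 1 + t 2 + t 3) \<le> h"
      using hm_bound_terms(1)[OF k] by (simp add: t_def numeral_eq_Suc)
    ultimately show ?thesis using r0[of 1] r0[of 2] unfolding t0[symmetric] by (simp add: numeral_eq_Suc)
  next
    case False
    then have "1 + (t 0 + t 1 + t 2 + t 3 + t 4) \<le> h"
      using hm_bound_terms(2) k by (simp add: t_def numeral_eq_Suc)
    then show ?thesis using r0[of 0] r0[of 1] r0[of 2] r0[of 3] unfolding t0[symmetric] by (simp add: numeral_eq_Suc)
  qed
  show "0 < D" using nk by simp
qed

text \<open>With \<open>\<beta> = n * (D + 1) / k\<close>, the largest size of a family with all degrees at most \<open>D + 1\<close>, this is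
  \<open>\<beta> < h\<close> and \<open>(h - \<beta>)\<^sup>2 > \<beta> * (N - h)\<close>.\<close>

definition narrow :: bool where
  "narrow \<longleftrightarrow> n * (D + 1) < k * h \<and> k * (n * (D + 1)) * (N - h) < (k * h - n * (D + 1))\<^sup>2"

lemma D_N: "(n - 1) * D = (k - 1) * N"
  using times_binomial_minus1_eq[of "k - 1" "n - 1"] nk k3 by (simp add: numeral_2_eq_2)

lemma N_sub_h: "N - h + 1 = (n - k - 1 choose (k - 1))" "h \<le> N"
proof -
  have "0 < (n - k - 1 choose (k - 1))" using nk by simp
  then show "N - h + 1 = (n - k - 1 choose (k - 1))" "h \<le> N" using hm_bound_add[of k n] nk k3 by linarith+
qed

text \<open>\<open>n * D \<le> (k - 1 / 2) * N\<close> and \<open>n \<le> N / 20\<close> leave at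
  least \<open>9 / 20\<close> of \<open>N\<close> between \<open>n * (D + 1)\<close> and
  \<open>k * N\<close>. The condition on \<open>r\<close> fits two amounts into this gap: the loss
  \<open>k * r\<^sup>2 * N\<close> from replacing \<open>N\<close> by \<open>h\<close>, and
  \<open>k * r * N\<close>, whose square bounds the left-hand side of \<open>narrow\<close>.\<close>

lemma narrow_of_ratio:
  fixes r :: real
  assumes r: "0 \<le> r" "real (n - k - 1 choose (k - 1)) \<le> r\<^sup>2 * real N"
    and s: "20 * real k * (r + r\<^sup>2) \<le> 9" and N: "20 * n \<le> N"
  shows narrow
proof -
  let ?N = "real N" and ?D = "real D" and ?h = "real h" and ?Q = "real (n - k - 1 choose (k - 1))"
  let ?t = "real n * (?D + 1)"
  have n: "real (n - 1) = real n - 1" "real (k - 1) = real k - 1" using nk k3 by auto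
  have DN: "(real n - 1) * ?D = (real k - 1) * ?N" using D_N by (metis of_nat_mult n)
  have nk': "2 * real k < real n" "3 \<le> real k" using nk k3 by linarith+
  have "real n * (real k - 1) \<le> (real k - 1 / 2) * (real n - 1)" using nk' by (simp add: field_simps)
  then have "real n * (real k - 1) * ?N \<le> (real k - 1 / 2) * (real n - 1) * ?N" by (rule mult_right_mono) simp
  then have "(real n - 1) * (real n * ?D) \<le> (real n - 1) * ((real k - 1 / 2) * ?N)"
    using DN by (simp add: mult_ac)
  then have nD: "real n * ?D \<le> (real k - 1 / 2) * ?N" by (rule mult_left_le_imp_le) (use nk' in simp)
  have "20 * real n \<le> ?N" using N by linarith
  moreover have "20 * real k * (r + r\<^sup>2) * ?N \<le> 9 * ?N" by (rule mult_right_mono[OF s]) simp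
  ultimately have t: "?t + real k * (r + r\<^sup>2) * ?N \<le> real k * ?N" using nD by (simp add: algebra_simps)
  have hQ: "?h = ?N + 1 - ?Q" using hm_bound_add[of k n] nk k3 by linarith
  have "real k * ?Q \<le> real k * (r\<^sup>2 * ?N)" by (rule mult_left_mono[OF r(2)]) simp
  moreover have "real k * ?h = real k * ?N + real k - real k * ?Q" unfolding hQ by (simp add: algebra_simps)
  moreover have "?t + (real k * r * ?N + real k * (r\<^sup>2 * ?N)) \<le> real k * ?N" using t by (simp add: algebra_simps)
  ultimately have gt: "real k * r * ?N < real k * ?h - ?t" using nk' by linarith
  moreover have "0 \<le> real k * r * ?N" using r by simp
  ultimately have lt: "?t < real k * ?h" by linarith
  have "(real k * r * ?N)\<^sup>2 < (real k * ?h - ?t)\<^sup>2" by (rule power_strict_mono[OF gt]) (use r in auto)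
  moreover have "real k * ?t * (?N - ?h) \<le> real k * (real k * ?N) * (r\<^sup>2 * ?N)"
  proof (rule mult_mono[OF mult_left_mono])
    have "0 \<le> real k * (r + r\<^sup>2) * ?N" using r by simp
    then show "?t \<le> real k * ?N" using t by linarith
    show "?N - ?h \<le> r\<^sup>2 * ?N" using hQ r(2) by linarith
    show "0 \<le> ?N - ?h" using N_sub_h(2) by simp
  qed simp_all
  moreover have "real k * (real k * ?N) * (r\<^sup>2 * ?N) = (real k * r * ?N)\<^sup>2" by (simp add: power2_eq_square)
  ultimately have main: "real k * ?t * (?N - ?h) < (real k * ?h - ?t)\<^sup>2" by linarith
  have "real (n * (D + 1)) < real (k * h)" using lt by (simp only: of_nat_mult of_nat_add of_nat_1)
  then have lt': "n * (D + 1) < k * h" by (simp only: of_nat_less_iff)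
  have "real (k * h - n * (D + 1)) = real k * ?h - ?t" using lt' by (simp add: of_nat_diff algebra_simps)
  moreover have "real (N - h) = ?N - ?h" using N_sub_h(2) by (simp add: of_nat_diff)
  ultimately have "real (k * (n * (D + 1)) * (N - h)) < real ((k * h - n * (D + 1))\<^sup>2)"
    using main by (simp only: of_nat_mult of_nat_power of_nat_add of_nat_1)
  then show ?thesis using lt' by (simp only: narrow_def of_nat_less_iff)
qed

lemma N_ge:
  assumes "14 \<le> k"
  shows "20 * n \<le> N"
proof -
  define m where "m = n - 29"
  have m: "n = m + 29" using nk assms by (simp add: m_def)
  have "3 * (n - 1 choose 3) = (n - 1) * (n - 2 choose 2)" "2 * (n - 2 choose 2) = (n - 2) * (n - 3)"
    using binomial_absorption[of 2 "n - 1"] binomial_absorption[of 1 "n - 2"] by (simp_all add: numeral_eq_Suc)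
  then have "6 * (n - 1 choose 3) = (n - 1) * ((n - 2) * (n - 3))"
    by (metis mult.assoc mult.left_commute mult_2 numeral_Bit0 distrib_right)
  also have "\<dots> \<ge> 120 * n" unfolding m by (simp add: algebra_simps)
  finally have "20 * n \<le> n - 1 choose 3" by simp
  also have "\<dots> \<le> N" by (rule binomial_mono) (use nk assms in auto)
  finally show ?thesis .
qed

end

text \<open>The disjunction of \<open>narrow\<close> and the assumptions of \<open>sparse_params\<close>, with all binomial coefficients
  multiplied by \<open>F = fact (k - 1)\<close> to avoid divisions in the evaluation.\<close>

definition small_case :: "nat \<Rightarrow> nat \<Rightarrow> bool" where
  "small_case k n \<longleftrightarrow>
    (let F = falling (k - 1) (int (k - 1)); a = falling (k - 1) (int (n - 1));
         d = int (k - 1) * falling (k - 2) (int (n - 2)); H = a - falling (k - 1) (int (n - k - 1)) + F;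
         t = int n * (d + F); e = int k * H - t
     in (0 < e \<and> int k * t * (a - H) < e * e)
      \<or> ((H + d) * (H + d) < 2 * (H * H) \<and> int (k - 2) * falling (k - 3) (int n) \<le> falling (k - 2) (int (n - 2))))"

lemma small_cases: "4 \<le> k \<Longrightarrow> k < 14 \<Longrightarrow> 2 * k < n \<Longrightarrow> n < 3 * k \<Longrightarrow> small_case k n"
proof -
  have "list_all (\<lambda>k. list_all (small_case k) [2 * k + 1..<3 * k]) [4..<14]" by code_simp
  then show "4 \<le> k \<Longrightarrow> k < 14 \<Longrightarrow> 2 * k < n \<Longrightarrow> n < 3 * k \<Longrightarrow> small_case k n"
    unfolding list_all_iff set_upt by (metis Suc_eq_plus1 Suc_leI atLeastLessThan_iff)
qed

text \<open>A decay rate \<open>c \<le> a / (a + 1)\<close> outweighs the growth of \<open>k\<close>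
  at every step, so the condition of \<open>narrow_of_ratio\<close> has to be checked at
  \<open>k = a\<close> alone.\<close>

lemma geometric_weight_le:
  fixes A c :: real
  assumes A: "0 \<le> A" "20 * real a * (A + A\<^sup>2) \<le> 9" and c: "0 \<le> c" "c * (real a + 1) \<le> real a" and "a \<le> k"
  shows "20 * real k * (A * c ^ (k - a) + (A * c ^ (k - a))\<^sup>2) \<le> 9"
  using \<open>a \<le> k\<close>
proof (induction k rule: dec_induct)
  case base then show ?case using A by simp
next
  case (step k)
  let ?r = "A * c ^ (k - a)"
  have r: "0 \<le> ?r" using A c by simp
  have "c * (real a + 1) \<le> 1 * (real a + 1)" by (rule order_trans[OF c(2)]) simp
  then have c1: "c \<le> 1" by (rule mult_right_le_imp_le) simp
  have "c * (real k - real a) \<le> 1 * (real k - real a)" by (rule mult_right_mono[OF c1]) (use step in simp)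
  then have ck: "c * (real k + 1) \<le> real k" using c(2) by (simp add: algebra_simps)
  have e: "A * c ^ (Suc k - a) = c * ?r" using step by (simp add: Suc_diff_le)
  have "c * (c * ?r\<^sup>2) \<le> 1 * (c * ?r\<^sup>2)" by (rule mult_right_mono[OF c1]) (use c in simp)
  then have "(c * ?r)\<^sup>2 \<le> c * ?r\<^sup>2" by (simp add: power2_eq_square mult_ac)
  then have "20 * real (Suc k) * (c * ?r + (c * ?r)\<^sup>2) \<le> 20 * real (Suc k) * (c * (?r + ?r\<^sup>2))"
    by (intro mult_left_mono) (simp_all add: algebra_simps)
  also have "\<dots> = 20 * (?r + ?r\<^sup>2) * (c * (real k + 1))" by (simp add: algebra_simps)
  also have "\<dots> \<le> 20 * (?r + ?r\<^sup>2) * real k" by (rule mult_left_mono[OF ck]) (use r in simp)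
  also have "\<dots> = 20 * real k * (?r + ?r\<^sup>2)" by simp
  also have "\<dots> \<le> 9" by (rule step.IH)
  finally show ?case unfolding e .
qed

text \<open>The growth factors of the two binomial coefficients tend to \<open>4\<close> and
  \<open>27 / 4\<close>, with quotient \<open>48 / 81\<close>; the square \<open>49 / 81\<close> of
  \<open>7 / 9\<close> lies just above. The constant \<open>3 / 100\<close> is the square root of
  the starting bound \<open>9 / 10000\<close> at \<open>j = 13\<close>.\<close>

lemma third_ratio_le:
  assumes "13 \<le> j"
  shows "real (2 * j choose j) \<le> (3 / 100 * (7 / 9) ^ (j - 13))\<^sup>2 * real (3 * j + 1 choose j)"
  using assms
proof (induction j rule: dec_induct)
  case base
  have "10000 * falling 13 26 \<le> 9 * falling 13 40" by code_simp
  then have "fact 13 * (10000 * int (26 choose 13)) \<le> (fact 13 :: int) * (9 * int (40 choose 13))"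
    using falling_eq[of 13 26] falling_eq[of 13 40] by (simp only: of_nat_numeral mult_ac)
  then have "10000 * int (26 choose 13) \<le> 9 * int (40 choose 13)"
    by (rule mult_left_le_imp_le) (simp only: fact_gt_zero)
  then have "10000 * (26 choose 13) \<le> 9 * (40 choose 13)" by linarith
  then have "10000 * real (26 choose 13) \<le> 9 * real (40 choose 13)" by linarith
  moreover have "2 * 13 = (26 :: nat)" "3 * 13 + 1 = (40 :: nat)" by simp_all
  ultimately show ?case by (simp only: power2_eq_square) simp
next
  case (step j)
  let ?r = "3 / 100 * (7 / 9 :: real) ^ (j - 13)"
  let ?p = "2 * j choose j" and ?q = "3 * j + 1 choose j"
  let ?p' = "2 * Suc j choose Suc j" and ?q' = "3 * Suc j + 1 choose Suc j"
  have p: "(j + 1) * ?p' = 2 * (2 * j + 1) * ?p"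
  proof -
    have "Suc j * ?p' = 2 * Suc j * (2 * j + 1 choose j)" using binomial_absorption[of j "2 * Suc j"] by simp
    moreover have "Suc j * (2 * j + 1 choose j) = (2 * j + 1) * ?p"
      using binomial_absorb_comp[of "2 * j + 1" j] by simp
    ultimately show ?thesis by (simp add: algebra_simps)
  qed
  have pred: "3 * (j + 1) + 1 = 3 * j + 4" "3 * j + 4 - 1 = 3 * j + 3" "3 * j + 3 - 1 = 3 * j + 2" "3 * j + 2 - 1 = 3 * j + 1"
    "Suc j = j + 1" "3 * j + 3 - j = 2 * j + 3" "3 * j + 2 - j = 2 * j + 2" by simp_all
  have q: "(j + 1) * ((2 * j + 3) * (2 * j + 2)) * ?q' = (3 * j + 4) * ((3 * j + 3) * (3 * j + 2)) * ?q"
  proof -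
    have 1: "(j + 1) * ?q' = (3 * j + 4) * (3 * j + 3 choose j)" using binomial_absorption[of j "3 * j + 4"] by (simp only: pred)
    have 2: "(2 * j + 3) * (3 * j + 3 choose j) = (3 * j + 3) * (3 * j + 2 choose j)"
      using binomial_absorb_comp[of "3 * j + 3" j] by (simp only: pred)
    have 3: "(2 * j + 2) * (3 * j + 2 choose j) = (3 * j + 2) * ?q"
      using binomial_absorb_comp[of "3 * j + 2" j] by (simp only: pred)
    have "(j + 1) * ((2 * j + 3) * (2 * j + 2)) * ?q' = (2 * j + 2) * ((2 * j + 3) * ((j + 1) * ?q'))" by (simp only: mult_ac)
    also have "\<dots> = (3 * j + 4) * ((2 * j + 2) * ((2 * j + 3) * (3 * j + 3 choose j)))" unfolding 1 by (simp only: mult_ac)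
    also have "\<dots> = (3 * j + 4) * ((3 * j + 3) * ((2 * j + 2) * (3 * j + 2 choose j)))" unfolding 2 by (simp only: mult_ac)
    also have "\<dots> = (3 * j + 4) * ((3 * j + 3) * ((3 * j + 2) * ?q))" unfolding 3 by (simp only: mult_ac)
    finally show ?thesis by (simp only: mult_ac)
  qed
  let ?J = "real j"
  have p': "real ?p' = 2 * (2 * ?J + 1) / (?J + 1) * real ?p"
  proof -
    have "real ((j + 1) * ?p') = real (2 * (2 * j + 1) * ?p)" by (simp only: p)
    then show ?thesis by (simp add: field_simps)
  qed
  have q': "real ?q' = 3 * (3 * ?J + 4) * (3 * ?J + 2) / (2 * (2 * ?J + 3) * (?J + 1)) * real ?q"
  proof -
    have "real ((j + 1) * ((2 * j + 3) * (2 * j + 2)) * ?q') = real ((3 * j + 4) * ((3 * j + 3) * (3 * j + 2)) * ?q)"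
      by (simp only: q)
    then have "(?J + 1) * ((?J + 1) * (2 * (2 * ?J + 3)) * real ?q') = (?J + 1) * (3 * (3 * ?J + 4) * (3 * ?J + 2) * real ?q)"
      by (simp add: algebra_simps)
    moreover have "?J + 1 \<noteq> 0" by simp
    ultimately have "(?J + 1) * (2 * (2 * ?J + 3)) * real ?q' = 3 * (3 * ?J + 4) * (3 * ?J + 2) * real ?q"
      by (metis mult_cancel_left)
    then have "2 * (2 * ?J + 3) * (?J + 1) * real ?q' = 3 * (3 * ?J + 4) * (3 * ?J + 2) * real ?q"
      by (simp only: mult_ac)
    moreover have "2 * (2 * ?J + 3) * (?J + 1) \<noteq> 0" by simp
    ultimately have "real ?q' = 3 * (3 * ?J + 4) * (3 * ?J + 2) * real ?q / (2 * (2 * ?J + 3) * (?J + 1))"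
      by (metis nonzero_mult_div_cancel_left)
    then show ?thesis by (simp only: times_divide_eq_left)
  qed
  have c: "2 * (2 * ?J + 1) / (?J + 1) \<le> (7 / 9)\<^sup>2 * (3 * (3 * ?J + 4) * (3 * ?J + 2) / (2 * (2 * ?J + 3) * (?J + 1)))"
  proof -
    have "2 * (2 * ?J + 1) * (2 * (2 * ?J + 3)) \<le> 49 / 81 * (3 * (3 * ?J + 4) * (3 * ?J + 2))"
      by (simp add: field_simps)
    then have "2 * (2 * ?J + 1) \<le> 49 / 81 * (3 * (3 * ?J + 4) * (3 * ?J + 2)) / (2 * (2 * ?J + 3))"
      by (rule pos_le_divide_eq[THEN iffD2, rotated]) simp
    then have "2 * (2 * ?J + 1) / (?J + 1) \<le> 49 / 81 * (3 * (3 * ?J + 4) * (3 * ?J + 2)) / (2 * (2 * ?J + 3)) / (?J + 1)"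
      by (rule divide_right_mono) simp
    moreover have "(7 / 9)\<^sup>2 = (49 / 81 :: real)" by (simp add: power2_eq_square)
    ultimately show ?thesis by (simp only: divide_divide_eq_left times_divide_eq_right)
  qed
  have "real ?p' \<le> 2 * (2 * ?J + 1) / (?J + 1) * (?r\<^sup>2 * real ?q)"
    unfolding p' by (rule mult_left_mono[OF step.IH]) simp
  also have "\<dots> \<le> (7 / 9)\<^sup>2 * (3 * (3 * ?J + 4) * (3 * ?J + 2) / (2 * (2 * ?J + 3) * (?J + 1))) * (?r\<^sup>2 * real ?q)"
    by (rule mult_right_mono[OF c]) simp
  also have "\<dots> = (7 / 9 * ?r)\<^sup>2 * real ?q'" unfolding q' power_mult_distrib by (simp only: mult_ac)
  also have "7 / 9 * ?r = 3 / 100 * (7 / 9) ^ (Suc j - 13)"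
    unfolding Suc_diff_le[OF step.hyps(1)] power_Suc by (rule mult.left_commute)
  finally show ?case .
qed

context uniform_params begin

text \<open>By \<open>binomial_ratio_mono\<close> the worst case is \<open>n = 3 * k - 1\<close>,
  where the ratio is the one of \<open>third_ratio_le\<close> with \<open>j = k - 1\<close>.\<close>

lemma narrow_of_third:
  assumes k: "14 \<le> k" and n: "n < 3 * k"
  shows narrow
proof (rule narrow_of_ratio)
  let ?r = "3 / 100 * (7 / 9 :: real) ^ (k - 14)"
  show "0 \<le> ?r" by simp
  show "20 * real k * (?r + ?r\<^sup>2) \<le> 9"
    by (rule geometric_weight_le[OF _ _ _ _ k]) (simp_all add: power2_eq_square)
  show "20 * n \<le> N" by (rule N_ge[OF k])
  define j where "j = k - 1"
  have j: "k = j + 1" "13 \<le> j" "j - 13 = k - 14" using k by (simp_all add: j_def)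
  let ?Q = "n - k - 1 choose j"
  have "?Q * (n - 1 + (3 * k - 1 - n) choose j) \<le> (n - k - 1 + (3 * k - 1 - n) choose j) * (n - 1 choose j)"
    by (rule binomial_ratio_mono) (use j nk in auto)
  moreover have "n - 1 + (3 * k - 1 - n) = 3 * j + 1" "n - k - 1 + (3 * k - 1 - n) = 2 * j" using j nk n by auto
  ultimately have "?Q * (3 * j + 1 choose j) \<le> (2 * j choose j) * (n - 1 choose j)" by (simp only:)
  then have "real (?Q * (3 * j + 1 choose j)) \<le> real ((2 * j choose j) * (n - 1 choose j))" by (simp only: of_nat_le_iff)
  then have "real ?Q * real (3 * j + 1 choose j) \<le> real (2 * j choose j) * real (n - 1 choose j)" by simp
  also have "\<dots> \<le> (?r\<^sup>2 * real (3 * j + 1 choose j)) * real (n - 1 choose j)"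
    by (rule mult_right_mono) (use third_ratio_le[OF j(2)] j(3) in simp_all)
  finally have "real ?Q * real (3 * j + 1 choose j) \<le> (?r\<^sup>2 * real (n - 1 choose j)) * real (3 * j + 1 choose j)"
    by (simp only: mult_ac)
  moreover have "0 < real (3 * j + 1 choose j)" by simp
  ultimately have "real ?Q \<le> ?r\<^sup>2 * real (n - 1 choose j)" by (rule mult_right_le_imp_le)
  then show "real (n - k - 1 choose (k - 1)) \<le> ?r\<^sup>2 * real N" by (simp only: j_def)
qed

text \<open>Each factor of the ratio is at most \<open>(n - k) / n \<le> 11 / 16\<close>, and
  \<open>25 / 36\<close> is a square slightly above, so \<open>r\<close> becomes a power of
  \<open>5 / 6\<close>.\<close>

lemma narrow_of_large:
  assumes k: "43 \<le> k" and n: "5 * n \<le> 16 * k"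
  shows narrow
proof (rule narrow_of_ratio)
  let ?r = "(5 / 6) ^ 42 * (5 / 6 :: real) ^ (k - 43)"
  show "0 \<le> ?r" by simp
  have "(5 / 6 :: real) ^ 42 \<le> 1 / 1000" by (simp add: power_divide)
  then have "20 * real 43 * ((5 / 6) ^ 42 + ((5 / 6 :: real) ^ 42)\<^sup>2) \<le> 20 * 43 * (1 / 1000 + (1 / 1000)\<^sup>2)"
    unfolding of_nat_numeral by (intro mult_left_mono add_mono power_mono) auto
  also have "\<dots> \<le> 9" by (simp add: power2_eq_square)
  finally show "20 * real k * (?r + ?r\<^sup>2) \<le> 9"
    by (intro geometric_weight_le[OF _ _ _ _ k]) simp_all
  show "20 * n \<le> N" by (rule N_ge) (use k in simp)
  have "k - 1 = 42 + (k - 43)" using k by simp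
  then have r: "?r = (5 / 6) ^ (k - 1)" by (simp only: power_add)
  have "real (n - k - 1 choose (k - 1)) \<le> (25 / 36) ^ (k - 1) * real N"
    by (rule binomial_ratio_power_le) (use n nk in simp_all)
  also have "(25 / 36 :: real) ^ (k - 1) = ?r\<^sup>2" unfolding r
    by (simp add: power2_eq_square flip: power_mult_distrib)
  finally show "real (n - k - 1 choose (k - 1)) \<le> ?r\<^sup>2 * real N" .
qed

lemma narrow_or_sparse_of_small_case:
  assumes k: "4 \<le> k" and sc: "small_case k n"
  shows "narrow \<or> ((h + D)\<^sup>2 < 2 * h\<^sup>2 \<and> n choose (k - 3) \<le> D)"
proof -
  let ?F = "fact (k - 1) :: int"
  have F: "0 < ?F" by simp
  have k1: "k - 1 = Suc (k - 2)" "k - 2 = Suc (k - 3)" using k by simp_all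
  have fF: "?F = int (k - 1) * fact (k - 2)" "(fact (k - 2) :: int) = int (k - 2) * fact (k - 3)"
    using fact_Suc[of "k - 2", where 'a = int] fact_Suc[of "k - 3", where 'a = int] unfolding k1[symmetric] by simp_all
  define e where "e = int k * int h - int n * (int D + 1)"
  have a: "falling (k - 1) (int (n - 1)) = ?F * int N" by (rule falling_eq)
  have d: "int (k - 1) * falling (k - 2) (int (n - 2)) = ?F * int D" unfolding falling_eq fF by (simp only: mult_ac)
  have H: "?F * int N - falling (k - 1) (int (n - k - 1)) + ?F = ?F * int h"
  proof -
    have "int h = int N - int (n - k - 1 choose (k - 1)) + 1" using hm_bound_add[of k n] nk k3 by linarith
    then have "?F * int h = ?F * (int N - int (n - k - 1 choose (k - 1)) + 1)" by (rule arg_cong)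
    also have "\<dots> = ?F * int N - ?F * int (n - k - 1 choose (k - 1)) + ?F" by (simp only: distrib_left right_diff_distrib mult_1_right)
    finally show ?thesis unfolding falling_eq by (rule sym)
  qed
  have f: "falling (k - 1) (int (k - 1)) = ?F" unfolding falling_eq by simp
  have t: "int n * (?F * int D + ?F) = ?F * (int n * (int D + 1))" by (simp only: algebra_simps)
  have e: "int k * (?F * int h) - ?F * (int n * (int D + 1)) = ?F * e" unfolding e_def by (simp only: algebra_simps)
  have FF: "0 < ?F * ?F" by simp
  from sc consider "0 < ?F * e" "int k * (?F * (int n * (int D + 1))) * (?F * int N - ?F * int h) < ?F * e * (?F * e)"
    | "(?F * int h + ?F * int D) * (?F * int h + ?F * int D) < 2 * (?F * int h * (?F * int h))"
      "int (k - 2) * falling (k - 3) (int n) \<le> falling (k - 2) (int (n - 2))"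
    unfolding small_case_def Let_def f a d H t e by blast
  then show ?thesis
  proof cases
    case 1
    have "0 < e" using 1(1) F by (simp only: zero_less_mult_pos)
    then have lt: "n * (D + 1) < k * h"
      unfolding e_def by (simp only: of_nat_less_iff[symmetric, where 'a = int] of_nat_mult of_nat_add of_nat_1)
    have "int (k * h - n * (D + 1)) = e" using lt by (simp add: e_def of_nat_diff algebra_simps)
    moreover have "int (N - h) = int N - int h" using N_sub_h(2) by (simp add: of_nat_diff)
    moreover have "?F * ?F * (int k * (int n * (int D + 1)) * (int N - int h)) < ?F * ?F * (e * e)"
      using 1(2) by (simp only: right_diff_distrib[symmetric] mult_ac)
    then have "int k * (int n * (int D + 1)) * (int N - int h) < e * e"
      using FF by (simp only: mult_less_cancel_left_pos)
    ultimately have "int (k * (n * (D + 1)) * (N - h)) < int ((k * h - n * (D + 1))\<^sup>2)"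
      by (simp only: power2_eq_square of_nat_mult of_nat_add of_nat_1)
    then have narrow using lt by (simp only: narrow_def of_nat_less_iff)
    then show ?thesis by (rule disjI1)
  next
    case 2
    have "?F * ?F * ((int h + int D) * (int h + int D)) < ?F * ?F * (2 * (int h * int h))"
      using 2(1) by (simp only: distrib_left[symmetric] mult_ac)
    then have "(int h + int D) * (int h + int D) < 2 * (int h * int h)" using FF by (simp only: mult_less_cancel_left_pos)
    then have "int ((h + D)\<^sup>2) < int (2 * h\<^sup>2)" by (simp only: power2_eq_square of_nat_mult of_nat_add of_nat_numeral)
    moreover have "fact (k - 2) * int (n choose (k - 3)) \<le> fact (k - 2) * int D"
      using 2(2) unfolding falling_eq fF(2) by (simp only: mult_ac)
    then have "int (n choose (k - 3)) \<le> int D" by (rule mult_left_le_imp_le) simp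
    ultimately show ?thesis by (intro disjI2 conjI) (simp_all only: of_nat_less_iff of_nat_le_iff)
  qed
qed

text \<open>Below \<open>3 * k\<close> the cases \<open>k < 14\<close> are evaluated and the others
  are narrow. From \<open>3 * k\<close> on the gap always holds, and the path condition is in doubt
  only for \<open>k \<ge> 43\<close> and \<open>n\<close> below \<open>16 * k / 5\<close>, where the
  parameters are narrow again.\<close>

lemma narrow_or_sparse:
  assumes k: "4 \<le> k"
  shows "narrow \<or> ((h + D)\<^sup>2 < 2 * h\<^sup>2 \<and> n choose (k - 3) \<le> D)"
proof (cases "n < 3 * k")
  case True
  then show ?thesis
    using small_cases[OF k _ nk] narrow_of_third narrow_or_sparse_of_small_case[OF k] by (meson not_le)
next
  case False
  then have n: "3 * k \<le> n" by simp
  show ?thesis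
  proof (cases "k \<le> 42 \<or> 16 * k \<le> 5 * n")
    case True then show ?thesis using gap_of_3_le[OF n k] binomial_minus3_le[OF n k] by blast
  next
    case False then show ?thesis using narrow_of_large by simp
  qed
qed

lemma gap_3: "k = 3 \<Longrightarrow> (h + D)\<^sup>2 < 2 * h\<^sup>2"
proof -
  assume k: "k = 3"
  define m where "m = n - 7"
  then have m: "n = m + 7" using nk k by simp
  have "h = 3 * m + 13" "D = m + 5" using hm_bound_3[OF k] D_3[OF k] m by simp_all
  then show ?thesis by (simp only: power2_eq_square) (simp add: algebra_simps)
qed

end

section \<open>The classification\<close>

lemma sum_card_link:
  assumes B: "B \<subseteq> nsets S k" and S: "finite S"
  shows "(\<Sum>x\<in>S. card (link x B)) = k * card B"
proof -
  have fin: "finite B" using finite_subset_nsets[OF B S] .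
  have "(\<Sum>x\<in>S. card (link x B)) = (\<Sum>x\<in>S. \<Sum>U\<in>B. if x \<in> U then 1 else 0)"
    by (rule sum.cong) (simp_all add: card_link flip: sum.inter_filter[OF fin])
  also have "\<dots> = (\<Sum>U\<in>B. \<Sum>x\<in>S. if x \<in> U then 1 else 0)" by (rule sum.swap)
  also have "\<dots> = (\<Sum>U\<in>B. k)"
  proof (rule sum.cong[OF refl])
    fix U assume "U \<in> B"
    then have "{x \<in> S. x \<in> U} = U" "card U = k" using B by (auto simp: nsets_def)
    then show "(\<Sum>x\<in>S. if x \<in> U then 1 else 0) = k" by (simp flip: sum.inter_filter[OF S])
  qed
  finally show ?thesis by simp
qed

context uniform_params begin

text \<open>With all degrees at most \<open>D + 1\<close>, counting incidences gives
  \<open>b \<le> n * (D + 1) / k\<close> for \<open>b = card B\<close>. From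
  \<open>card A + card B \<le> N + h\<close> a product of at least \<open>h\<^sup>2\<close> yields
  \<open>(h - b)\<^sup>2 \<le> b * (N - h)\<close>. For \<open>b < h\<close> the left side decreases
  and the right side increases with \<open>b\<close>, so the upper bound for \<open>b\<close> would
  satisfy this as well, against \<open>narrow\<close>.\<close>

lemma heavy_of_narrow:
  assumes nr: narrow and k: "4 \<le> k" and ad: "admissible A B" and prod: "h\<^sup>2 \<le> card A * card B"
  shows "heavy B"
proof (rule ccontr)
  assume "\<not> heavy B"
  then have le: "card (link x B) \<le> T" if "x \<in> {1..n}" for x using that by (auto simp: heavy_def not_less)
  have "k \<noteq> 3" using k by simp
  then have T: "T = D + 1" unfolding T_def by (rule if_not_P)
  let ?a = "card A" and ?b = "card B"
  have S: "finite {1..n}" "card {1..n} = n" by simp_all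
  have "k * ?b \<le> (\<Sum>x\<in>{1..n}. T)"
    unfolding sum_card_link[OF admissibleD(2)[OF ad] S(1), symmetric] by (rule sum_mono) (rule le)
  then have kb: "k * ?b \<le> n * (D + 1)" by (simp add: T)
  also have "\<dots> < k * h" using nr by (simp only: narrow_def)
  finally have bh: "?b < h" by simp
  show False
  proof (cases "D < ?b")
    case False
    have "?a * ?b \<le> ?a * D" using False by simp
    also have "\<dots> \<le> (h - 1)\<^sup>2"
    proof (rule nontrivial_imp_card_le[OF admissibleD(1,2)[OF ad] S admissibleD(3)[OF ad]])
      show "\<exists>V\<in>B. x \<notin> V" if "x \<in> {1..n}" for x using admissibleD(7)[OF ad that] by (auto simp: avoid_def)
    qed
    also have "\<dots> < h\<^sup>2" by (rule power_strict_mono) (use bh in auto)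
    finally show False using prod by simp
  next
    case True
    have "?a + ?b \<le> N + h"
    proof (cases "N < ?a")
      case True
      then show ?thesis using cross_sum_le_uniform[OF S admissibleD(1,2,3)[OF ad] \<open>D < ?b\<close>] by blast
    next
      case False then show ?thesis using bh by linarith
    qed
    then have "?a * ?b \<le> (N + h - ?b) * ?b" by (intro mult_right_mono) auto
    then have "int (h\<^sup>2) \<le> int ((N + h - ?b) * ?b)" using prod by (simp only: of_nat_le_iff)
    also have "\<dots> = (int N + int h - int ?b) * int ?b" using bh by (simp add: of_nat_diff)
    finally have "(int h - int ?b)\<^sup>2 \<le> int ?b * (int N - int h)" by (simp add: power2_eq_square algebra_simps)
    then have "int ((h - ?b)\<^sup>2) \<le> int (?b * (N - h))" using bh N_sub_h(2) by (simp add: of_nat_diff)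
    then have *: "(h - ?b)\<^sup>2 \<le> ?b * (N - h)" by (simp only: of_nat_le_iff)
    have "(k * h - n * (D + 1))\<^sup>2 \<le> (k * h - k * ?b)\<^sup>2" by (rule power_mono) (use kb in simp_all)
    also have "\<dots> = k\<^sup>2 * (h - ?b)\<^sup>2" by (simp only: right_diff_distrib'[symmetric] power_mult_distrib)
    also have "\<dots> \<le> k\<^sup>2 * (?b * (N - h))" by (rule mult_left_mono[OF *]) simp
    also have "\<dots> = k * (k * ?b) * (N - h)" by (simp only: power2_eq_square mult_ac)
    also have "\<dots> \<le> k * (n * (D + 1)) * (N - h)" by (intro mult_right_mono mult_left_mono kb) simp_all
    finally show False using nr by (simp add: narrow_def)
  qed
qed

lemma heavy_pair:
  assumes ad: "admissible A B" and prod: "h\<^sup>2 \<le> card A * card B"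
  shows "heavy A \<and> heavy B"
proof -
  have ba: "admissible B A" "h\<^sup>2 \<le> card B * card A" using ad prod by (simp_all add: admissible_commute mult.commute)
  have "heavy A \<and> heavy B" if "(h + D)\<^sup>2 < 2 * h\<^sup>2" "n choose (k - 3) \<le> D"
  proof -
    interpret sparse_params n k by unfold_locales (use that in auto)
    show ?thesis using no_light_pair[of A B] ad prod by (auto simp: light_pair_def)
  qed
  moreover have "heavy A \<and> heavy B" if narrow "4 \<le> k"
    using heavy_of_narrow[OF that] ad prod ba by blast
  moreover have "n choose (k - 3) \<le> D" if "k = 3" using D_3[OF that] that nk by simp
  ultimately show ?thesis using narrow_or_sparse gap_3 k3 by (cases "k = 3") auto
qed

end

lemma hm_bound_double:
  assumes "3 \<le> k"
  shows "2 * hm_bound (2 * k) k = 2 * k choose k"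
proof -
  have "2 * k choose k = (2 * k - 1 choose k) + (2 * k - 1 choose (k - 1))"
    by (rule choose_pred_split) (use assms in auto)
  moreover have "2 * k - 1 choose k = (2 * k - 1 choose (k - 1))"
    using binomial_symmetric[of k "2 * k - 1"] assms by (simp add: mult_2)
  moreover have "2 * k - k - 1 choose (k - 1) = 1" by (simp add: mult_2)
  moreover have "0 < (2 * k - 1 choose (k - 1))" by simp
  ultimately show ?thesis by (simp add: hm_bound_def)
qed

lemma eq_of_sum_product:
  fixes a b h :: nat
  assumes "a + b \<le> 2 * h" "a * b = h\<^sup>2"
  shows "a = h" "b = h"
proof -
  have "4 * (int a * int b) = (2 * int h)\<^sup>2" using assms(2) by (simp flip: of_nat_mult of_nat_power)
  moreover have "(int a + int b)\<^sup>2 \<le> (2 * int h)\<^sup>2" by (rule power_mono) (use assms(1) in auto)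
  ultimately have "(int a - int b)\<^sup>2 \<le> 0" by (simp add: power2_eq_square algebra_simps)
  then have ab: "a = b" by simp
  then have "a\<^sup>2 = h\<^sup>2" using assms(2) by (simp add: power2_eq_square)
  then show "a = h" "b = h" using ab by simp_all
qed

lemma complement_dual_eqI:
  assumes A: "A \<subseteq> nsets {1..2 * k} k" and B: "B \<subseteq> nsets {1..2 * k} k" and cr: "cross_intersecting A B"
    and sum: "card A + card B = 2 * k choose k"
  shows "B = complement_dual k A"
proof (rule card_subset_eq)
  let ?S = "{1..2 * k}" and ?C = "(\<lambda>U. {1..2 * k} - U) ` A"
  have eq: "complement_dual k A = nsets ?S k - ?C" by (auto simp: complement_dual_def)
  show "finite (complement_dual k A)" unfolding eq by (simp add: finite_imp_finite_nsets)
  show "B \<subseteq> complement_dual k A"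
    using B cr by (fastforce simp: complement_dual_def cross_intersecting_def)
  have "inj_on (\<lambda>U. ?S - U) A" using A by (intro inj_onI) (auto simp: nsets_def)
  then have "card ?C = card A" by (rule card_image)
  moreover have "?C \<subseteq> nsets ?S k" using A by (auto simp: nsets_def card_Diff_subset)
  then have "card (nsets ?S k - ?C) = card (nsets ?S k) - card ?C"
    by (intro card_Diff_subset) (auto intro: finite_subset finite_imp_finite_nsets)
  moreover have "card (nsets ?S k) = 2 * k choose k" by simp
  ultimately show "card B = card (complement_dual k A)" unfolding eq using sum by simp
qed

theorem theorem1p6:
  fixes n k :: nat and \<A> \<B> :: "nat set set"
  assumes "n \<ge> 2 * k" and "2 * k \<ge> 6"
    and "\<A> \<subseteq> nsets {1..n} k" and "\<B> \<subseteq> nsets {1..n} k"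
    and "nontrivial_cross_intersecting n \<A> \<B>"
    and "card \<A> * card \<B> = (hm_bound n k)\<^sup>2"
  shows "\<exists>p. isomorphic_pairs n (\<A>, \<B>) p \<and>
           (cross_HM_type n k p \<or> cross_triangle_type n k p \<or> complement_dual_type n k p)"
proof -
  have k3: "3 \<le> k" using assms(2) by simp
  \<comment> \<open>The three types range over all centres and all sets, so they are closed under
    permutations and the identity is enough.\<close>
  have iso: "isomorphic_pairs n (\<A>, \<B>) (\<A>, \<B>)"
    unfolding isomorphic_pairs_def by (rule exI[of _ id]) (simp add: permutes_id)
  have "cross_HM_type n k (\<A>, \<B>) \<or> cross_triangle_type n k (\<A>, \<B>) \<or> complement_dual_type n k (\<A>, \<B>)"
  proof (cases "n = 2 * k")
    case False
    then interpret uniform_params n k using assms(1) k3 by unfold_locales auto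
    have "admissible \<A> \<B>" using assms(3-5) by (simp add: admissible_def)
    then show ?thesis using heavy_pair heavy_structure assms(6) by (metis order_refl)
  next
    case True
    note sub = assms(3,4)[unfolded True]
    have cr: "cross_intersecting \<A> \<B>" and nt: "nontrivial (2 * k) \<A>"
      using assms(5) True by (simp_all add: nontrivial_cross_intersecting_def)
    have "card \<A> + card \<B> \<le> 2 * hm_bound (2 * k) k"
      unfolding hm_bound_double[OF k3] by (rule card_cross_intersecting_half[OF sub cr]) simp_all
    then have eq: "card \<A> = hm_bound (2 * k) k" "card \<B> = hm_bound (2 * k) k"
      using eq_of_sum_product assms(6) True by blast+
    then have "\<B> = complement_dual k \<A>"
      using complement_dual_eqI[OF sub cr] hm_bound_double[OF k3] by simp
    then show ?thesis using sub(1) nt eq(1) True by (auto simp: complement_dual_type_def)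
  qed
  then show ?thesis using iso by blast
qed

end
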